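(* Consider a one-parameter family of hyperbolic orthogonal ring patterns with $q=1-\epsilon$, with fixed boundary conditions, and with a limiting hyperbolic orthogonal circle pattern as $q\to1$. Then there exists an $\epsilon$-family of associated spacelike S$_1$-cmc pairs $\frac1\epsilon s$ and $\frac1\epsilon s^*$ in $\mathbb{R}^{2,1}$ with mean curvature $H=\epsilon$. In the limit $\epsilon\to0$ (surfaces being suitably translated), $s$ converges to a spacelike Koebe net with edges touching the (spacelike) unit sphere, and $\frac1\epsilon s^*$ converges to its dual S$_1$-maximal surface.
   Context: S-quad graph $\mathcal S$: here a simply connected set of squares of $\mathbb{Z}^2$, vertices properly bicolored white/black, white vertices labeled s or c ($V_w=V_s\,\dot\cup\,V_c$), each quad having one s- and one c-vertex. $\mathcal G$: quad graph with vertices $V_s$, edges $\leftrightarrow$ black vertices, faces $\leftrightarrow V_c$. Edges of $\mathcal G$ are horizontal/vertical alternating around faces; extended to $\mathcal S$: edge $(v,b)$ has the color of the $\mathcal G$-edge through $b$ if $v\in V_s$, the opposite color if $v\in V_c$. Hyperbolic orthogonal ring pattern on $\mathcal S$: rings $(p_v,r_v,R_v)$, $v\in V_w$ (concentric circles about $p_v$ in the hyperbolic plane with signed inner radius $r_v$ and outer radius $R_v>0$), such that for the two white vertices of each quad the outer circle of each ring intersects the inner circle of the other orthogonally; at each black vertex $b$ the inner circles of the rings at the horizontal neighbors and the outer circles at the vertical neighbors pass through one point $q_b$; the points $q_b$ around each ring are ordered counterclockwise if $r_v>0$, clockwise if $r_v<0$. There is a global $q\le1$ with $q\cosh R_v=\cosh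 r_v$; $q=1$ gives orthogonal circle patterns. Variables: $\cosh R_v=\frac1{q\operatorname{sn}(\gamma_v,q)}$, $\tanh R_v=\operatorname{dn}(\gamma_v,q)$, $\sinh r_v=\frac{\operatorname{cn}(\gamma_v,q)}{\operatorname{sn}(\gamma_v,q)}$; for $q=1$: $\cosh R=\coth\gamma^0$, $\sinh R=1/\sinh\gamma^0$. The family converges: $\gamma_v(q)\to\gamma_v^0$ as $q\to1$. Boundary conditions: prescribed boundary radii $\gamma$ (Dirichlet) or prescribed boundary cone angles (Neumann). $\mathbb{R}^{2,1}$: $\langle x,y\rangle=x_1y_1+x_2y_2-x_3y_3$, $\|x\|^2=\langle x,x\rangle$; spacelike unit sphere $\{\langle x,x\rangle=-1\}$, whose upper part $x_3>0$ is the hyperbolic plane. Timelike sphere: $\{\langle x-c,x-c\rangle=d^2\}$, $d^2>0$; two touch if they share a point with common tangent plane. In $\mathbb{R}^{3,2}$ ($\langle x,y\rangle_{3,2}=x_1y_1+x_2y_2+x_3y_3-x_4y_4-x_5y_5$, $e_0=\frac12(e_5-e_3)$, $e_\infty=\frac12(e_3+e_5)$, $x\in\mathbb{R}^{2,1}$ identified with $x_1e_1+x_2e_2+x_3e_4$) lift an oriented timelike sphere with center $c$ and signed radius $d$ to $\hat s=\frac1d(c+e_0+(\|c\|^2-d^2)e_\infty)$. A map $s$ from $V(\mathcal G)$ to oriented timelike spheres is (spacelike) S$_1$-isothermic if the centers of each face lie in a spacelike plane, $\hat s_{v_{ij}}-\hat s_v=a_{ij}(\hat s_{v_j}-\hat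 s_{v_i})$, $a_{ij}\in\mathbb{R}$, on each face ($(v,v_i)$ horizontal, $(v,v_j)$ vertical), and neighboring spheres touch, with $\langle\hat s_v,\hat s_{v'}\rangle_{3,2}=-1$ on horizontal, $+1$ on vertical edges. Christoffel dual: $c^*_{v'}-c^*_v=\lambda\frac{c_{v'}-c_v}{d_vd_{v'}}$, $d_v^*=\lambda/d_v$, $\lambda>0$ global, up to translation. $(s,s^* )$ is a spacelike S$_1$-cmc pair if, suitably scaled and translated, on all edges $\hat s^*_{v'}-\hat s_v=a_+(\hat s^*_v-\hat s_{v'})$, $a_+\in\mathbb{R}$ (possibly after reversing simultaneously all orientations of $s^*$) and all $c_v^*-c_v$ are timelike. Associated pair: the S$_1$-cmc pair $(s,s^* )$ (mean curvature $1$), unique up to translation, whose Gauss map up to global sign, $k=c-c^*$, is $k_v=\frac{\sqrt q}{\cosh r_v}p_v$, $v\in V_s$, with absolute vertex sphere radii $d_v=\frac1{2\sqrt q}(\operatorname{dn}\gamma_v+q\operatorname{cn}\gamma_v)$, $d_v^*=\frac1{2\sqrt q}(\operatorname{dn}\gamma_v-q\operatorname{cn}\gamma_v)$. Scaling the pair by $\mu$ while keeping the Gauss map gives $\mu s,\mu s^*$ with mean curvature $1/\mu$ (discrete mean curvature of a face: $-A(c,n)/A(c)$ with $n=c^*-c$ for the unscaled pair, $A(\cdot,\cdot)$ the mixed area in the spacelike face plane). Spacelike Koebe net: a net in $\mathbb{R}^{2,1}$ with planar spacelike faces all of whose edges touch the spacelike unit sphere, regarded as an S$_1$-isothermic surface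 with timelike vertex spheres centered at its vertices and passing through the adjacent points of tangency. S$_1$-maximal surface: an S$_1$-isothermic surface whose Christoffel dual (up to scaling) is a spacelike Koebe net. *)

theory Defs
  imports "HOL-Analysis.Analysis"
begin

section \<open>Lorentz space and the hyperbolic plane\<close>

definition lor :: "real^3 \<Rightarrow> real^3 \<Rightarrow> real" where
  "lor x y = x$1 * y$1 + x$2 * y$2 - x$3 * y$3"

definition hyperbolic_plane :: "(real^3) set" where
  "hyperbolic_plane = {x. lor x x = -1 \<and> x$3 > 0}"

definition hdist :: "real^3 \<Rightarrow> real^3 \<Rightarrow> real" where
  "hdist x y = arcosh (- lor x y)"

definition hcircle :: "real^3 \<Rightarrow> real \<Rightarrow> (real^3) set" where
  "hcircle p \<rho> = {x \<in> hyperbolic_plane. hdist p x = \<rho>}"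

text \<open>The component of \<open>y\<close> tangent to the hyperbolic plane at \<open>x\<close>; for \<open>y \<noteq> x\<close> in the hyperbolic
  plane it points along the geodesic from \<open>x\<close> to \<open>y\<close>.\<close>

definition hdirection :: "real^3 \<Rightarrow> real^3 \<Rightarrow> real^3" where
  "hdirection x y = y + lor x y *\<^sub>R x"

text \<open>A circle is perpendicular to its radii, so two circles meet orthogonally at \<open>x\<close> iff their radii
  at \<open>x\<close> do.\<close>

definition orthogonal_hcircles :: "real^3 \<Rightarrow> real \<Rightarrow> real^3 \<Rightarrow> real \<Rightarrow> bool" where
  "orthogonal_hcircles p \<rho> p' \<rho>' \<longleftrightarrow>
     hcircle p \<rho> \<inter> hcircle p' \<rho>' \<noteq> {} \<and>
     (\<forall>x \<in> hcircle p \<rho> \<inter> hcircle p' \<rho>'. lor (hdirection x p) (hdirection x p') = 0)"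

definition hangle :: "real^3 \<Rightarrow> real^3 \<Rightarrow> real^3 \<Rightarrow> real" where
  "hangle p x y =
     arccos (lor (hdirection p x) (hdirection p y) /
       (sqrt (lor (hdirection p x) (hdirection p x)) * sqrt (lor (hdirection p y) (hdirection p y))))"

definition hccw :: "real^3 \<Rightarrow> real^3 \<Rightarrow> real^3 \<Rightarrow> bool" where
  "hccw p x y \<longleftrightarrow> det (vector [p, x, y] :: real^3^3) > 0"

definition hyperbolic_motion :: "real^3^3 \<Rightarrow> bool" where
  "hyperbolic_motion A \<longleftrightarrow>
     (\<forall>x y. lor (A *v x) (A *v y) = lor x y) \<and> det A = 1 \<and>
     (\<forall>x \<in> hyperbolic_plane. A *v x \<in> hyperbolic_plane)"

section \<open>Jacobi elliptic functions with modulus k in [0,1]\<close>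

text \<open>The amplitude inverts the incomplete elliptic integral of the first kind. For \<open>k = 1\<close> the
  integral diverges at \<open>pi / 2\<close>, so the amplitude stays in \<open>(- pi / 2, pi / 2)\<close>.\<close>

definition jacobi_am :: "real \<Rightarrow> real \<Rightarrow> real" where
  "jacobi_am u k = (THE \<phi>.
     (0 \<le> \<phi> \<and> ((\<lambda>\<theta>. 1 / sqrt (1 - k\<^sup>2 * (sin \<theta>)\<^sup>2)) has_integral u) {0..\<phi>}) \<or>
     (\<phi> \<le> 0 \<and> ((\<lambda>\<theta>. 1 / sqrt (1 - k\<^sup>2 * (sin \<theta>)\<^sup>2)) has_integral - u) {\<phi>..0}))"

definition jacobi_sn :: "real \<Rightarrow> real \<Rightarrow> real" where
  "jacobi_sn u k = sin (jacobi_am u k)"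

definition jacobi_cn :: "real \<Rightarrow> real \<Rightarrow> real" where
  "jacobi_cn u k = cos (jacobi_am u k)"

definition jacobi_dn :: "real \<Rightarrow> real \<Rightarrow> real" where
  "jacobi_dn u k = sqrt (1 - k\<^sup>2 * (jacobi_sn u k)\<^sup>2)"

section \<open>S-quad graphs in the square lattice\<close>

type_synonym lattice_point = "int \<times> int"

text \<open>A square is named by its lower left corner. \<open>hor b\<close> tells whether the edge of the quad graph
  through the black vertex \<open>b\<close> is coloured horizontal; this need not be its direction in the lattice.\<close>

record lattice_graph =
  squares :: "lattice_point set"
  white :: "lattice_point \<Rightarrow> bool"
  svert :: "lattice_point \<Rightarrow> bool"
  hor :: "lattice_point \<Rightarrow> bool"

text \<open>Corners in counterclockwise order, \<open>k\<close> being read modulo 4.\<close>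

fun corner :: "lattice_point \<Rightarrow> nat \<Rightarrow> lattice_point" where
  "corner (i, j) k =
     (if k mod 4 = 0 then (i, j)
      else if k mod 4 = 1 then (i + 1, j)
      else if k mod 4 = 2 then (i + 1, j + 1)
      else (i, j + 1))"

text \<open>\<open>v, b, v', b'\<close> are the corners of a square, counterclockwise and with \<open>v\<close> white. Thus every square
  gives two such quadruples, and \<open>b\<close>, \<open>b'\<close> are counterclockwise successors around \<open>v\<close>.\<close>

definition quad :: "lattice_graph \<Rightarrow> lattice_point \<Rightarrow> lattice_point \<Rightarrow> lattice_point \<Rightarrow> lattice_point \<Rightarrow> bool" where
  "quad G v b v' b' \<longleftrightarrow>
     (\<exists>Q \<in> squares G. \<exists>k. v = corner Q k \<and> b = corner Q (k + 1) \<and> v' = corner Q (k + 2) \<and>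
        b' = corner Q (k + 3)) \<and> white G v"

fun side_adjacent :: "lattice_point \<Rightarrow> lattice_point \<Rightarrow> bool" where
  "side_adjacent (i, j) (i', j') \<longleftrightarrow> \<bar>i - i'\<bar> + \<bar>j - j'\<bar> = 1"

definition region :: "lattice_graph \<Rightarrow> (real \<times> real) set" where
  "region G = (\<Union>(i, j) \<in> squares G.
     cbox (real_of_int i, real_of_int j) (real_of_int i + 1, real_of_int j + 1))"

text \<open>The chain condition excludes pieces that are joined at a corner only, where the union of the
  squares is not a surface. The last clause says that horizontal and vertical edges alternate around
  the faces: the two black vertices of a square are consecutive edges of the face of its c-vertex.\<close>

definition s_quad_graph :: "lattice_graph \<Rightarrow> bool" where
  "s_quad_graph G \<longleftrightarrow>
     squares G \<noteq> {} \<and>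
     simply_connected (region G) \<and>
     (\<forall>Q \<in> squares G. \<forall>Q' \<in> squares G.
        (Q, Q') \<in> {(A, B). A \<in> squares G \<and> B \<in> squares G \<and> side_adjacent A B}\<^sup>*) \<and>
     (\<forall>Q \<in> squares G. \<forall>k. white G (corner Q k) \<noteq> white G (corner Q (k + 1))) \<and>
     (\<forall>v b v' b'. quad G v b v' b' \<longrightarrow> svert G v \<noteq> svert G v' \<and> hor G b \<noteq> hor G b')"

definition white_vertices :: "lattice_graph \<Rightarrow> lattice_point set" where
  "white_vertices G = {v. \<exists>b v' b'. quad G v b v' b'}"

definition s_vertices :: "lattice_graph \<Rightarrow> lattice_point set" where
  "s_vertices G = {v \<in> white_vertices G. svert G v}"

definition c_vertices :: "lattice_graph \<Rightarrow> lattice_point set" where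
  "c_vertices G = {v \<in> white_vertices G. \<not> svert G v}"

fun surrounding_squares :: "lattice_point \<Rightarrow> lattice_point set" where
  "surrounding_squares (i, j) = {(i, j), (i - 1, j), (i - 1, j - 1), (i, j - 1)}"

definition boundary_vertices :: "lattice_graph \<Rightarrow> lattice_point set" where
  "boundary_vertices G = {v \<in> white_vertices G. \<not> surrounding_squares v \<subseteq> squares G}"

text \<open>\<open>v\<close> is white, \<open>b\<close> is black, and both are joined by an edge of the S-quad graph.\<close>

definition incident :: "lattice_graph \<Rightarrow> lattice_point \<Rightarrow> lattice_point \<Rightarrow> bool" where
  "incident G v b \<longleftrightarrow> (\<exists>v' b'. quad G v b v' b' \<or> quad G v b' v' b)"

definition horizontal :: "lattice_graph \<Rightarrow> lattice_point \<Rightarrow> lattice_point \<Rightarrow> bool" where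
  "horizontal G v b \<longleftrightarrow> (if svert G v then hor G b else \<not> hor G b)"

text \<open>\<open>v\<close> and \<open>v'\<close> are joined by the edge of the quad graph on the s-vertices that passes through \<open>b\<close>.\<close>

definition s_edge :: "lattice_graph \<Rightarrow> lattice_point \<Rightarrow> lattice_point \<Rightarrow> lattice_point \<Rightarrow> bool" where
  "s_edge G b v v' \<longleftrightarrow>
     svert G v \<and> svert G v' \<and> v \<noteq> v' \<and> incident G v b \<and> incident G v' b"

text \<open>A c-vertex at the boundary of the S-quad graph has no complete face of the quad graph around it.\<close>

definition faces :: "lattice_graph \<Rightarrow> lattice_point set" where
  "faces G = {w \<in> c_vertices G. surrounding_squares w \<subseteq> squares G}"

text \<open>The vertices of the face of \<open>w\<close> in counterclockwise order, \<open>k\<close> being read modulo 4.\<close>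

fun face_vertex :: "lattice_point \<Rightarrow> nat \<Rightarrow> lattice_point" where
  "face_vertex (i, j) k =
     (if k mod 4 = 0 then (i - 1, j - 1)
      else if k mod 4 = 1 then (i + 1, j - 1)
      else if k mod 4 = 2 then (i + 1, j + 1)
      else (i - 1, j + 1))"

section \<open>Hyperbolic orthogonal ring patterns\<close>

text \<open>\<open>pt b\<close> is the point \<open>q\<^sub>b\<close> of the black vertex \<open>b\<close>.\<close>

record ring_data =
  ctr :: "lattice_point \<Rightarrow> real^3"
  inner_rad :: "lattice_point \<Rightarrow> real"
  outer_rad :: "lattice_point \<Rightarrow> real"
  pt :: "lattice_point \<Rightarrow> real^3"

text \<open>The inner circle has radius \<open>\<bar>inner_rad\<bar>\<close>; it is a circle with an orientation, hence not of
  radius zero. The points \<open>q\<^sub>b\<close> around a ring are ordered counterclockwise (clockwise) iff all pairs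
  of consecutive ones are, since the angle subtended at the centre by such a pair is less than \<open>pi\<close>.\<close>

definition ring_pattern :: "lattice_graph \<Rightarrow> real \<Rightarrow> ring_data \<Rightarrow> bool" where
  "ring_pattern G q P \<longleftrightarrow>
     0 < q \<and> q \<le> 1 \<and>
     (\<forall>v \<in> white_vertices G.
        ctr P v \<in> hyperbolic_plane \<and> outer_rad P v > 0 \<and> inner_rad P v \<noteq> 0 \<and>
        q * cosh (outer_rad P v) = cosh (inner_rad P v)) \<and>
     (\<forall>v b. incident G v b \<longrightarrow>
        pt P b \<in> hcircle (ctr P v) (if horizontal G v b then \<bar>inner_rad P v\<bar> else outer_rad P v)) \<and>
     (\<forall>v b v' b'. quad G v b v' b' \<longrightarrow>
        orthogonal_hcircles (ctr P v) (outer_rad P v) (ctr P v') \<bar>inner_rad P v'\<bar>) \<and>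
     (\<forall>v b v' b'. quad G v b v' b' \<longrightarrow>
        (inner_rad P v > 0 \<longrightarrow> hccw (ctr P v) (pt P b) (pt P b')) \<and>
        (inner_rad P v < 0 \<longrightarrow> hccw (ctr P v) (pt P b') (pt P b)))"

definition ring_variables ::
    "lattice_graph \<Rightarrow> real \<Rightarrow> ring_data \<Rightarrow> (lattice_point \<Rightarrow> real) \<Rightarrow> bool" where
  "ring_variables G q P \<gamma> \<longleftrightarrow>
     (\<forall>v \<in> white_vertices G.
        cosh (outer_rad P v) = 1 / (q * jacobi_sn (\<gamma> v) q) \<and>
        tanh (outer_rad P v) = jacobi_dn (\<gamma> v) q \<and>
        sinh (inner_rad P v) = jacobi_cn (\<gamma> v) q / jacobi_sn (\<gamma> v) q)"

definition cone_angle :: "lattice_graph \<Rightarrow> ring_data \<Rightarrow> lattice_point \<Rightarrow> real" where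
  "cone_angle G P v =
     (\<Sum>(b, b') \<in> {(b, b'). \<exists>v'. quad G v b v' b'}. hangle (ctr P v) (pt P b) (pt P b'))"

text \<open>At each boundary vertex either the radius (Dirichlet) or the cone angle (Neumann) is prescribed;
  pure Dirichlet and pure Neumann conditions are special cases.\<close>

definition fixed_boundary_conditions ::
    "lattice_graph \<Rightarrow> real set \<Rightarrow> (real \<Rightarrow> ring_data) \<Rightarrow> (real \<Rightarrow> lattice_point \<Rightarrow> real) \<Rightarrow> bool" where
  "fixed_boundary_conditions G E P \<gamma> \<longleftrightarrow>
     (\<forall>v \<in> boundary_vertices G.
        (\<exists>g. \<forall>\<epsilon> \<in> E. \<gamma> \<epsilon> v = g) \<or> (\<exists>\<Theta>. \<forall>\<epsilon> \<in> E. cone_angle G (P \<epsilon>) v = \<Theta>))"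

definition move_pattern :: "real^3^3 \<Rightarrow> ring_data \<Rightarrow> ring_data" where
  "move_pattern A P = P\<lparr>ctr := (\<lambda>v. A *v ctr P v), pt := (\<lambda>b. A *v pt P b)\<rparr>"

text \<open>The variables \<open>\<gamma>\<close> determine a ring pattern only up to a motion of the hyperbolic plane. The
  motions below place the patterns such that their centres converge as well.\<close>

definition normalizing_motions ::
    "lattice_graph \<Rightarrow> (real \<Rightarrow> ring_data) \<Rightarrow> ring_data \<Rightarrow> (real \<Rightarrow> real^3^3) \<Rightarrow> bool" where
  "normalizing_motions G P P0 M \<longleftrightarrow>
     (\<forall>\<epsilon>. hyperbolic_motion (M \<epsilon>)) \<and>
     (\<forall>v \<in> white_vertices G.
        ((\<lambda>\<epsilon>. ctr (move_pattern (M \<epsilon>) (P \<epsilon>)) v) \<longlongrightarrow> ctr P0 v) (at_right 0))"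

section \<open>Oriented timelike spheres\<close>

text \<open>Centre and signed radius; the radius is nonzero.\<close>

type_synonym oriented_sphere = "(real^3) \<times> real"
type_synonym sphere_map = "lattice_point \<Rightarrow> oriented_sphere"

definition sphere_points :: "oriented_sphere \<Rightarrow> (real^3) set" where
  "sphere_points S = {x. lor (x - fst S) (x - fst S) = (snd S)\<^sup>2}"

definition tangent_plane :: "oriented_sphere \<Rightarrow> real^3 \<Rightarrow> (real^3) set" where
  "tangent_plane S x = {y. lor (y - x) (x - fst S) = 0}"

definition spheres_touch :: "oriented_sphere \<Rightarrow> oriented_sphere \<Rightarrow> bool" where
  "spheres_touch S T \<longleftrightarrow>
     (\<exists>x \<in> sphere_points S \<inter> sphere_points T. tangent_plane S x = tangent_plane T x)"

definition inner32 :: "real^5 \<Rightarrow> real^5 \<Rightarrow> real" where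
  "inner32 x y = x$1 * y$1 + x$2 * y$2 + x$3 * y$3 - x$4 * y$4 - x$5 * y$5"

definition e_zero :: "real^5" where
  "e_zero = (1/2) *\<^sub>R (axis 5 1 - axis 3 1)"

definition e_inf :: "real^5" where
  "e_inf = (1/2) *\<^sub>R (axis 3 1 + axis 5 1)"

definition embed32 :: "real^3 \<Rightarrow> real^5" where
  "embed32 x = x$1 *\<^sub>R axis 1 1 + x$2 *\<^sub>R axis 2 1 + x$3 *\<^sub>R axis 4 1"

definition sphere_lift :: "oriented_sphere \<Rightarrow> real^5" where
  "sphere_lift S = (1 / snd S) *\<^sub>R
     (embed32 (fst S) + e_zero + (lor (fst S) (fst S) - (snd S)\<^sup>2) *\<^sub>R e_inf)"

definition scale_map :: "real \<Rightarrow> sphere_map \<Rightarrow> sphere_map" where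
  "scale_map \<mu> s = (\<lambda>v. (\<mu> *\<^sub>R fst (s v), \<mu> * snd (s v)))"

definition translate_map :: "real^3 \<Rightarrow> sphere_map \<Rightarrow> sphere_map" where
  "translate_map \<tau> s = (\<lambda>v. (fst (s v) + \<tau>, snd (s v)))"

definition reverse_map :: "sphere_map \<Rightarrow> sphere_map" where
  "reverse_map s = (\<lambda>v. (fst (s v), - snd (s v)))"

section \<open>S1-isothermic surfaces, Christoffel duals, S1-cmc pairs\<close>

text \<open>A plane is spacelike iff its normals are timelike.\<close>

definition spacelike_plane :: "(real^3) set \<Rightarrow> bool" where
  "spacelike_plane F \<longleftrightarrow> (\<exists>N h. lor N N < 0 \<and> F = {x. lor N x = h})"

definition planar_spacelike_faces :: "lattice_graph \<Rightarrow> (lattice_point \<Rightarrow> real^3) \<Rightarrow> bool" where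
  "planar_spacelike_faces G x \<longleftrightarrow>
     (\<forall>w \<in> faces G. \<exists>F. spacelike_plane F \<and> (\<forall>k. x (face_vertex w k) \<in> F))"

text \<open>In the third clause the roles of the horizontal and of the vertical neighbour need not be
  distinguished: exchanging them replaces \<open>a\<close> by \<open>-a\<close>.\<close>

definition s1_isothermic :: "lattice_graph \<Rightarrow> sphere_map \<Rightarrow> bool" where
  "s1_isothermic G s \<longleftrightarrow>
     (\<forall>v \<in> s_vertices G. snd (s v) \<noteq> 0) \<and>
     planar_spacelike_faces G (\<lambda>v. fst (s v)) \<and>
     (\<forall>w \<in> faces G. \<forall>k. \<exists>a.
        sphere_lift (s (face_vertex w (k + 2))) - sphere_lift (s (face_vertex w k)) =
        a *\<^sub>R (sphere_lift (s (face_vertex w (k + 3))) - sphere_lift (s (face_vertex w (k + 1))))) \<and>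
     (\<forall>b v v'. s_edge G b v v' \<longrightarrow>
        spheres_touch (s v) (s v') \<and>
        inner32 (sphere_lift (s v)) (sphere_lift (s v')) = (if hor G b then -1 else 1))"

definition christoffel_dual :: "lattice_graph \<Rightarrow> sphere_map \<Rightarrow> sphere_map \<Rightarrow> bool" where
  "christoffel_dual G s s' \<longleftrightarrow>
     (\<exists>\<kappa>>0.
        (\<forall>v \<in> s_vertices G. snd (s' v) = \<kappa> / snd (s v)) \<and>
        (\<forall>b v v'. s_edge G b v v' \<longrightarrow>
           fst (s' v') - fst (s' v) =
           (\<kappa> / (snd (s v) * snd (s v'))) *\<^sub>R (fst (s v') - fst (s v))))"

definition cmc_edge_condition :: "lattice_graph \<Rightarrow> sphere_map \<Rightarrow> sphere_map \<Rightarrow> bool" where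
  "cmc_edge_condition G s s' \<longleftrightarrow>
     (\<forall>b v v'. s_edge G b v v' \<longrightarrow>
        (\<exists>a. sphere_lift (s' v') - sphere_lift (s v) = a *\<^sub>R (sphere_lift (s' v) - sphere_lift (s v'))))"

text \<open>The pair in the scale and position in which the defining condition of S1-cmc pairs holds.\<close>

definition cmc_position :: "lattice_graph \<Rightarrow> sphere_map \<Rightarrow> sphere_map \<Rightarrow> bool" where
  "cmc_position G s s' \<longleftrightarrow>
     (cmc_edge_condition G s s' \<or> cmc_edge_condition G s (reverse_map s')) \<and>
     (\<forall>v \<in> s_vertices G. lor (fst (s' v) - fst (s v)) (fst (s' v) - fst (s v)) < 0)"

text \<open>Scaling and translating only \<open>s'\<close> is enough, since \<open>cmc_position\<close> is invariant under
  simultaneous similarities of \<open>s\<close> and \<open>s'\<close>.\<close>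

definition s1_cmc_pair :: "lattice_graph \<Rightarrow> sphere_map \<Rightarrow> sphere_map \<Rightarrow> bool" where
  "s1_cmc_pair G s s' \<longleftrightarrow>
     s1_isothermic G s \<and> s1_isothermic G s' \<and> christoffel_dual G s s' \<and>
     (\<exists>\<mu>>0. \<exists>\<tau>. cmc_position G s (translate_map \<tau> (scale_map \<mu> s')))"

text \<open>Mixed area of two quadrilaterals in planes with unit timelike normal \<open>N\<close>: the polarization of
  the area, half the determinant of the diagonals.\<close>

definition mixed_area ::
    "real^3 \<Rightarrow> lattice_point \<Rightarrow> (lattice_point \<Rightarrow> real^3) \<Rightarrow> (lattice_point \<Rightarrow> real^3) \<Rightarrow> real" where
  "mixed_area N w x y =
     (det (vector [x (face_vertex w 2) - x (face_vertex w 0),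
                   y (face_vertex w 3) - y (face_vertex w 1), N] :: real^3^3) +
      det (vector [y (face_vertex w 2) - y (face_vertex w 0),
                   x (face_vertex w 3) - x (face_vertex w 1), N] :: real^3^3)) / 4"

text \<open>The surface with vertices \<open>x\<close> and Gauss map \<open>n\<close> has discrete mean curvature \<open>H\<close> on all faces.
  The normal \<open>N\<close> is unique up to sign, which cancels in the quotient.\<close>

definition has_mean_curvature ::
    "lattice_graph \<Rightarrow> (lattice_point \<Rightarrow> real^3) \<Rightarrow> (lattice_point \<Rightarrow> real^3) \<Rightarrow> real \<Rightarrow> bool" where
  "has_mean_curvature G x n H \<longleftrightarrow>
     (\<forall>w \<in> faces G. \<exists>N. lor N N = -1 \<and>
        (\<forall>k l. lor N (x (face_vertex w k) - x (face_vertex w l)) = 0 \<and>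
               lor N (n (face_vertex w k) - n (face_vertex w l)) = 0) \<and>
        mixed_area N w x x \<noteq> 0 \<and>
        H = - mixed_area N w x n / mixed_area N w x x)"

definition gauss_map :: "sphere_map \<Rightarrow> sphere_map \<Rightarrow> lattice_point \<Rightarrow> real^3" where
  "gauss_map s s' = (\<lambda>v. fst (s' v) - fst (s v))"

definition associated_cmc_pair ::
    "lattice_graph \<Rightarrow> real \<Rightarrow> ring_data \<Rightarrow> (lattice_point \<Rightarrow> real) \<Rightarrow> sphere_map \<Rightarrow> sphere_map \<Rightarrow> bool" where
  "associated_cmc_pair G q P \<gamma> s s' \<longleftrightarrow>
     s1_cmc_pair G s s' \<and> cmc_position G s s' \<and>
     has_mean_curvature G (\<lambda>v. fst (s v)) (gauss_map s s') 1 \<and>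
     (\<exists>\<sigma> \<in> {1, -1}. \<forall>v \<in> s_vertices G.
        fst (s v) - fst (s' v) = (\<sigma> * sqrt q / cosh (inner_rad P v)) *\<^sub>R ctr P v) \<and>
     (\<forall>v \<in> s_vertices G.
        \<bar>snd (s v)\<bar> = (jacobi_dn (\<gamma> v) q + q * jacobi_cn (\<gamma> v) q) / (2 * sqrt q) \<and>
        \<bar>snd (s' v)\<bar> = (jacobi_dn (\<gamma> v) q - q * jacobi_cn (\<gamma> v) q) / (2 * sqrt q))"

section \<open>Koebe nets and S1-maximal surfaces\<close>

definition touches_unit_sphere_at :: "real^3 \<Rightarrow> real^3 \<Rightarrow> real^3 \<Rightarrow> bool" where
  "touches_unit_sphere_at x y t \<longleftrightarrow>
     t \<in> closed_segment x y \<and> lor t t = -1 \<and> lor t (y - x) = 0"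

definition spacelike_koebe_net :: "lattice_graph \<Rightarrow> (lattice_point \<Rightarrow> real^3) \<Rightarrow> bool" where
  "spacelike_koebe_net G x \<longleftrightarrow>
     planar_spacelike_faces G x \<and>
     (\<forall>b v v'. s_edge G b v v' \<longrightarrow> (\<exists>t. touches_unit_sphere_at (x v) (x v') t))"

definition spacelike_koebe_surface :: "lattice_graph \<Rightarrow> sphere_map \<Rightarrow> bool" where
  "spacelike_koebe_surface G s \<longleftrightarrow>
     spacelike_koebe_net G (\<lambda>v. fst (s v)) \<and> s1_isothermic G s \<and>
     (\<forall>b v v' t. s_edge G b v v' \<and> touches_unit_sphere_at (fst (s v)) (fst (s v')) t \<longrightarrow>
        t \<in> sphere_points (s v) \<inter> sphere_points (s v'))"

definition s1_maximal :: "lattice_graph \<Rightarrow> sphere_map \<Rightarrow> bool" where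
  "s1_maximal G s \<longleftrightarrow>
     s1_isothermic G s \<and> (\<exists>k. spacelike_koebe_surface G k \<and> christoffel_dual G s k)"

definition surfaces_converge ::
    "lattice_graph \<Rightarrow> (real \<Rightarrow> sphere_map) \<Rightarrow> sphere_map \<Rightarrow> bool" where
  "surfaces_converge G s s0 \<longleftrightarrow>
     (\<forall>v \<in> s_vertices G. ((\<lambda>\<epsilon>. s \<epsilon> v) \<longlongrightarrow> s0 v) (at_right 0))"

end

theory Submission
  imports Defs "HOL-Complex_Analysis.Cauchy_Integral_Formula"
begin

text \<open>
  Let \<open>u\<close> be the unit vector at the point \<open>q\<^sub>b\<close> towards the centre of a ring through it, with the sign
  of the radius. The orientation conditions force the vectors \<open>u\<close> of consecutive rings around a black
  vertex to arise from each other by a quarter turn, so the two rings of an edge lie on one geodesic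
  through \<open>q\<^sub>b\<close>. All surfaces are then integrated from a single closed form on the S-quad graph: at
  s-vertices its primitive \<open>F\<close> gives the centres of \<open>s\<^sup>*\<close> divided by \<open>1 - q\<close>, at black vertices the
  points of tangency and at c-vertices the centres of the circles through the points of tangency of a
  face. Together with the explicit Gauss map \<open>k\<close> this determines \<open>s = k + (1 - q) F\<close>. The increments
  of \<open>F\<close> depend continuously on the pattern up to \<open>q = 1\<close>, where \<open>s = k\<close> is a Koebe net and \<open>F\<close> its
  Christoffel dual. The form is exact because a simply connected set of squares has no holes.
\<close>

section \<open>Closed forms on the square lattice\<close>

text \<open>The factor 1 - q can be taken out of \<open>s\<^sup>*\<close> because radius times dual
  radius is a constant: q cosh R = cosh r gives tanh^2 R - q^2 tanh^2 r = 1 - q^2 and q^2 sinh^2 R -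
  sinh^2 r = 1 - q^2, so for vertex spheres and for the circles of faces the product is (1 - q^2) /
  (4 q). Division by 1 - q leaves \<open>dual_factor q\<close> = (1 + q) / (4 q), which is harmless
  at q = 1; the blow-up in the theorem is thus no limit of quotients.

  Three obstacles shape the proof. The orientation conditions concern one ring and two of its
  points, while the quarter turn concerns two rings and one point; the inequality |sinh r sinh r'|
  \<le> q sinh R sinh R' decides the signs. The set of squares may be infinite, so winding numbers
  are combined with a truncation. And an edge is given only by two s-vertices at one black vertex;
  that two consecutive squares join them requires the exclusion of vertices at which squares meet
  only in a corner.\<close>

lemma int_antidifference:
  fixes g :: "int \<Rightarrow> 'a::ab_group_add"
  obtains f where "\<And>i. f (i + 1) - f i = g i"
proof
  define f where "f i = (if 0 \<le> i then sum g {0..<i} else - sum g {i..<0})" for i :: int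
  fix i :: int
  show "f (i + 1) - f i = g i"
  proof (cases "0 \<le> i")
    case True
    then have "{0..<i + 1} = insert i {0..<i}" by auto
    then show ?thesis using True by (simp add: f_def)
  next
    case False
    then have "{i..<0} = insert i {i + 1..<0}" by auto
    then have "sum g {i..<0} = g i + sum g {i + 1..<0}" by simp
    then show ?thesis using False by (cases "i = -1") (auto simp: f_def)
  qed
qed

text \<open>Integrate along the axis j = 0 and then along every column. The vertical increments are
  right by construction; the defect of the horizontal ones does not depend on j, by closedness, and
  vanishes on the axis.\<close>

lemma lattice_form_exact:
  fixes h v :: "lattice_point \<Rightarrow> 'a::ab_group_add"
  assumes closed: "\<And>i j. h (i, j) + v (i + 1, j) = v (i, j) + h (i, j + 1)"
  obtains \<Phi> where "\<And>i j. \<Phi> (i + 1, j) - \<Phi> (i, j) = h (i, j)"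
    and "\<And>i j. \<Phi> (i, j + 1) - \<Phi> (i, j) = v (i, j)"
proof -
  obtain f where f: "\<And>i. f (i + 1) - f i = h (i, 0)"
    using int_antidifference[of "\<lambda>i. h (i, 0)"] by blast
  have "\<forall>i. \<exists>g. g (0::int) = f i \<and> (\<forall>j. g (j + 1) - g j = v (i, j))"
  proof
    fix i
    obtain g where g: "\<And>j. g (j + 1) - g j = v (i, j)"
      using int_antidifference[of "\<lambda>j. v (i, j)"] by blast
    then show "\<exists>g. g (0::int) = f i \<and> (\<forall>j. g (j + 1) - g j = v (i, j))"
      by (intro exI[of _ "\<lambda>j. g j - g 0 + f i"]) auto
  qed
  then obtain g where g0: "\<And>i. g i (0::int) = f i" and g: "\<And>i j. g i (j + 1) - g i j = v (i, j)"
    by metis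
  have step: "g (i + 1) (j + 1) - g i (j + 1) - h (i, j + 1) = g (i + 1) j - g i j - h (i, j)" for i j
  proof -
    have "g (i + 1) (j + 1) = v (i + 1, j) + g (i + 1) j" "g i (j + 1) = v (i, j) + g i j"
      using g by (metis diff_add_cancel)+
    moreover have "h (i, j + 1) = h (i, j) + v (i + 1, j) - v (i, j)"
      using closed[of i j] by (simp add: algebra_simps)
    ultimately show ?thesis by (simp add: algebra_simps)
  qed
  have "g (i + 1) j - g i j - h (i, j) = 0" for i j
  proof (induction j rule: int_induct[where k = 0])
    case base
    show ?case using f g0 by simp
  next
    case (step1 j)
    then show ?case using step[of i j] by simp
  next
    case (step2 j)
    then show ?case using step[of i "j - 1"] by simp
  qed
  then have hh: "g (i + 1) j - g i j = h (i, j)" for i j by simp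
  show thesis
    by (rule that[of "\<lambda>(i, j). g i j"]) (use hh g in auto)
qed

section \<open>Winding numbers around squares as forms on the lattice\<close>

definition to_complex :: "lattice_point \<Rightarrow> complex" where
  "to_complex x = Complex (of_int (fst x)) (of_int (snd x))"

definition square_centre :: "lattice_point \<Rightarrow> complex" where
  "square_centre x = to_complex x + Complex (1/2) (1/2)"

definition complex_square :: "lattice_point \<Rightarrow> complex set" where
  "complex_square x = cbox (to_complex x) (to_complex x + Complex 1 1)"

definition complex_region :: "lattice_graph \<Rightarrow> complex set" where
  "complex_region G = (\<Union>Q \<in> squares G. complex_square Q)"

text \<open>The linear bijection of pairs with complex numbers is a homeomorphism of the regions; it
  carries the hypothesis to the plane of the winding numbers.\<close>

lemma simply_connected_complex_region:
  assumes "simply_connected (region G)"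
  shows "simply_connected (complex_region G)"
proof -
  define f where "f = (\<lambda>(x, y). Complex x y)"
  have inj: "inj f" by (auto simp: f_def inj_def)
  have lin: "linear f"
    by (auto intro!: linearI simp: f_def complex_eq_iff)
  have *: "f ` cbox (a, b) (c, d) = cbox (Complex a b) (Complex c d)" for a b c d
  proof
    show "cbox (Complex a b) (Complex c d) \<subseteq> f ` cbox (a, b) (c, d)"
    proof
      fix z assume "z \<in> cbox (Complex a b) (Complex c d)"
      then have "f (Re z, Im z) = z" "(Re z, Im z) \<in> cbox (a, b) (c, d)"
        by (auto simp: f_def in_cbox_complex_iff cbox_Pair_eq)
      then show "z \<in> f ` cbox (a, b) (c, d)" by (metis imageI)
    qed
  qed (auto simp: f_def in_cbox_complex_iff cbox_Pair_eq)
  have "f ` region G = complex_region G"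
    unfolding region_def complex_region_def complex_square_def image_UN
    by (intro SUP_cong) (auto simp: * to_complex_def complex_eq_iff split: prod.splits
        intro!: arg_cong2[where f = cbox])
  moreover have "region G homeomorphic f ` region G"
    using linear_homeomorphic_image[OF lin inj] .
  ultimately show ?thesis
    using assms homeomorphic_simply_connected by metis
qed

definition lattice_edge :: "lattice_graph \<Rightarrow> lattice_point \<Rightarrow> lattice_point \<Rightarrow> bool" where
  "lattice_edge G x y \<longleftrightarrow>
     (\<exists>Q \<in> squares G. \<exists>k. (x = corner Q k \<and> y = corner Q (k + 1)) \<or> (y = corner Q k \<and> x = corner Q (k + 1)))"

lemma corner_cases:
  obtains "corner (i, j) k = (i, j)" "corner (i, j) (k + 1) = (i + 1, j)" "corner (i, j) (k + 2) = (i + 1, j + 1)" "corner (i, j) (k + 3) = (i, j + 1)"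
  | "corner (i, j) k = (i + 1, j)" "corner (i, j) (k + 1) = (i + 1, j + 1)" "corner (i, j) (k + 2) = (i, j + 1)" "corner (i, j) (k + 3) = (i, j)"
  | "corner (i, j) k = (i + 1, j + 1)" "corner (i, j) (k + 1) = (i, j + 1)" "corner (i, j) (k + 2) = (i, j)" "corner (i, j) (k + 3) = (i + 1, j)"
  | "corner (i, j) k = (i, j + 1)" "corner (i, j) (k + 1) = (i, j)" "corner (i, j) (k + 2) = (i + 1, j)" "corner (i, j) (k + 3) = (i + 1, j + 1)"
proof -
  have "k mod 4 < 4" by simp
  then consider "k mod 4 = 0" | "k mod 4 = 1" | "k mod 4 = 2" | "k mod 4 = 3"
    by linarith
  then show thesis
  proof cases
    case 1
    moreover from this have "(k + 1) mod 4 = 1" "(k + 2) mod 4 = 2" "(k + 3) mod 4 = 3"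
      by presburger+
    ultimately show ?thesis by (intro that(1)) (simp_all del: mod_add_left_eq mod_add_right_eq)
  next
    case 2
    moreover from this have "(k + 1) mod 4 = 2" "(k + 2) mod 4 = 3" "(k + 3) mod 4 = 0"
      by presburger+
    ultimately show ?thesis by (intro that(2)) simp_all
  next
    case 3
    moreover from this have "(k + 1) mod 4 = 3" "(k + 2) mod 4 = 0" "(k + 3) mod 4 = 1"
      by presburger+
    ultimately show ?thesis by (intro that(3)) simp_all
  next
    case 4
    moreover from this have "(k + 1) mod 4 = 0" "(k + 2) mod 4 = 1" "(k + 3) mod 4 = 2"
      by presburger+
    ultimately show ?thesis by (intro that(4)) simp_all
  qed
qed

declare corner.simps[simp del]

lemma lattice_edge_sym: "lattice_edge G x y \<Longrightarrow> lattice_edge G y x"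
  unfolding lattice_edge_def by blast

lemma lattice_edge_cases:
  assumes "lattice_edge G x y"
  obtains i j where "x = (i, j)" "y = (i + 1, j)" | i j where "y = (i, j)" "x = (i + 1, j)"
  | i j where "x = (i, j)" "y = (i, j + 1)" | i j where "y = (i, j)" "x = (i, j + 1)"
proof -
  obtain i j k where *: "(x = corner (i, j) k \<and> y = corner (i, j) (k + 1)) \<or> (y = corner (i, j) k \<and> x = corner (i, j) (k + 1))"
    using assms unfolding lattice_edge_def by auto
  show thesis
  proof (cases rule: corner_cases[of i j k])
    case 1
    with * show ?thesis using that(1,2)[of i j] by metis
  next
    case 2
    with * show ?thesis using that(3,4)[of "i + 1" j] by metis
  next
    case 3
    with * show ?thesis using that(1,2)[of i "j + 1"] by metis
  next
    case 4
    with * show ?thesis using that(3,4)[of i j] by metis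
  qed
qed

definition circulation :: "(lattice_point \<Rightarrow> lattice_point \<Rightarrow> 'a::ab_group_add) \<Rightarrow> lattice_point \<Rightarrow> 'a" where
  "circulation \<omega> Q = \<omega> (corner Q 0) (corner Q 1) + \<omega> (corner Q 1) (corner Q 2) +
     \<omega> (corner Q 2) (corner Q 3) + \<omega> (corner Q 3) (corner Q 0)"

text \<open>The discrete version of d arg / (2 pi) around the centre of \<open>Q\<close>: the
  segment is not closed, so its winding number is no integer, and the real part is the swept angle
  divided by 2 pi.\<close>

definition winding_form :: "lattice_point \<Rightarrow> lattice_point \<Rightarrow> lattice_point \<Rightarrow> real" where
  "winding_form Q x y = Re (winding_number (linepath (to_complex x) (to_complex y)) (square_centre Q))"

text \<open>Centres have half-integral coordinates, so they avoid all lattice edges and the winding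
  numbers of lattice paths around them are meaningful.\<close>

lemma square_centre_notin_hor:
  "square_centre Q \<notin> closed_segment (to_complex (i, j)) (to_complex (i', j))"
proof
  assume "square_centre Q \<in> closed_segment (to_complex (i, j)) (to_complex (i', j))"
  then have "Im (square_centre Q) = of_int j"
    by (subst (asm) closed_segment_same_Im) (auto simp: to_complex_def)
  then have "2 * real_of_int (snd Q) + 1 = 2 * of_int j"
    by (simp add: square_centre_def to_complex_def)
  then have "2 * snd Q + 1 = 2 * j" by linarith
  then show False by presburger
qed

lemma square_centre_notin_vert:
  "square_centre Q \<notin> closed_segment (to_complex (i, j)) (to_complex (i, j'))"
proof
  assume "square_centre Q \<in> closed_segment (to_complex (i, j)) (to_complex (i, j'))"
  then have "Re (square_centre Q) = of_int i"
    by (subst (asm) closed_segment_same_Re) (auto simp: to_complex_def)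
  then have "2 * real_of_int (fst Q) + 1 = 2 * of_int i"
    by (simp add: square_centre_def to_complex_def)
  then have "2 * fst Q + 1 = 2 * i" by linarith
  then show False by presburger
qed

lemma circulation_winding_form:
  "circulation (winding_form Q) Q' =
     Re (winding_number (rectpath (to_complex Q') (to_complex Q' + Complex 1 1)) (square_centre Q))"
proof -
  obtain i j where Q': "Q' = (i, j)" by (cases Q')
  have c: "to_complex (i, j) + Complex 1 1 = to_complex (i + 1, j + 1)"
    "Complex (Re (to_complex (i + 1, j + 1))) (Im (to_complex (i, j))) = to_complex (i + 1, j)"
    "Complex (Re (to_complex (i, j))) (Im (to_complex (i + 1, j + 1))) = to_complex (i, j + 1)"
    by (auto simp: to_complex_def complex_eq_iff)
  show ?thesis
    unfolding circulation_def winding_form_def rectpath_def Let_def Q' c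
    using square_centre_notin_hor[of Q] square_centre_notin_vert[of Q]
    by (simp add: winding_number_join not_in_path_image_join corner.simps)
qed

lemma circulation_winding_form_other:
  assumes "Q' \<noteq> Q"
  shows "circulation (winding_form Q) Q' = 0"
proof -
  have "square_centre Q \<notin> cbox (to_complex Q') (to_complex Q' + Complex 1 1)"
  proof
    assume "square_centre Q \<in> cbox (to_complex Q') (to_complex Q' + Complex 1 1)"
    then have "real_of_int (fst Q') \<le> of_int (fst Q) + 1/2" "of_int (fst Q) + 1/2 \<le> real_of_int (fst Q') + 1"
      "real_of_int (snd Q') \<le> of_int (snd Q) + 1/2" "of_int (snd Q) + 1/2 \<le> real_of_int (snd Q') + 1"
      by (auto simp: in_cbox_complex_iff square_centre_def to_complex_def)
    then have "fst Q = fst Q'" "snd Q = snd Q'" by linarith+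
    then show False using assms by (simp add: prod_eq_iff)
  qed
  moreover have "path_image (rectpath (to_complex Q') (to_complex Q' + Complex 1 1))
      \<subseteq> cbox (to_complex Q') (to_complex Q' + Complex 1 1)"
    by (rule path_image_rectpath_subset_cbox) auto
  ultimately show ?thesis
    unfolding circulation_winding_form
    by (subst winding_number_zero_outside[OF _ convex_box(1)]) auto
qed

text \<open>The winding number of the boundary is an integer of modulus 1, hence its real part is
  not zero. Its sign may stay open, as it is only divided by.\<close>

lemma circulation_winding_form_self: "circulation (winding_form Q) Q \<noteq> 0"
proof -
  let ?a = "to_complex Q" and ?b = "to_complex Q + Complex 1 1"
  have "square_centre Q \<in> box ?a ?b"
    by (auto simp: in_box_complex_iff square_centre_def to_complex_def)
  then have "square_centre Q \<in> interior (cbox ?a ?b)" by simp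
  then have "square_centre Q \<in> inside (frontier (cbox ?a ?b))"
    using interior_inside_frontier[of "cbox ?a ?b"] by auto
  then have "square_centre Q \<in> inside (path_image (rectpath ?a ?b))"
    by (subst path_image_rectpath_cbox_minus_box) (auto simp: frontier_cbox)
  moreover have "simple_path (rectpath ?a ?b)" by (rule simple_path_rectpath) auto
  ultimately have "cmod (winding_number (rectpath ?a ?b) (square_centre Q)) = 1"
    using simple_closed_path_norm_winding_number_inside by auto
  moreover have "winding_number (rectpath ?a ?b) (square_centre Q) \<in> \<int>"
    using \<open>square_centre Q \<in> inside (path_image (rectpath ?a ?b))\<close>
    by (intro integer_winding_number) (auto simp: inside_def)
  ultimately show ?thesis
    unfolding circulation_winding_form by (auto elim!: Ints_cases)
qed

lemma s_quad_graph_square_induct [consumes 3, case_names start step]: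
  assumes "s_quad_graph G" "Q0 \<in> squares G" "Q \<in> squares G"
    and "P Q0"
    and step: "\<And>A B. A \<in> squares G \<Longrightarrow> B \<in> squares G \<Longrightarrow> side_adjacent A B \<Longrightarrow> P A \<Longrightarrow> P B"
  shows "P Q"
proof -
  have "(Q0, Q) \<in> {(A, B). A \<in> squares G \<and> B \<in> squares G \<and> side_adjacent A B}\<^sup>*"
    using assms unfolding s_quad_graph_def by blast
  then show ?thesis
    by induction (use assms(4) step in auto)
qed

lemma lattice_edge_corner:
  assumes "Q \<in> squares G"
  shows "lattice_edge G (corner Q k) (corner Q (k + 1))" "lattice_edge G (corner Q (k + 1)) (corner Q k)"
  using assms unfolding lattice_edge_def by auto

lemma corner_mod: "corner Q (k mod 4) = corner Q k"
  by (cases Q) (simp add: corner.simps)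

lemma lattice_edge_square:
  assumes "Q \<in> squares G"
  shows "lattice_edge G (corner Q 0) (corner Q 1)" "lattice_edge G (corner Q 1) (corner Q 2)"
    "lattice_edge G (corner Q 2) (corner Q 3)" "lattice_edge G (corner Q 3) (corner Q 0)"
  using lattice_edge_corner(1)[OF assms, of 0] lattice_edge_corner(1)[OF assms, of 1]
    lattice_edge_corner(1)[OF assms, of 2] lattice_edge_corner(1)[OF assms, of 3]
    corner_mod[of Q 4, symmetric]
  by (simp_all add: eval_nat_numeral)

lemma side_adjacent_common_edge:
  assumes "side_adjacent A B"
  obtains k l where "corner A k = corner B (l + 1)" "corner A (k + 1) = corner B l"
proof -
  obtain i j i' j' where AB: "A = (i, j)" "B = (i', j')" by (cases A, cases B)
  then consider "i' = i + 1" "j' = j" | "i' = i - 1" "j' = j" | "i' = i" "j' = j + 1" | "i' = i" "j' = j - 1"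
    using assms by fastforce
  then show thesis
  proof cases
    case 1 then show thesis using AB by (intro that[of 1 3]) (auto simp: corner.simps)
  next
    case 2 then show thesis using AB by (intro that[of 3 1]) (auto simp: corner.simps)
  next
    case 3 then show thesis using AB by (intro that[of 2 0]) (auto simp: corner.simps)
  next
    case 4 then show thesis using AB by (intro that[of 0 2]) (auto simp: corner.simps)
  qed
qed

text \<open>A property passes around a square along its sides and into a side-adjacent square
  through the common side, so the chain condition brings it from one corner to all.\<close>

lemma lattice_edge_induct:
  assumes G: "s_quad_graph G" and Q: "Q0 \<in> squares G" "Q \<in> squares G"
    and P: "P (corner Q0 k0)"
    and step: "\<And>x y. lattice_edge G x y \<Longrightarrow> P x \<Longrightarrow> P y"
  shows "P (corner Q k)"
proof -
  have all: "\<forall>l. P (corner Q l)" if "Q \<in> squares G" "P (corner Q k)" for Q k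
  proof
    fix l
    have up: "P (corner Q (k + n))" for n
    proof (induction n)
      case (Suc n)
      then show ?case using step[OF lattice_edge_corner(1)[OF that(1), of "k + n"]] by simp
    qed (use that in simp)
    \<comment> \<open>Going forward by \<open>l + 3 * k\<close> from corner \<open>k\<close> ends at
      \<open>l + 4 * k\<close>, which is corner \<open>l\<close>.\<close>
    have "(k + (l + 3 * k)) mod 4 = l mod 4"
      using mod_mult_self2[of l 4 k] by (simp add: algebra_simps)
    then have "corner Q (k + (l + 3 * k)) = corner Q l" by (metis corner_mod)
    then show "P (corner Q l)" using up[of "l + 3 * k"] by simp
  qed
  from G Q have "\<forall>l. P (corner Q l)"
  proof (induction rule: s_quad_graph_square_induct)
    case start
    then show ?case using all[OF Q(1) P] .
  next
    case (step A B)
    then show ?case using all[of B] side_adjacent_common_edge[of A B] by metis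
  qed
  then show ?thesis by blast
qed

lemma complex_square_convex: "convex (complex_square Q)"
  unfolding complex_square_def by (rule convex_box)

lemma to_complex_corner: "to_complex (corner Q k) \<in> complex_square Q"
proof -
  obtain i j where Q: "Q = (i, j)" by (cases Q)
  show ?thesis
    unfolding Q complex_square_def
    by (cases rule: corner_cases[of i j k]) (simp_all add: in_cbox_complex_iff to_complex_def)
qed

lemma lattice_edge_segment:
  assumes "lattice_edge G x y"
  shows "closed_segment (to_complex x) (to_complex y) \<subseteq> complex_region G"
    and "square_centre Q \<notin> closed_segment (to_complex x) (to_complex y)"
proof -
  obtain Q' k where "Q' \<in> squares G" "{x, y} \<subseteq> {corner Q' k, corner Q' (k + 1)}"
    using assms unfolding lattice_edge_def by blast
  then have "to_complex x \<in> complex_square Q'" "to_complex y \<in> complex_square Q'"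
    using to_complex_corner[of Q' k] to_complex_corner[of Q' "k + 1"] by auto
  then have "closed_segment (to_complex x) (to_complex y) \<subseteq> complex_square Q'"
    by (intro closed_segment_subset complex_square_convex)
  then show "closed_segment (to_complex x) (to_complex y) \<subseteq> complex_region G"
    using \<open>Q' \<in> squares G\<close> unfolding complex_region_def by blast
  show "square_centre Q \<notin> closed_segment (to_complex x) (to_complex y)"
    using assms by (cases rule: lattice_edge_cases)
      (use square_centre_notin_hor square_centre_notin_vert in auto)
qed

lemma square_centre_in_complex_square_iff: "square_centre Q \<in> complex_square Q' \<longleftrightarrow> Q = Q'"
proof
  assume "square_centre Q \<in> complex_square Q'"
  then have "real_of_int (fst Q') \<le> of_int (fst Q) + 1/2" "of_int (fst Q) + 1/2 \<le> real_of_int (fst Q') + 1"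
    "real_of_int (snd Q') \<le> of_int (snd Q) + 1/2" "of_int (snd Q) + 1/2 \<le> real_of_int (snd Q') + 1"
    by (auto simp: complex_square_def in_cbox_complex_iff square_centre_def to_complex_def)
  then have "fst Q = fst Q'" "snd Q = snd Q'" by linarith+
  then show "Q = Q'" by (simp add: prod_eq_iff)
qed (auto simp: complex_square_def in_cbox_complex_iff square_centre_def to_complex_def)

definition lattice_box :: "int \<Rightarrow> lattice_point set" where
  "lattice_box m = {- m..m} \<times> {- m..m}"

definition complex_box :: "int \<Rightarrow> complex set" where
  "complex_box m = cbox (Complex (- of_int m) (- of_int m)) (Complex (of_int m) (of_int m))"

lemma to_complex_in_box_iff: "to_complex x \<in> complex_box m \<longleftrightarrow> x \<in> lattice_box m"
  by (cases x) (auto simp: complex_box_def lattice_box_def to_complex_def in_cbox_complex_iff)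

lemma complex_box_mono: "m \<le> n \<Longrightarrow> complex_box m \<subseteq> complex_box n"
  by (auto simp: complex_box_def in_cbox_complex_iff)

lemma square_centre_in_box:
  assumes "square_centre Q \<in> complex_box m"
  shows "corner Q k \<in> lattice_box m"
proof -
  obtain i j where Q: "Q = (i, j)" by (cases Q)
  have "- real_of_int m \<le> i + 1/2" "i + 1/2 \<le> real_of_int m" "- real_of_int m \<le> j + 1/2" "j + 1/2 \<le> real_of_int m"
    using assms by (auto simp: Q complex_box_def in_cbox_complex_iff square_centre_def to_complex_def)
  then have "- m \<le> i" "i + 1 \<le> m" "- m \<le> j" "j + 1 \<le> m" by linarith+
  then show ?thesis
    unfolding Q lattice_box_def by (cases rule: corner_cases[of i j k]) simp_all
qed

lemma circulation_diff_sum: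
  fixes c :: "lattice_point \<Rightarrow> 'a::real_vector"
  shows "circulation (\<lambda>x y. \<omega> x y - (\<Sum>Q\<in>S. f Q x y *\<^sub>R c Q)) Q' =
     circulation \<omega> Q' - (\<Sum>Q\<in>S. circulation (f Q) Q' *\<^sub>R c Q)"
  by (simp add: circulation_def sum.distrib scaleR_left.add algebra_simps)

lemma winding_form_antisym:
  assumes "square_centre Q \<notin> closed_segment (to_complex x) (to_complex y)"
  shows "winding_form Q y x = - winding_form Q x y"
proof -
  have "winding_number (reversepath (linepath (to_complex x) (to_complex y))) (square_centre Q) =
      - winding_number (linepath (to_complex x) (to_complex y)) (square_centre Q)"
    using assms by (intro winding_number_reversepath) auto
  then show ?thesis by (simp add: winding_form_def reversepath_linepath)
qed

text \<open>A winding form has circulation around a single square, so finitely many multiples absorb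
  all circulation of \<omega>; the remainder is closed on the whole lattice and has a potential. No
  correction is made where the circulation is already zero, which later limits the squares to be
  discussed.\<close>

lemma winding_forms_span:
  fixes \<omega> :: "lattice_point \<Rightarrow> lattice_point \<Rightarrow> 'a::real_vector"
  assumes fin: "finite S" and supp: "\<And>Q. circulation \<omega> Q \<noteq> 0 \<Longrightarrow> Q \<in> S"
    and anti: "\<And>x y. \<omega> y x = - \<omega> x y"
  obtains c \<Phi> where "\<And>Q. circulation \<omega> Q = 0 \<Longrightarrow> c Q = 0"
    and "\<And>G x y. lattice_edge G x y \<Longrightarrow> \<omega> x y = (\<Sum>Q\<in>S. winding_form Q x y *\<^sub>R c Q) + (\<Phi> y - \<Phi> x)"
proof -
  define c where "c Q = (1 / circulation (winding_form Q) Q) *\<^sub>R circulation \<omega> Q" for Q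
  define \<beta> where "\<beta> x y = \<omega> x y - (\<Sum>Q\<in>S. winding_form Q x y *\<^sub>R c Q)" for x y
  have "circulation \<beta> Q' = 0" for Q'
  proof -
    have "(\<Sum>Q\<in>S. circulation (winding_form Q) Q' *\<^sub>R c Q) =
        (\<Sum>Q\<in>S. if Q = Q' then circulation \<omega> Q' else 0)"
      by (intro sum.cong) (auto simp: c_def circulation_winding_form_self circulation_winding_form_other)
    also have "\<dots> = circulation \<omega> Q'" using fin supp[of Q'] by auto
    finally show ?thesis unfolding \<beta>_def circulation_diff_sum by simp
  qed
  note circ = this
  have anti_h: "\<beta> (i + 1, j) (i, j) = - \<beta> (i, j) (i + 1, j)" for i j
    unfolding \<beta>_def using anti[of "(i, j)" "(i + 1, j)"] winding_form_antisym[OF square_centre_notin_hor[of _ i j "i + 1"]] by (simp add: sum_negf)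
  have anti_v: "\<beta> (i, j + 1) (i, j) = - \<beta> (i, j) (i, j + 1)" for i j
    unfolding \<beta>_def using anti[of "(i, j)" "(i, j + 1)"] winding_form_antisym[OF square_centre_notin_vert[of _ i j "j + 1"]] by (simp add: sum_negf)
  define h where "h = (\<lambda>(i, j). \<beta> (i, j) (i + 1, j))"
  define v where "v = (\<lambda>(i, j). \<beta> (i, j) (i, j + 1))"
  have "h (i, j) + v (i + 1, j) = v (i, j) + h (i, j + 1)" for i j
    using circ[of "(i, j)"] anti_h[of i "j + 1"] anti_v[of i j]
    by (simp add: circulation_def corner.simps h_def v_def algebra_simps)
  then obtain \<Phi> where \<Phi>: "\<And>i j. \<Phi> (i + 1, j) - \<Phi> (i, j) = h (i, j)" "\<And>i j. \<Phi> (i, j + 1) - \<Phi> (i, j) = v (i, j)"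
    using lattice_form_exact[of h v] by metis
  have "\<beta> x y = \<Phi> y - \<Phi> x" if "lattice_edge G x y" for G x y
    using that
  proof (cases rule: lattice_edge_cases)
    case (1 i j) then show ?thesis using \<Phi>(1)[of i j] by (simp add: h_def)
  next
    case (2 i j) then show ?thesis using \<Phi>(1)[of i j] anti_h[of i j] by (simp add: h_def algebra_simps)
  next
    case (3 i j) then show ?thesis using \<Phi>(2)[of i j] by (simp add: v_def)
  next
    case (4 i j) then show ?thesis using \<Phi>(2)[of i j] anti_v[of i j] by (simp add: v_def algebra_simps)
  qed
  then show thesis
    by (intro that[of c \<Phi>]) (auto simp: c_def \<beta>_def algebra_simps)
qed

text \<open>Truncated to a box and corrected by multiples of winding forms around the centres of squares, the form
  is closed on the whole lattice, hence exact. The squares that need a correction lie outside the graph or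
  reach out of the box, so their winding forms have no periods on loops of the graph inside the box: its
  region is simply connected.\<close>

theorem discrete_poincare:
  fixes \<omega> :: "lattice_point \<Rightarrow> lattice_point \<Rightarrow> 'a::real_vector"
  assumes G: "s_quad_graph G"
    and closed: "\<And>Q. Q \<in> squares G \<Longrightarrow> circulation \<omega> Q = 0"
    and anti: "\<And>x y. lattice_edge G x y \<Longrightarrow> \<omega> y x = - \<omega> x y"
  obtains F where "\<And>x y. lattice_edge G x y \<Longrightarrow> F y - F x = \<omega> x y"
proof -
  obtain Q0 where Q0: "Q0 \<in> squares G" using G unfolding s_quad_graph_def by blast
  define x0 where "x0 = corner Q0 0"
  \<comment> \<open>The squares may be infinitely many, but the span of winding forms needs finite
    support. The extension by zero creates circulation outside the graph and at the margin of the
    box.\<close>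
  define trunc where "trunc m x y = (if lattice_edge G x y \<and> x \<in> lattice_box m \<and> y \<in> lattice_box m then \<omega> x y else 0)" for m x y
  have trunc_anti: "trunc m y x = - trunc m x y" for m x y
  proof (cases "lattice_edge G x y")
    case True
    then show ?thesis using anti[OF True] lattice_edge_sym[OF True] by (simp add: trunc_def)
  next
    case False
    then show ?thesis using lattice_edge_sym[of G y x] by (auto simp: trunc_def)
  qed
  \<comment> \<open>A square with some corner in the box can have its lower left corner one step
    outside, hence \<open>m + 1\<close>.\<close>
  have supp: "Q \<in> lattice_box (m + 1)" if "circulation (trunc m) Q \<noteq> 0" for m Q
  proof -
    have "\<exists>k. corner Q k \<in> lattice_box m"
      using that by (force simp: circulation_def trunc_def split: if_splits)
    then obtain k where k: "corner Q k \<in> lattice_box m" by blast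
    obtain i j where Q: "Q = (i, j)" by (cases Q)
    show ?thesis
      using k unfolding Q lattice_box_def by (cases rule: corner_cases[of i j k]) auto
  qed
  have "\<forall>m. \<exists>c \<Phi>. (\<forall>Q. circulation (trunc m) Q = 0 \<longrightarrow> c Q = 0) \<and>
      (\<forall>x y. lattice_edge G x y \<longrightarrow>
         trunc m x y = (\<Sum>Q\<in>lattice_box (m + 1). winding_form Q x y *\<^sub>R c Q) + (\<Phi> y - \<Phi> x))"
  proof
    fix m
    have fin: "finite (lattice_box (m + 1))" by (simp add: lattice_box_def)
    show "\<exists>c \<Phi>. (\<forall>Q. circulation (trunc m) Q = 0 \<longrightarrow> c Q = 0) \<and>
      (\<forall>x y. lattice_edge G x y \<longrightarrow>
         trunc m x y = (\<Sum>Q\<in>lattice_box (m + 1). winding_form Q x y *\<^sub>R c Q) + (\<Phi> y - \<Phi> x))"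
      by (rule winding_forms_span[where \<omega> = "trunc m", OF fin supp trunc_anti]) blast+
  qed
  then have "\<exists>c \<Phi>. \<forall>m. (\<forall>Q. circulation (trunc m) Q = 0 \<longrightarrow> c m Q = 0) \<and>
      (\<forall>x y. lattice_edge G x y \<longrightarrow>
         trunc m x y = (\<Sum>Q\<in>lattice_box (m + 1). winding_form Q x y *\<^sub>R c m Q) + (\<Phi> m y - \<Phi> m x))"
    by (simp only: choice_iff)
  then obtain c \<Phi> where c\<Phi>: "\<forall>m. (\<forall>Q. circulation (trunc m) Q = 0 \<longrightarrow> c m Q = 0) \<and>
      (\<forall>x y. lattice_edge G x y \<longrightarrow>
         trunc m x y = (\<Sum>Q\<in>lattice_box (m + 1). winding_form Q x y *\<^sub>R c m Q) + (\<Phi> m y - \<Phi> m x))"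
    by (elim exE)
  have c: "c m Q = 0" if "circulation (trunc m) Q = 0" for m Q
    using c\<Phi> that by blast
  have \<Phi>: "trunc m x y = (\<Sum>Q\<in>lattice_box (m + 1). winding_form Q x y *\<^sub>R c m Q) + (\<Phi> m y - \<Phi> m x)"
    if "lattice_edge G x y" for m x y
    using c\<Phi> that by blast
  \<comment> \<open>On a square of the graph inside the box the truncation changes nothing and the
    form is closed; a nonzero coefficient on a square of the graph therefore puts its centre outside
    the box.\<close>
  have outside: "square_centre Q \<notin> complex_box m" if "Q \<in> squares G" "c m Q \<noteq> 0" for m Q
  proof
    assume "square_centre Q \<in> complex_box m"
    then have "corner Q k \<in> lattice_box m" for k by (rule square_centre_in_box)
    moreover have "lattice_edge G (corner Q 0) (corner Q 1)" "lattice_edge G (corner Q 1) (corner Q 2)"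
      "lattice_edge G (corner Q 2) (corner Q 3)" "lattice_edge G (corner Q 3) (corner Q 0)"
      using lattice_edge_square[OF that(1)] by auto
    ultimately have "circulation (trunc m) Q = circulation \<omega> Q"
      by (simp add: circulation_def trunc_def)
    then show False using closed[OF that(1)] c[of m Q] that(2) by simp
  qed
  \<comment> \<open>A state is a vertex together with the sum of the form along the way to it; the
    primitive is read off from the reachable states.\<close>
  define walk where "walk = (\<lambda>(x, a) (y, b). lattice_edge G x y \<and> b = a + \<omega> x y)"
  \<comment> \<open>The walk is traced by a curve \<open>g\<close>, along which its sum splits into
    winding numbers and a difference of potentials. The equation is kept for all boxes from
    \<open>n\<close> on, because two walks to the same vertex must be compared in a box that
    contains both.\<close>
  define inv where "inv x a g n \<longleftrightarrow> path g \<and> pathstart g = to_complex x0 \<and> pathfinish g = to_complex x \<and>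
      path_image g \<subseteq> complex_region G \<inter> complex_box n \<and> (\<forall>Q. square_centre Q \<notin> path_image g) \<and>
      (\<forall>m\<ge>n. a = (\<Sum>Q\<in>lattice_box (m + 1). Re (winding_number g (square_centre Q)) *\<^sub>R c m Q) + (\<Phi> m x - \<Phi> m x0))"
    for x a g n
  have x0_in: "to_complex x0 \<in> complex_region G"
    using to_complex_corner[of Q0 0] Q0 unfolding complex_region_def x0_def by blast
  have x0_centre: "square_centre Q \<noteq> to_complex x0" for Q
    using square_centre_notin_hor[of Q "fst x0" "snd x0" "fst x0"] by auto
  have ex_inv: "\<exists>g n. inv x a g n" if "walk\<^sup>*\<^sup>* (x0, 0) (x, a)" for x a
    using that
  proof (induction rule: rtranclp_induct2)
    case refl
    have "x0 \<in> lattice_box (max \<bar>fst x0\<bar> \<bar>snd x0\<bar>)" by (cases x0) (auto simp: lattice_box_def)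
    then have "inv x0 0 (linepath (to_complex x0) (to_complex x0)) (max \<bar>fst x0\<bar> \<bar>snd x0\<bar>)"
      using x0_in x0_centre to_complex_in_box_iff unfolding inv_def by simp
    then show ?case by blast
  next
    case (step x a y b)
    then obtain g n where g: "inv x a g n" by blast
    have e: "lattice_edge G x y" and b: "b = a + \<omega> x y"
      using step.hyps(2) by (auto simp: walk_def)
    define l where "l = linepath (to_complex x) (to_complex y)"
    have "x \<in> lattice_box n"
      using g pathfinish_in_path_image[of g] to_complex_in_box_iff[of x n] unfolding inv_def by auto
    then have xn: "x \<in> lattice_box (n + 1)" and yn: "y \<in> lattice_box (n + 1)"
      using e by (auto elim!: lattice_edge_cases simp: lattice_box_def)
    have l_box: "path_image l \<subseteq> complex_box (n + 1)"
      using xn yn unfolding l_def complex_box_def path_image_linepath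
      by (intro closed_segment_subset convex_box) (use xn yn to_complex_in_box_iff[of x "n + 1"] to_complex_in_box_iff[of y "n + 1"] in \<open>auto simp: complex_box_def\<close>)
    have l_region: "path_image l \<subseteq> complex_region G" and l_centre: "square_centre Q \<notin> path_image l" for Q
      using lattice_edge_segment[OF e] by (auto simp: l_def)
    have gl: "path g" "path l" "pathfinish g = pathstart l" "\<And>Q. square_centre Q \<notin> path_image g"
      using g by (auto simp: inv_def l_def)
    have wn: "Re (winding_number (g +++ l) (square_centre Q)) =
        Re (winding_number g (square_centre Q)) + winding_form Q x y" for Q
      using winding_number_join[OF gl(1) gl(4) gl(2) l_centre gl(3)] by (simp add: winding_form_def l_def)
    have "inv y b (g +++ l) (n + 1)"
      unfolding inv_def
    proof (intro conjI allI impI)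
      show "path (g +++ l)" using gl by simp
      show "pathstart (g +++ l) = to_complex x0" using g by (simp add: inv_def)
      show "pathfinish (g +++ l) = to_complex y" by (simp add: l_def)
      show "path_image (g +++ l) \<subseteq> complex_region G \<inter> complex_box (n + 1)"
        using g l_box l_region complex_box_mono[of n "n + 1"] by (simp add: inv_def path_image_join gl) blast
      show "square_centre Q \<notin> path_image (g +++ l)" for Q
        using gl l_centre by (simp add: path_image_join)
      fix m assume m: "n + 1 \<le> m"
      then have "x \<in> lattice_box m" "y \<in> lattice_box m" using xn yn by (auto simp: lattice_box_def)
      then have "\<omega> x y = (\<Sum>Q\<in>lattice_box (m + 1). winding_form Q x y *\<^sub>R c m Q) + (\<Phi> m y - \<Phi> m x)"
        using \<Phi>[OF e, of m] e by (simp add: trunc_def)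
      moreover have "a = (\<Sum>Q\<in>lattice_box (m + 1). Re (winding_number g (square_centre Q)) *\<^sub>R c m Q) + (\<Phi> m x - \<Phi> m x0)"
        using g m by (simp add: inv_def)
      ultimately show "b = (\<Sum>Q\<in>lattice_box (m + 1). Re (winding_number (g +++ l) (square_centre Q)) *\<^sub>R c m Q) + (\<Phi> m y - \<Phi> m x0)"
        unfolding b wn by (simp add: scaleR_add_left sum.distrib)
    qed
    then show ?case by blast
  qed
  have uniq: "a = b" if walks: "walk\<^sup>*\<^sup>* (x0, 0) (x, a)" "walk\<^sup>*\<^sup>* (x0, 0) (x, b)" for x a b
  proof -
    obtain f n g n' where f: "inv x a f n" and g: "inv x b g n'"
      using ex_inv walks by meson
    define m where "m = max n n'"
    define loop where "loop = f +++ reversepath g"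
    have loop: "path loop" "pathfinish loop = pathstart loop" "path_image loop \<subseteq> complex_region G \<inter> complex_box m"
      using f g complex_box_mono[of n m] complex_box_mono[of n' m]
      by (auto simp: inv_def loop_def m_def path_image_join)
    \<comment> \<open>If \<open>Q\<close> is a square of the graph, its centre lies outside the box
      around the loop; otherwise it lies outside the simply connected region. In both cases the loop
      does not wind around it.\<close>
    have zero: "(Re (winding_number f (square_centre Q)) - Re (winding_number g (square_centre Q))) *\<^sub>R c m Q = 0" for Q
    proof (cases "c m Q = 0")
      case False
      have "winding_number loop (square_centre Q) = 0"
      proof (cases "Q \<in> squares G")
        case True
        show ?thesis
          using winding_number_zero_outside[OF loop(1) _ loop(2) outside[OF True False]] loop(3)
          unfolding complex_box_def by auto
      next
        case False
        then have "square_centre Q \<notin> complex_region G"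
          by (auto simp: complex_region_def square_centre_in_complex_square_iff)
        moreover have "simply_connected (complex_region G)"
          using G simply_connected_complex_region unfolding s_quad_graph_def by blast
        ultimately show ?thesis
          using simply_connected_imp_winding_number_zero[OF _ loop(1) _ loop(2)] loop(3) by blast
      qed
      moreover have "winding_number loop (square_centre Q) =
          winding_number f (square_centre Q) - winding_number g (square_centre Q)"
      proof -
        have "path f" "path g" "pathfinish f = pathfinish g"
          "square_centre Q \<notin> path_image f" "square_centre Q \<notin> path_image g"
          using f g unfolding inv_def by metis+
        then show ?thesis
          unfolding loop_def by (simp add: winding_number_join winding_number_reversepath)
      qed
      ultimately show ?thesis by simp
    qed simp
    have "a - b = (\<Sum>Q\<in>lattice_box (m + 1).
        (Re (winding_number f (square_centre Q)) - Re (winding_number g (square_centre Q))) *\<^sub>R c m Q)"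
    proof -
      have "a = (\<Sum>Q\<in>lattice_box (m + 1). Re (winding_number f (square_centre Q)) *\<^sub>R c m Q) + (\<Phi> m x - \<Phi> m x0)"
        "b = (\<Sum>Q\<in>lattice_box (m + 1). Re (winding_number g (square_centre Q)) *\<^sub>R c m Q) + (\<Phi> m x - \<Phi> m x0)"
        using f g unfolding inv_def m_def by auto
      then show ?thesis by (simp add: scaleR_diff_left sum_subtractf)
    qed
    then show ?thesis using zero by simp
  qed
  define F where "F x = (THE a. walk\<^sup>*\<^sup>* (x0, 0) (x, a))" for x
  have F: "F x = a" if "walk\<^sup>*\<^sup>* (x0, 0) (x, a)" for x a
    unfolding F_def using that uniq by blast
  have reach: "\<exists>a. walk\<^sup>*\<^sup>* (x0, 0) (corner Q k, a)" if "Q \<in> squares G" for Q k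
  proof (rule lattice_edge_induct[OF G Q0 that, of "\<lambda>x. \<exists>a. walk\<^sup>*\<^sup>* (x0, 0) (x, a)" 0])
    show "\<exists>a. walk\<^sup>*\<^sup>* (x0, 0) (corner Q0 0, a)" unfolding x0_def by blast
    fix x y assume "lattice_edge G x y" "\<exists>a. walk\<^sup>*\<^sup>* (x0, 0) (x, a)"
    then obtain a where "walk\<^sup>*\<^sup>* (x0, 0) (x, a)" "walk (x, a) (y, a + \<omega> x y)"
      by (auto simp: walk_def)
    then show "\<exists>a. walk\<^sup>*\<^sup>* (x0, 0) (y, a)" by (meson rtranclp.rtrancl_into_rtrancl)
  qed
  show thesis
  proof
    fix x y assume e: "lattice_edge G x y"
    then obtain Q k where "Q \<in> squares G" "x = corner Q k" unfolding lattice_edge_def by blast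
    then obtain a where a: "walk\<^sup>*\<^sup>* (x0, 0) (x, a)" using reach by blast
    moreover have "walk (x, a) (y, a + \<omega> x y)" using e by (simp add: walk_def)
    ultimately have "walk\<^sup>*\<^sup>* (x0, 0) (y, a + \<omega> x y)" by (meson rtranclp.rtrancl_into_rtrancl)
    then show "F y - F x = \<omega> x y" using F a by simp
  qed
qed

section \<open>S-quad graphs\<close>

lemma circulation_rotate:
  "circulation \<omega> Q = \<omega> (corner Q k) (corner Q (k + 1)) + \<omega> (corner Q (k + 1)) (corner Q (k + 2)) +
     \<omega> (corner Q (k + 2)) (corner Q (k + 3)) + \<omega> (corner Q (k + 3)) (corner Q k)"
proof -
  obtain i j where Q: "Q = (i, j)" by (cases Q)
  have *: "corner (i, j) 0 = (i, j)" "corner (i, j) 1 = (i + 1, j)"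
      "corner (i, j) 2 = (i + 1, j + 1)" "corner (i, j) 3 = (i, j + 1)"
    by (auto simp: corner.simps)
  show ?thesis
    unfolding Q circulation_def *
    by (cases rule: corner_cases[of i j k]) (simp_all only: ac_simps)
qed

lemma corner_distinct:
  "corner Q k \<noteq> corner Q (k + 1)" "corner Q k \<noteq> corner Q (k + 2)" "corner Q k \<noteq> corner Q (k + 3)"
  "corner Q (k + 1) \<noteq> corner Q (k + 2)" "corner Q (k + 1) \<noteq> corner Q (k + 3)" "corner Q (k + 2) \<noteq> corner Q (k + 3)"
proof -
  obtain i j where Q: "Q = (i, j)" by (cases Q)
  show "corner Q k \<noteq> corner Q (k + 1)" "corner Q k \<noteq> corner Q (k + 2)" "corner Q k \<noteq> corner Q (k + 3)"
  "corner Q (k + 1) \<noteq> corner Q (k + 2)" "corner Q (k + 1) \<noteq> corner Q (k + 3)" "corner Q (k + 2) \<noteq> corner Q (k + 3)"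
    unfolding Q by (cases rule: corner_cases[of i j k]; simp only: prod.inject; simp)+
qed

lemma corner_index:
  obtains "corner Q l = corner Q k" | "corner Q l = corner Q (k + 1)" | "corner Q l = corner Q (k + 2)" | "corner Q l = corner Q (k + 3)"
proof -
  define n where "n = (l + 3 * k) mod 4"
  have "(k + n) mod 4 = (l + 4 * k) mod 4"
    unfolding n_def by (simp add: mod_add_right_eq algebra_simps)
  then have "corner Q (k + n) = corner Q l"
    using corner_mod[of Q "k + n"] corner_mod[of Q l] by simp
  then have *: "corner Q l = corner Q (k + n)" by simp
  have "n < 4" unfolding n_def by simp
  then consider "n = 0" | "n = 1" | "n = 2" | "n = 3" by linarith
  then show thesis
  proof cases
    case 1 then show thesis using that(1) * by simp
  next
    case 2 then show thesis using that(2) * by simp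
  next
    case 3 then show thesis using that(3) * by simp
  next
    case 4 then show thesis using that(4) * by simp
  qed
qed

lemma corner_add_4: "corner Q (k + 4) = corner Q k"
  using corner_mod[of Q "k + 4"] corner_mod[of Q k] by simp

lemma corner_shift:
  assumes "corner Q m = corner Q k"
  shows "corner Q (m + n) = corner Q (k + n)"
proof -
  obtain i j where Q: "Q = (i, j)" by (cases Q)
  have "m mod 4 < 4" "k mod 4 < 4" by simp_all
  then have "m mod 4 = k mod 4"
    using assms unfolding Q corner.simps by (simp split: if_splits)
  then have "(m + n) mod 4 = (k + n) mod 4" by (metis mod_add_left_eq)
  then show ?thesis by (metis corner_mod)
qed

text \<open>The form that jumps by one when the square \<open>A\<close> is entered from \<open>b\<close> is closed if \<open>A\<close> and \<open>B\<close> are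
  the only squares at \<open>b\<close>; its primitive would separate \<open>A\<close> from \<open>B\<close>.\<close>

lemma no_pinched_vertex:
  assumes G: "s_quad_graph G" and AB: "A \<in> squares G" "B \<in> squares G"
    and b: "b = corner A k" "b = corner B l"
    and only: "\<And>Q m. Q \<in> squares G \<Longrightarrow> corner Q m = b \<Longrightarrow> Q = A \<or> Q = B"
    and apart: "{corner A (k + 1), corner A (k + 3)} \<inter> {corner B (l + 1), corner B (l + 3)} = {}"
  shows False
proof -
  define N where "N = {corner A (k + 1), corner A (k + 3)}"
  define \<omega> :: "lattice_point \<Rightarrow> lattice_point \<Rightarrow> real" where
    "\<omega> x y = (if x = b \<and> y \<in> N then 1 else if y = b \<and> x \<in> N then -1 else 0)" for x y
  have bN: "b \<notin> N" using corner_distinct[of A k] unfolding N_def b(1) by simp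
  have at_A: "{corner A (m + 1), corner A (m + 3)} = N" if "corner A m = b" for m
    using corner_shift[of A m k] that b(1) unfolding N_def by metis
  have at_B: "{corner B (m + 1), corner B (m + 3)} \<inter> N = {}" if "corner B m = b" for m
    using corner_shift[of B m l] that b(2) apart unfolding N_def by (metis inf_commute)
  have far: "\<omega> x y = 0" if "x \<noteq> b" "y \<noteq> b" for x y
    using that by (simp add: \<omega>_def)
  \<comment> \<open>At \<open>A\<close> the two sides at \<open>b\<close> contribute 1 and -1, at
    \<open>B\<close> both contribute 0 since \<open>B\<close> has no neighbour of \<open>b\<close>
    in common with \<open>A\<close>, and all other squares avoid \<open>b\<close>.\<close>
  have "circulation \<omega> Q = 0" if Q: "Q \<in> squares G" for Q
  proof (cases "\<exists>m. corner Q m = b")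
    case True
    then obtain m where m: "corner Q m = b" by blast
    have "corner Q (m + 1) \<in> N \<longleftrightarrow> corner Q (m + 3) \<in> N"
      using only[OF Q m] at_A[of m] at_B[of m] m by blast
    then show ?thesis
      using corner_distinct[of Q m] bN far unfolding m by (auto simp: circulation_rotate[of \<omega> Q m] m \<omega>_def)
  next
    case False
    then show ?thesis by (simp add: circulation_def far)
  qed
  moreover have "\<omega> y x = - \<omega> x y" for x y
    using bN by (auto simp: \<omega>_def)
  ultimately obtain F where F: "\<And>x y. lattice_edge G x y \<Longrightarrow> F y - F x = \<omega> x y"
    using discrete_poincare[OF G, of \<omega>] by blast
  \<comment> \<open>The corners of a square other than \<open>b\<close> are joined by sides that
    avoid \<open>b\<close>, where the form vanishes.\<close>
  have const: "F x = F y" if Q: "Q \<in> squares G" and xy: "x = corner Q m" "y = corner Q n" "x \<noteq> b" "y \<noteq> b" for Q m n x y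
  proof -
    have e: "F (corner Q (i + 1)) = F (corner Q i)" if "corner Q i \<noteq> b" "corner Q (i + 1) \<noteq> b" for i
      using F[OF lattice_edge_corner(1)[OF Q, of i]] far[OF that] by simp
    show ?thesis
    proof (cases "\<exists>i. corner Q i = b")
      case True
      then obtain i where i: "corner Q i = b" by blast
      have "F (corner Q (i + 1)) = F (corner Q (i + 2))" "F (corner Q (i + 2)) = F (corner Q (i + 3))"
        using e[of "i + 1"] e[of "i + 2"] corner_distinct[of Q i] unfolding i by (simp_all add: eval_nat_numeral)
      then show ?thesis using xy i corner_index[of Q m i] corner_index[of Q n i] by metis
    next
      case False
      then have "F (corner Q m) = F (corner Q (m + 1))" "F (corner Q (m + 1)) = F (corner Q (m + 2))"
        "F (corner Q (m + 2)) = F (corner Q (m + 3))"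
        using e[of m] e[of "m + 1"] e[of "m + 2"] by (simp_all add: eval_nat_numeral)
      then show ?thesis using xy corner_index[of Q n m] by metis
    qed
  qed
  define t where "t = F b + 1"
  have t: "F (corner A (k + 1)) = t"
    using F[OF lattice_edge_corner(1)[OF AB(1), of k]] bN b(1) unfolding t_def by (simp add: \<omega>_def N_def)
  \<comment> \<open>Side-adjacent squares share two corners, at most one of which is
    \<open>b\<close>, so the value \<open>t\<close> travels from \<open>A\<close> to
    \<open>B\<close>. The primitive would then jump from \<open>b\<close> to its neighbour in
    \<open>B\<close>, where the form is zero.\<close>
  have "\<forall>m. corner B m \<noteq> b \<longrightarrow> F (corner B m) = t"
    using G AB
  proof (induction rule: s_quad_graph_square_induct)
    case start
    then show ?case using t const[OF AB(1)] corner_distinct(1)[of A k] b(1) by metis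
  next
    case (step C D)
    obtain i j where ij: "corner C i = corner D (j + 1)" "corner C (i + 1) = corner D j"
      using side_adjacent_common_edge[OF step(3)] by blast
    have "corner C i \<noteq> corner C (i + 1)" using corner_distinct by blast
    then obtain n m where "corner D n = corner C m" "corner D n \<noteq> b"
      using ij by metis
    then have "F (corner D n) = t" using step(4) by metis
    then show ?case using const[OF step(2)] \<open>corner D n \<noteq> b\<close> by metis
  qed
  then have "F (corner B (l + 1)) = t"
    using corner_distinct(1)[of B l] b(2) by metis
  moreover have "\<omega> b (corner B (l + 1)) = 0"
    using at_B[of l] b(2) bN by (auto simp: \<omega>_def)
  ultimately show False
    using F[OF lattice_edge_corner(1)[OF AB(2), of l]] b(2) unfolding t_def by simp
qed

section \<open>Quads, incidences and colours\<close>

lemma white_corner_alternates: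
  assumes "s_quad_graph G" "Q \<in> squares G"
  shows "white G (corner Q (k + 1)) \<longleftrightarrow> \<not> white G (corner Q k)"
  using assms unfolding s_quad_graph_def by blast

lemma square_quad:
  assumes "Q \<in> squares G" "white G (corner Q k)"
  shows "quad G (corner Q k) (corner Q (k + 1)) (corner Q (k + 2)) (corner Q (k + 3))"
  using assms unfolding quad_def by blast

lemma quadE:
  assumes "quad G v b v' b'"
  obtains Q k where "Q \<in> squares G" "v = corner Q k" "b = corner Q (k + 1)" "v' = corner Q (k + 2)"
    "b' = corner Q (k + 3)" "white G v"
  using assms unfolding quad_def by blast

lemma quad_swap:
  assumes G: "s_quad_graph G" and q: "quad G v b v' b'"
  shows "quad G v' b' v b"
proof -
  obtain Q k where Q: "Q \<in> squares G" "v = corner Q k" "b = corner Q (k + 1)" "v' = corner Q (k + 2)"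
    "b' = corner Q (k + 3)" "white G v"
    using q by (rule quadE)
  have "white G (corner Q (k + 2))"
    using white_corner_alternates[OF G Q(1), of k] white_corner_alternates[OF G Q(1), of "k + 1"] Q by simp
  then show ?thesis
    using square_quad[OF Q(1), of "k + 2"] corner_add_4[of Q k] corner_add_4[of Q "k + 1"]
    unfolding Q by (simp add: eval_nat_numeral)
qed

lemma quad_facts:
  assumes G: "s_quad_graph G" and q: "quad G v b v' b'"
  shows "incident G v b" "incident G v b'" "incident G v' b" "incident G v' b'"
    "v \<in> white_vertices G" "v' \<in> white_vertices G"
    "white G v" "white G v'" "\<not> white G b" "\<not> white G b'"
    "svert G v' \<longleftrightarrow> \<not> svert G v" "hor G b' \<longleftrightarrow> \<not> hor G b"
    "horizontal G v b' \<longleftrightarrow> \<not> horizontal G v b" "horizontal G v' b \<longleftrightarrow> \<not> horizontal G v b"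
    "horizontal G v' b' \<longleftrightarrow> horizontal G v b"
proof -
  note q' = quad_swap[OF G q]
  show "incident G v b" "incident G v b'" "incident G v' b" "incident G v' b'"
    "v \<in> white_vertices G" "v' \<in> white_vertices G"
    using q q' unfolding incident_def white_vertices_def by blast+
  show "white G v" "white G v'" using q q' unfolding quad_def by blast+
  show "\<not> white G b" "\<not> white G b'"
    using q q' white_corner_alternates[OF G] by (elim quadE, metis)+
  show s: "svert G v' \<longleftrightarrow> \<not> svert G v" and h: "hor G b' \<longleftrightarrow> \<not> hor G b"
    using G q unfolding s_quad_graph_def by blast+
  show "horizontal G v b' \<longleftrightarrow> \<not> horizontal G v b" "horizontal G v' b \<longleftrightarrow> \<not> horizontal G v b"
    "horizontal G v' b' \<longleftrightarrow> horizontal G v b"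
    using s h by (auto simp: horizontal_def)
qed

lemma incident_quad:
  assumes G: "s_quad_graph G" and "incident G v b"
  obtains v' b' where "quad G v b v' b'" "quad G v' b' v b" | v' b' where "quad G v b' v' b" "quad G v' b v b'"
  using assms quad_swap[OF G] unfolding incident_def by blast

lemma incident_lattice_edge:
  assumes G: "s_quad_graph G" and "incident G v b"
  shows "lattice_edge G v b" "white G v" "\<not> white G b" "v \<in> white_vertices G"
proof -
  show "lattice_edge G v b"
    using assms(2) unfolding incident_def
  proof (elim exE disjE)
    fix v' b' assume "quad G v b v' b'"
    then show ?thesis using lattice_edge_corner(1) by (elim quadE) metis
  next
    fix v' b' assume "quad G v b' v' b"
    then show ?thesis
    proof (elim quadE)
      fix Q k assume "Q \<in> squares G" "v = corner Q k" "b = corner Q (k + 3)"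
      then show ?thesis
        using lattice_edge_corner(2)[of Q G "k + 3"] corner_add_4[of Q k] by (simp add: eval_nat_numeral)
    qed
  qed
  show "white G v" "\<not> white G b" "v \<in> white_vertices G"
    using incident_quad[OF assms] quad_facts[OF G] by metis+
qed

lemma lattice_edge_incident:
  assumes G: "s_quad_graph G" and "lattice_edge G x y" "white G x"
  shows "incident G x y"
proof -
  obtain Q k where Q: "Q \<in> squares G" and
    "(x = corner Q k \<and> y = corner Q (k + 1)) \<or> (y = corner Q k \<and> x = corner Q (k + 1))"
    using assms unfolding lattice_edge_def by blast
  then show ?thesis
  proof (elim disjE conjE)
    assume "x = corner Q k" "y = corner Q (k + 1)"
    then show ?thesis using square_quad[OF Q, of k] assms(3) unfolding incident_def by blast
  next
    assume xy: "y = corner Q k" "x = corner Q (k + 1)"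
    have "k + 1 + 3 = k + 4" by simp
    then have "y = corner Q (k + 1 + 3)" using corner_add_4[of Q k] xy by metis
    then show ?thesis using square_quad[OF Q, of "k + 1"] assms(3) xy unfolding incident_def by blast
  qed
qed

lemma lattice_edge_white:
  assumes G: "s_quad_graph G" and "lattice_edge G x y"
  shows "white G y \<longleftrightarrow> \<not> white G x"
  using assms(2) white_corner_alternates[OF G] unfolding lattice_edge_def by blast

text \<open>The step is an equivalence, so the property can travel from white to black vertices and
  back; convergence of nets is propagated in this way.\<close>

lemma incident_induct:
  assumes G: "s_quad_graph G" and e: "incident G v0 b0" "incident G v b" and P: "P v0"
    and step: "\<And>v b. incident G v b \<Longrightarrow> P v \<longleftrightarrow> P b"
  shows "P v"
proof -
  obtain Q k where Q: "Q \<in> squares G" "v = corner Q k"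
    using incident_lattice_edge(1)[OF G e(2)] unfolding lattice_edge_def by blast
  obtain Q0 k0 where Q0: "Q0 \<in> squares G" "v0 = corner Q0 k0"
    using incident_lattice_edge(1)[OF G e(1)] unfolding lattice_edge_def by blast
  have "P y" if "lattice_edge G x y" "P x" for x y
    using that step lattice_edge_incident[OF G] lattice_edge_white[OF G that(1)] lattice_edge_sym by metis
  then show ?thesis
    using lattice_edge_induct[OF G Q0(1) Q(1), of P k0 k] P Q0 Q by metis
qed

text \<open>The forms in question are given from white to black vertices. Their antisymmetric
  extension turns the alternating sum over a quad into a circulation.\<close>

lemma bipartite_poincare:
  fixes \<theta> :: "lattice_point \<Rightarrow> lattice_point \<Rightarrow> 'a::real_vector"
  assumes G: "s_quad_graph G"
    and closed: "\<And>v b v' b'. quad G v b v' b' \<Longrightarrow> \<theta> v b - \<theta> v' b + \<theta> v' b' - \<theta> v b' = 0"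
  obtains F where "\<And>v b. incident G v b \<Longrightarrow> F b - F v = \<theta> v b"
proof -
  define \<omega> where "\<omega> x y = (if white G x then \<theta> x y else - \<theta> y x)" for x y
  have "circulation \<omega> Q = 0" if Q: "Q \<in> squares G" for Q
  proof -
    obtain k where k: "white G (corner Q k)"
      using white_corner_alternates[OF G Q] by blast
    have q: "quad G (corner Q k) (corner Q (k + 1)) (corner Q (k + 2)) (corner Q (k + 3))"
      using square_quad[OF Q k] .
    show ?thesis
      using closed[OF q] quad_facts[OF G q] unfolding circulation_rotate[of \<omega> Q k] \<omega>_def by simp
  qed
  moreover have "\<omega> y x = - \<omega> x y" if "lattice_edge G x y" for x y
    using lattice_edge_white[OF G that] by (simp add: \<omega>_def)
  ultimately obtain F where F: "\<And>x y. lattice_edge G x y \<Longrightarrow> F y - F x = \<omega> x y"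
    using discrete_poincare[OF G, of \<omega>] by blast
  show thesis
    by (rule that[of F]) (use F incident_lattice_edge[OF G] in \<open>simp add: \<omega>_def\<close>)
qed

text \<open>Opposite corners of a square differ by one in both coordinates and have opposite
  colours, so colour and parity flip together; connectedness makes one choice of \<open>s\<close>
  and \<open>t\<close> valid everywhere.\<close>

lemma colours_by_parity:
  assumes G: "s_quad_graph G"
  obtains s t where "\<And>v b. incident G v b \<Longrightarrow> svert G v \<longleftrightarrow> (even (fst v) \<longleftrightarrow> s)"
    and "\<And>v b. incident G v b \<Longrightarrow> hor G b \<longleftrightarrow> (even (fst b) \<longleftrightarrow> t)"
proof -
  obtain Q0 where Q0: "Q0 \<in> squares G" using G unfolding s_quad_graph_def by blast
  define good where "good s t x \<longleftrightarrow> (if white G x then svert G x \<longleftrightarrow> (even (fst x) \<longleftrightarrow> s) else hor G x \<longleftrightarrow> (even (fst x) \<longleftrightarrow> t))"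
    for s t x
  have "\<exists>s t. good s t (corner Q0 0) \<and> good s t (corner Q0 1)"
  proof -
    have alt: "white G (corner Q0 1) \<longleftrightarrow> \<not> white G (corner Q0 0)"
      using white_corner_alternates[OF G Q0, of 0] by simp
    have "\<exists>s t. good s t x \<and> good s t y" if "white G y \<longleftrightarrow> \<not> white G x" for x y
    proof (cases "white G x")
      case w: True
      show ?thesis
        unfolding good_def
        by (rule exI[of _ "even (fst x) \<longleftrightarrow> svert G x"], rule exI[of _ "even (fst y) \<longleftrightarrow> hor G y"]) (use that w in auto)
    next
      case w: False
      show ?thesis
        unfolding good_def
        by (rule exI[of _ "even (fst y) \<longleftrightarrow> svert G y"], rule exI[of _ "even (fst x) \<longleftrightarrow> hor G x"]) (use that w in auto)
    qed
    then show ?thesis using alt by blast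
  qed
  then obtain s t where st: "good s t (corner Q0 0)" "good s t (corner Q0 1)" by blast
  have opposite: "good s t (corner Q (m + 2))" if Q: "Q \<in> squares G" "good s t (corner Q m)" for Q m
  proof -
    have par: "even (fst (corner Q (m + 2))) \<longleftrightarrow> odd (fst (corner Q m))"
      by (cases Q; cases rule: corner_cases[of "fst Q" "snd Q" m]) auto
    show ?thesis
    proof (cases "white G (corner Q m)")
      case True
      then show ?thesis
        using quad_facts[OF G square_quad[OF Q(1) True]] Q(2) par unfolding good_def by auto
    next
      case False
      then have w: "white G (corner Q (m + 1))" using white_corner_alternates[OF G Q(1)] by blast
      have e: "m + 1 + 1 = m + 2" "m + 1 + 3 = m + 4" by simp_all
      show ?thesis
        using quad_facts[OF G square_quad[OF Q(1) w]] Q(2) par False corner_add_4[of Q m]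
        unfolding good_def e by auto
    qed
  qed
  have square: "\<forall>n. good s t (corner Q n)" if Q: "Q \<in> squares G" "good s t (corner Q m)" "good s t (corner Q (m + 1))" for Q m
  proof
    fix n
    have e: "m + 1 + 2 = m + 3" by simp
    have "good s t (corner Q (m + 2))" "good s t (corner Q (m + 3))"
      using opposite[OF Q(1,2)] opposite[OF Q(1,3)] unfolding e by blast+
    then show "good s t (corner Q n)"
      using corner_index[of Q n m] Q by metis
  qed
  have all: "\<forall>n. good s t (corner Q n)" if "Q \<in> squares G" for Q
    using G Q0 that
  proof (induction rule: s_quad_graph_square_induct)
    case start
    then show ?case using square[OF Q0, of 0] st by simp
  next
    case (step A B)
    then show ?case using square[of B] side_adjacent_common_edge[of A B] by metis
  qed
  have "good s t x" if "lattice_edge G x y" for x y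
    using that all unfolding lattice_edge_def by blast
  then show thesis
    by (intro that[of s t]) (use incident_lattice_edge[OF G] lattice_edge_sym good_def in metis)+
qed

section \<open>Consecutive squares around an edge\<close>

lemma corner_surrounding:
  assumes "corner Q k = x"
  shows "Q \<in> surrounding_squares x"
proof -
  obtain i j where Q: "Q = (i, j)" by (cases Q)
  show ?thesis
    using assms unfolding Q by (cases rule: corner_cases[of i j k]) auto
qed

lemma quad_coordinates:
  assumes "(i, j) \<in> squares G"
  shows "white G (i, j) \<Longrightarrow> quad G (i, j) (i + 1, j) (i + 1, j + 1) (i, j + 1)"
    and "white G (i + 1, j) \<Longrightarrow> quad G (i + 1, j) (i + 1, j + 1) (i, j + 1) (i, j)"
    and "white G (i + 1, j + 1) \<Longrightarrow> quad G (i + 1, j + 1) (i, j + 1) (i, j) (i + 1, j)"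
    and "white G (i, j + 1) \<Longrightarrow> quad G (i, j + 1) (i, j) (i + 1, j) (i + 1, j + 1)"
  using square_quad[OF assms, of 0] square_quad[OF assms, of 1] square_quad[OF assms, of 2] square_quad[OF assms, of 3]
  by (simp_all add: corner.simps)

text \<open>Without one of the other two squares, the given ones would be the only squares at
  \<open>(i, j)\<close> and have nothing but this corner in common.\<close>

lemma no_pinched_diagonal:
  assumes G: "s_quad_graph G" and "(i, j) \<in> squares G" "(i - 1, j - 1) \<in> squares G"
  shows "(i - 1, j) \<in> squares G \<or> (i, j - 1) \<in> squares G"
proof (rule ccontr)
  assume no: "\<not> ?thesis"
  show False
  proof (rule no_pinched_vertex[OF G assms(2,3), of "(i, j)" 0 2])
    show "Q = (i, j) \<or> Q = (i - 1, j - 1)" if "Q \<in> squares G" "corner Q m = (i, j)" for Q m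
      using corner_surrounding[OF that(2)] that(1) no by auto
  qed (simp_all add: corner.simps)
qed

lemma no_pinched_antidiagonal:
  assumes G: "s_quad_graph G" and "(i - 1, j) \<in> squares G" "(i, j - 1) \<in> squares G"
  shows "(i, j) \<in> squares G \<or> (i - 1, j - 1) \<in> squares G"
proof (rule ccontr)
  assume no: "\<not> ?thesis"
  show False
  proof (rule no_pinched_vertex[OF G assms(2,3), of "(i, j)" 1 3])
    show "Q = (i - 1, j) \<or> Q = (i, j - 1)" if "Q \<in> squares G" "corner Q m = (i, j)" for Q m
      using corner_surrounding[OF that(2)] that(1) no by auto
  qed (simp_all add: corner.simps)
qed

lemma incident_square:
  assumes "incident G v b"
  obtains Q where "Q \<in> squares G" "Q \<in> surrounding_squares v" "Q \<in> surrounding_squares b"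
proof -
  obtain v' b' where "quad G v b v' b' \<or> quad G v b' v' b"
    using assms unfolding incident_def by blast
  then obtain Q k l where "Q \<in> squares G" "v = corner Q k" "b = corner Q l"
    by (elim disjE quadE) blast+
  then show thesis using that corner_surrounding by metis
qed

text \<open>\<open>v\<close>, \<open>w\<close>, \<open>v'\<close> are consecutive white neighbours
  of \<open>b\<close> in clockwise order. The rings of \<open>v\<close> and \<open>v'\<close> are
  compared through the ring of \<open>w\<close> between them.\<close>

definition fan :: "lattice_graph \<Rightarrow> lattice_point \<Rightarrow> lattice_point \<Rightarrow> lattice_point \<Rightarrow> lattice_point \<Rightarrow> bool" where
  "fan G b v w v' \<longleftrightarrow> (\<exists>c c'. quad G v b w c \<and> quad G w b v' c')"

text \<open>Each incidence supplies a square at its end of the edge. If the two lie diagonally, the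
  vertex \<open>b\<close> would be pinched unless there is a third one; so two squares lie on the
  same side.\<close>

lemma fan_horizontal:
  assumes G: "s_quad_graph G" and e: "incident G (i + 1, j) (i, j)" "incident G (i - 1, j) (i, j)"
  shows "\<exists>w. fan G (i, j) (i - 1, j) w (i + 1, j) \<or> fan G (i, j) (i + 1, j) w (i - 1, j)"
proof -
  obtain A B where "A \<in> squares G" "A \<in> surrounding_squares (i + 1, j)" "A \<in> surrounding_squares (i, j)"
    "B \<in> squares G" "B \<in> surrounding_squares (i - 1, j)" "B \<in> surrounding_squares (i, j)"
    using incident_square[OF e(1)] incident_square[OF e(2)] by metis
  then have "(i, j) \<in> squares G \<and> (i - 1, j) \<in> squares G \<or> (i, j - 1) \<in> squares G \<and> (i - 1, j - 1) \<in> squares G"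
    using no_pinched_diagonal[OF G, of i j] no_pinched_antidiagonal[OF G, of i j] by auto
  moreover have w: "white G (i + 1, j)" "white G (i - 1, j)" using incident_lattice_edge[OF G] e by blast+
  ultimately show ?thesis
  proof (elim disjE conjE)
    assume Q: "(i, j) \<in> squares G" "(i - 1, j) \<in> squares G"
    have "quad G (i - 1, j) (i, j) (i, j + 1) (i - 1, j + 1)"
      using quad_coordinates(1)[OF Q(2)] w by simp
    moreover have "quad G (i, j + 1) (i, j) (i + 1, j) (i + 1, j + 1)"
      using quad_swap[OF G quad_coordinates(2)[OF Q(1) w(1)]] .
    ultimately show ?thesis unfolding fan_def by blast
  next
    assume Q: "(i, j - 1) \<in> squares G" "(i - 1, j - 1) \<in> squares G"
    have "quad G (i + 1, j) (i, j) (i, j - 1) (i + 1, j - 1)"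
      using quad_coordinates(3)[OF Q(1)] w by simp
    moreover have "quad G (i, j - 1) (i, j) (i - 1, j) (i - 1, j - 1)"
      using quad_swap[OF G quad_coordinates(4)[OF Q(2)]] w by simp
    ultimately show ?thesis unfolding fan_def by blast
  qed
qed

lemma fan_vertical:
  assumes G: "s_quad_graph G" and e: "incident G (i, j + 1) (i, j)" "incident G (i, j - 1) (i, j)"
  shows "\<exists>w. fan G (i, j) (i, j - 1) w (i, j + 1) \<or> fan G (i, j) (i, j + 1) w (i, j - 1)"
proof -
  obtain A B where "A \<in> squares G" "A \<in> surrounding_squares (i, j + 1)" "A \<in> surrounding_squares (i, j)"
    "B \<in> squares G" "B \<in> surrounding_squares (i, j - 1)" "B \<in> surrounding_squares (i, j)"
    using incident_square[OF e(1)] incident_square[OF e(2)] by metis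
  then have "(i, j) \<in> squares G \<and> (i, j - 1) \<in> squares G \<or> (i - 1, j) \<in> squares G \<and> (i - 1, j - 1) \<in> squares G"
    using no_pinched_diagonal[OF G, of i j] no_pinched_antidiagonal[OF G, of i j] by auto
  moreover have w: "white G (i, j + 1)" "white G (i, j - 1)" using incident_lattice_edge[OF G] e by blast+
  ultimately show ?thesis
  proof (elim disjE conjE)
    assume Q: "(i, j) \<in> squares G" "(i, j - 1) \<in> squares G"
    have "quad G (i, j + 1) (i, j) (i + 1, j) (i + 1, j + 1)"
      using quad_coordinates(4)[OF Q(1) w(1)] .
    moreover have "quad G (i + 1, j) (i, j) (i, j - 1) (i + 1, j - 1)"
      using quad_swap[OF G quad_coordinates(1)[OF Q(2)]] w by simp
    ultimately show ?thesis unfolding fan_def by blast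
  next
    assume Q: "(i - 1, j) \<in> squares G" "(i - 1, j - 1) \<in> squares G"
    have "quad G (i, j - 1) (i, j) (i - 1, j) (i - 1, j - 1)"
      using quad_coordinates(2)[OF Q(2)] w by simp
    moreover have "quad G (i - 1, j) (i, j) (i, j + 1) (i - 1, j + 1)"
      using quad_swap[OF G quad_coordinates(3)[OF Q(1)]] w by simp
    ultimately show ?thesis unfolding fan_def by blast
  qed
qed

text \<open>Equal colour means equal parity of the first coordinate, which forces two different
  s-vertices next to \<open>b\<close> to lie opposite to each other.\<close>

lemma s_edge_cases:
  assumes G: "s_quad_graph G" and e: "s_edge G b v v'"
  obtains (hor) i j where "b = (i, j)" "v = (i + 1, j)" "v' = (i - 1, j)"
  | (hor') i j where "b = (i, j)" "v' = (i + 1, j)" "v = (i - 1, j)"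
  | (vert) i j where "b = (i, j)" "v = (i, j + 1)" "v' = (i, j - 1)"
  | (vert') i j where "b = (i, j)" "v' = (i, j + 1)" "v = (i, j - 1)"
proof -
  obtain s t where s: "\<And>v b. incident G v b \<Longrightarrow> svert G v \<longleftrightarrow> (even (fst v) \<longleftrightarrow> s)"
    using colours_by_parity[OF G] by metis
  obtain i j where b: "b = (i, j)" by (cases b)
  have nb: "u = (i + 1, j) \<or> u = (i - 1, j) \<or> u = (i, j + 1) \<or> u = (i, j - 1)" if "incident G u b" for u
    using incident_lattice_edge(1)[OF G that] b by (elim lattice_edge_cases) auto
  have vv: "incident G v b" "incident G v' b" "v \<noteq> v'" "even (fst v) \<longleftrightarrow> even (fst v')"
    using e s unfolding s_edge_def by blast+
  show thesis
    using nb[OF vv(1)] nb[OF vv(2)] vv(3,4) that b by (elim disjE) simp_all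
qed

lemma s_edge_fan:
  assumes G: "s_quad_graph G" and e: "s_edge G b v v'"
  obtains w where "fan G b v w v'" | w where "fan G b v' w v"
proof -
  have i: "incident G v b" "incident G v' b" using e unfolding s_edge_def by blast+
  show thesis
    using G e
  proof (cases rule: s_edge_cases)
    case (hor i j)
    then show ?thesis using fan_horizontal[OF G, of i j] i that by auto
  next
    case (hor' i j)
    then show ?thesis using fan_horizontal[OF G, of i j] i that by auto
  next
    case (vert i j)
    then show ?thesis using fan_vertical[OF G, of i j] i that by auto
  next
    case (vert' i j)
    then show ?thesis using fan_vertical[OF G, of i j] i that by auto
  qed
qed

text \<open>These become the orientations of the vertex spheres: lifts of spheres touching from
  outside have product -1 or 1 according to whether the signed radii have equal or opposite
  signs.\<close>

lemma orientation_signs: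
  assumes G: "s_quad_graph G"
  obtains sg :: "lattice_point \<Rightarrow> real" where "\<And>v. sg v = 1 \<or> sg v = -1"
    and "\<And>b v v'. s_edge G b v v' \<Longrightarrow> sg v' = (if hor G b then sg v else - sg v)"
proof -
  obtain s t where s: "\<And>v b. incident G v b \<Longrightarrow> svert G v \<longleftrightarrow> (even (fst v) \<longleftrightarrow> s)"
    and t: "\<And>v b. incident G v b \<Longrightarrow> hor G b \<longleftrightarrow> (even (fst b) \<longleftrightarrow> t)"
    using colours_by_parity[OF G] by metis
  define alt where "alt i = (if even (i div 2) then 1 else - 1 :: real)" for i :: int
  have alt: "alt (i + 1) = - alt (i - 1)" for i
  proof -
    have "(i + 1) div 2 = (i - 1) div 2 + 1" by presburger
    then show ?thesis by (simp add: alt_def)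
  qed
  \<comment> \<open>For \<open>s = t\<close> the vertical edges run along the first lattice
    coordinate, otherwise along the second. Edges have length two, so the parity of half the
    coordinate alternates exactly along vertical edges.\<close>
  define sg :: "lattice_point \<Rightarrow> real" where "sg = (\<lambda>v. if s = t then alt (fst v) else alt (snd v))"
  show thesis
  proof
    show "sg v = 1 \<or> sg v = -1" for v by (simp add: sg_def alt_def)
    fix b v v' assume e: "s_edge G b v v'"
    then have sv: "even (fst v) \<longleftrightarrow> s" "hor G b \<longleftrightarrow> (even (fst b) \<longleftrightarrow> t)"
      using s t unfolding s_edge_def by blast+
    show "sg v' = (if hor G b then sg v else - sg v)"
      using G e
    proof (cases rule: s_edge_cases)
      case (hor i j)
      then show ?thesis using sv alt[of i] by (auto simp: sg_def)
    next
      case (hor' i j)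
      then show ?thesis using sv alt[of i] by (auto simp: sg_def)
    next
      case (vert i j)
      then show ?thesis using sv alt[of j] by (auto simp: sg_def)
    next
      case (vert' i j)
      then show ?thesis using sv alt[of j] by (auto simp: sg_def)
    qed
  qed
qed

text \<open>The black vertex \<open>face_edge w k\<close> lies on the edge from \<open>face_vertex w k\<close> to \<open>face_vertex w (k + 1)\<close>.\<close>

fun face_edge :: "lattice_point \<Rightarrow> nat \<Rightarrow> lattice_point" where
  "face_edge (i, j) k =
     (if k mod 4 = 0 then (i, j - 1)
      else if k mod 4 = 1 then (i + 1, j)
      else if k mod 4 = 2 then (i, j + 1)
      else (i - 1, j))"

lemma face_vertex_mod: "face_vertex w (k mod 4) = face_vertex w k"
  by (cases w) simp

lemma face_edge_mod: "face_edge w (k mod 4) = face_edge w k"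
  by (cases w) simp

lemma face_quad:
  assumes G: "s_quad_graph G" and w: "w \<in> faces G"
  shows "quad G w (face_edge w (k + 3)) (face_vertex w k) (face_edge w k)"
proof -
  obtain i j where ij: "w = (i, j)" by (cases w)
  have sq: "(i, j) \<in> squares G" "(i - 1, j) \<in> squares G" "(i - 1, j - 1) \<in> squares G" "(i, j - 1) \<in> squares G"
    and wv: "w \<in> white_vertices G"
    using w by (auto simp: ij faces_def c_vertices_def)
  have white: "white G (i, j)"
    using wv unfolding ij white_vertices_def quad_def by auto
  have q: "quad G (i, j) (i - 1, j) (i - 1, j - 1) (i, j - 1)" "quad G (i, j) (i, j - 1) (i + 1, j - 1) (i + 1, j)"
    "quad G (i, j) (i + 1, j) (i + 1, j + 1) (i, j + 1)" "quad G (i, j) (i, j + 1) (i - 1, j + 1) (i - 1, j)"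
    using quad_coordinates(3)[OF sq(3)] quad_coordinates(4)[OF sq(4)] quad_coordinates(1)[OF sq(1)]
      quad_coordinates(2)[OF sq(2)] white by simp_all
  define r where "r = k mod 4"
  have "(k + 3) mod 4 = (r + 3) mod 4" by (simp add: mod_simps r_def)
  then have r: "face_edge w (k + 3) = face_edge w (r + 3)" "face_vertex w k = face_vertex w r" "face_edge w k = face_edge w r"
    using face_edge_mod[of w "k + 3"] face_edge_mod[of w "r + 3"] face_vertex_mod[of w k] face_edge_mod[of w k]
    by (simp_all add: r_def)
  have "r < 4" by (simp add: r_def)
  then consider "r = 0" | "r = 1" | "r = 2" | "r = 3" by linarith
  then show ?thesis
    unfolding r by cases (use q in \<open>simp_all add: ij\<close>)
qed

lemma face_edge_add_4: "face_edge w (k + 4) = face_edge w k"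
  using face_edge_mod[of w "k + 4"] face_edge_mod[of w k] by simp

lemma face_vertex_add_4: "face_vertex w (k + 4) = face_vertex w k"
  using face_vertex_mod[of w "k + 4"] face_vertex_mod[of w k] by simp

declare face_edge.simps[simp del] face_vertex.simps[simp del]

lemma face_fan:
  assumes G: "s_quad_graph G" and w: "w \<in> faces G"
  shows "fan G (face_edge w k) (face_vertex w k) w (face_vertex w (k + 1))"
proof -
  have e: "k + 1 + 3 = k + 4" by simp
  show ?thesis
    using quad_swap[OF G face_quad[OF G w, of k]] face_quad[OF G w, of "k + 1"]
    unfolding fan_def e face_edge_add_4 by blast
qed

lemma face_facts:
  assumes G: "s_quad_graph G" and w: "w \<in> faces G"
  shows "s_edge G (face_edge w k) (face_vertex w k) (face_vertex w (k + 1))"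
    and "hor G (face_edge w (k + 1)) \<longleftrightarrow> \<not> hor G (face_edge w k)"
    and "face_vertex w k \<in> s_vertices G" and "w \<in> white_vertices G" and "\<not> svert G w"
proof -
  show ww: "w \<in> white_vertices G" "\<not> svert G w"
    using w unfolding faces_def c_vertices_def by blast+
  have e: "k + 1 + 3 = k + 4" by simp
  note q = quad_facts[OF G face_quad[OF G w, of k]] and q1 = quad_facts[OF G face_quad[OF G w, of "k + 1", unfolded e face_edge_add_4]]
  show "face_vertex w k \<in> s_vertices G"
    using q ww unfolding s_vertices_def by blast
  show "hor G (face_edge w (k + 1)) \<longleftrightarrow> \<not> hor G (face_edge w k)"
    using q1 by blast
  have "face_vertex w k \<noteq> face_vertex w (k + 1)"
  proof -
    obtain i j where ij: "w = (i, j)" by (cases w)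
    define r where "r = k mod 4"
    have "(k + 1) mod 4 = (r + 1) mod 4" by (simp add: mod_simps r_def)
    then have r: "face_vertex w (k + 1) = face_vertex w (r + 1)" "face_vertex w k = face_vertex w r"
      using face_vertex_mod[of w k] face_vertex_mod[of w "k + 1"] face_vertex_mod[of w "r + 1"]
      by (simp_all add: r_def)
    have "r < 4" by (simp add: r_def)
    then consider "r = 0" | "r = 1" | "r = 2" | "r = 3" by linarith
    then show ?thesis
      unfolding r by cases (simp_all add: ij face_vertex.simps)
  qed
  then show "s_edge G (face_edge w k) (face_vertex w k) (face_vertex w (k + 1))"
    using q q1 ww unfolding s_edge_def by blast
qed

section \<open>Lorentz geometry of kites\<close>

lemma lor_commute: "lor x y = lor y x"
  by (simp add: lor_def algebra_simps)

lemma lor_simps [simp]: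
  "lor (x + y) z = lor x z + lor y z" "lor z (x + y) = lor z x + lor z y"
  "lor (x - y) z = lor x z - lor y z" "lor z (x - y) = lor z x - lor z y"
  "lor (c *\<^sub>R x) z = c * lor x z" "lor z (c *\<^sub>R x) = c * lor z x"
  "lor (- x) z = - lor x z" "lor z (- x) = - lor z x" "lor 0 z = 0" "lor z 0 = 0"
  by (simp_all add: lor_def algebra_simps)

text \<open>The sign of the third component makes \<open>lor (lcross x y) z\<close> the determinant of \<open>x\<close>, \<open>y\<close>, \<open>z\<close>.\<close>

definition lcross :: "real^3 \<Rightarrow> real^3 \<Rightarrow> real^3" where
  "lcross x y = vector [x$2 * y$3 - x$3 * y$2, x$3 * y$1 - x$1 * y$3, x$2 * y$1 - x$1 * y$2]"

lemma lcross_nth [simp]: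
  "lcross x y $ 1 = x$2 * y$3 - x$3 * y$2" "lcross x y $ 2 = x$3 * y$1 - x$1 * y$3"
  "lcross x y $ 3 = x$2 * y$1 - x$1 * y$2"
  by (simp_all add: lcross_def)

lemma vec3_eq_iff: "x = y \<longleftrightarrow> x$1 = y$1 \<and> x$2 = y$2 \<and> x$3 = (y::real^3)$3"
  by (auto simp: vec_eq_iff forall_3)

lemma det_eq_lor_lcross: "det (vector [x, y, z] :: real^3^3) = lor (lcross x y) z"
  by (simp add: det_3 lor_def algebra_simps)

lemma lcross_simps:
  "lcross (x + y) z = lcross x z + lcross y z" "lcross z (x + y) = lcross z x + lcross z y"
  "lcross (x - y) z = lcross x z - lcross y z" "lcross z (x - y) = lcross z x - lcross z y"
  "lcross (c *\<^sub>R x) z = c *\<^sub>R lcross x z" "lcross z (c *\<^sub>R x) = c *\<^sub>R lcross z x"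
  "lcross x x = 0"
  by (simp_all add: vec3_eq_iff algebra_simps)

lemma lcross_minus: "lcross y x = - lcross x y"
  by (simp add: vec3_eq_iff)

lemma lor_lcross_cyclic: "lor (lcross x y) z = lor (lcross y z) x"
  by (simp add: lor_def algebra_simps)

lemma lor_lcross_self [simp]: "lor (lcross x y) x = 0" "lor (lcross x y) y = 0" "lor x (lcross x y) = 0" "lor y (lcross x y) = 0"
  by (simp_all add: lor_def algebra_simps)

lemma lor_lcross_lcross: "lor (lcross a b) (lcross c d) = lor a d * lor b c - lor a c * lor b d"
  by (simp add: lor_def algebra_simps)

lemma lcross_lcross: "lcross (lcross a b) c = lor b c *\<^sub>R a - lor a c *\<^sub>R b"
  by (simp add: lor_def vec3_eq_iff algebra_simps)

text \<open>Cramer's rule for four vectors in three dimensions.\<close>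

lemma four_vectors_dependent:
  "lor (lcross x p') x' *\<^sub>R p - lor (lcross p p') x' *\<^sub>R x + lor (lcross p x) x' *\<^sub>R p' - lor (lcross p x) p' *\<^sub>R x' = 0"
  by (simp add: lor_def vec3_eq_iff algebra_simps)

text \<open>A squared determinant is minus the Gram determinant, because the Lorentz form itself has
  determinant -1.\<close>

lemma lor_gram:
  "(lor (lcross x y) z)\<^sup>2 = - (lor x x * lor y y * lor z z + 2 * lor x y * lor y z * lor x z
     - lor x x * (lor y z)\<^sup>2 - lor y y * (lor x z)\<^sup>2 - lor z z * (lor x y)\<^sup>2)"
  by (simp add: lor_def power2_eq_square algebra_simps)

text \<open>Orthogonality to \<open>u\<close> and \<open>x\<close> makes \<open>y\<close> parallel
  to the unit vector \<open>lcross u x\<close>; the triple product fixes the factor.\<close>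

lemma eq_lcross_if_orthogonal:
  assumes "lor u u = 1" "lor x x = -1" "lor u x = 0" "lor y u = 0" "lor y x = 0" "lor (lcross u x) y = 1"
  shows "y = lcross u x"
proof -
  define m where "m = lcross u x"
  have "lor m m = 1" unfolding m_def using assms by (simp add: lor_lcross_lcross lor_commute[of x u])
  moreover have "lcross m y = 0"
    unfolding m_def using assms by (simp add: lcross_lcross lor_commute)
  then have "lcross (lcross m y) m = 0" by (simp add: lcross_simps vec3_eq_iff)
  then have "lor y m *\<^sub>R m - lor m m *\<^sub>R y = 0" by (simp add: lcross_lcross)
  ultimately show ?thesis using assms(6) by (simp add: m_def lor_commute)
qed

text \<open>Here \<open>A\<close>, \<open>a\<close> are cosh and sinh of an inner radius,
  \<open>B\<close>, \<open>b\<close> those of the outer one, primes belong to the second ring. The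
  metric fixes the triple products \<open>D\<close>, \<open>D'\<close> up to sign, and the
  orientations of the rings are two inequalities for the signs. They decide both, because the
  product \<open>q * b * b'\<close> dominates \<open>a * a'\<close>.\<close>

lemma kite_signs:
  fixes q a A b B a' A' b' B' D D' :: real
  assumes q: "0 < q" "q \<le> 1" and AB: "A = q * B" "A' = q * B'"
    and sq: "A\<^sup>2 = 1 + a\<^sup>2" "B\<^sup>2 = 1 + b\<^sup>2" "A'\<^sup>2 = 1 + a'\<^sup>2" "B'\<^sup>2 = 1 + b'\<^sup>2"
    and pos: "0 < b" "0 < b'" "a \<noteq> 0" "a' \<noteq> 0" "0 < B" "0 < B'"
    and \<tau>: "\<tau> = 1 \<or> \<tau> = -1"
    and D: "D\<^sup>2 = (a * b')\<^sup>2" "D'\<^sup>2 = (a' * b)\<^sup>2"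
    and s: "0 < \<tau> * a * (D' * B' * a\<^sup>2 + D * A' * b\<^sup>2)" "0 < \<tau> * a' * (D' * A * b'\<^sup>2 + D * B * a'\<^sup>2)"
  shows "D = \<tau> * (a * b') \<and> D' = \<tau> * (a' * b)"
proof -
  have sign: "\<exists>\<sigma>. (\<sigma> = 1 \<or> \<sigma> = -1) \<and> X = \<tau> * \<sigma> * c" if "X\<^sup>2 = c\<^sup>2" for X c :: real
  proof -
    have "X = c \<or> X = - c" using that by (simp add: power2_eq_iff)
    then show ?thesis
    proof
      assume "X = c"
      then show ?thesis using \<tau> by (intro exI[of _ \<tau>]) auto
    next
      assume "X = - c"
      then show ?thesis using \<tau> by (intro exI[of _ "- \<tau>"]) auto
    qed
  qed
  obtain \<sigma> where \<sigma>: "\<sigma> = 1 \<or> \<sigma> = -1" "D = \<tau> * \<sigma> * (a * b')"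
    using sign[OF D(1)] by blast
  obtain \<sigma>' where \<sigma>': "\<sigma>' = 1 \<or> \<sigma>' = -1" "D' = \<tau> * \<sigma>' * (a' * b)"
    using sign[OF D(2)] by blast
  have \<tau>2: "\<tau> * \<tau> = 1" using \<tau> by auto
  have "\<tau> * a * (D' * B' * a\<^sup>2 + D * A' * b\<^sup>2) = (\<tau> * \<tau>) * (a\<^sup>2 * b * B') * (\<sigma>' * (a * a') + \<sigma> * (q * b * b'))"
    unfolding \<sigma> \<sigma>' AB by (simp add: power2_eq_square algebra_simps)
  then have "0 < (a\<^sup>2 * b * B') * (\<sigma>' * (a * a') + \<sigma> * (q * b * b'))"
    using s(1) unfolding \<tau>2 by linarith
  moreover have "0 < a\<^sup>2 * b * B'" using pos by simp
  ultimately have 1: "0 < \<sigma>' * (a * a') + \<sigma> * (q * b * b')"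
    by (rule zero_less_mult_pos)
  have "\<tau> * a' * (D' * A * b'\<^sup>2 + D * B * a'\<^sup>2) = (\<tau> * \<tau>) * (a'\<^sup>2 * b' * B) * (\<sigma>' * (q * b * b') + \<sigma> * (a * a'))"
    unfolding \<sigma> \<sigma>' AB by (simp add: power2_eq_square algebra_simps)
  then have "0 < (a'\<^sup>2 * b' * B) * (\<sigma>' * (q * b * b') + \<sigma> * (a * a'))"
    using s(2) unfolding \<tau>2 by linarith
  moreover have "0 < a'\<^sup>2 * b' * B" using pos by simp
  ultimately have 2: "0 < \<sigma>' * (q * b * b') + \<sigma> * (a * a')"
    by (rule zero_less_mult_pos)
  \<comment> \<open>Subtracting q^2 E^2 = q^2 + q^2 d^2 from q^2 E^2 = 1 + c^2 gives c^2 = q^2 d^2 -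
    (1 - q^2).\<close>
  have le: "\<bar>c\<bar> \<le> q * d" if "(q * E)\<^sup>2 = 1 + c\<^sup>2" "E\<^sup>2 = 1 + d\<^sup>2" "0 < d" for c d E :: real
  proof -
    have "c\<^sup>2 \<le> (q * d)\<^sup>2"
      using that q by (simp add: power_mult_distrib algebra_simps) (smt (verit) mult_left_le power_le_one zero_le_power2)
    then show ?thesis using that q by (simp add: abs_le_square_iff[symmetric])
  qed
  have "\<bar>a * a'\<bar> \<le> (q * b) * (q * b')"
    unfolding abs_mult using le[of B a b] le[of B' a' b'] sq AB pos by (intro mult_mono) auto
  also have "\<dots> \<le> q * b * b'"
    using q pos mult_right_mono[of "q * q" q "b * b'"] by (simp add: mult.commute mult.left_commute mult_left_le)
  finally have "\<bar>a * a'\<bar> \<le> q * b * b'" .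
  then have "\<sigma> = 1 \<and> \<sigma>' = 1" using 1 2 \<sigma>(1) \<sigma>'(1) by auto
  then show ?thesis using \<sigma> \<sigma>' by simp
qed

text \<open>\<open>x\<close> lies on the inner circle about \<open>p\<close> and the outer one about
  \<open>p'\<close>, \<open>x'\<close> the other way round. The orientation of a ring concerns one
  centre and both points; the linear dependence of the four vectors expresses these triple products
  by those of both centres and one point. The same dependence, with the values inserted, is the last
  claim.\<close>

lemma kite_orientation:
  fixes p p' x x' :: "real^3"
  assumes q: "0 < q" "q \<le> 1" and AB: "A = q * B" "A' = q * B'"
    and sq: "A\<^sup>2 = 1 + a\<^sup>2" "B\<^sup>2 = 1 + b\<^sup>2" "A'\<^sup>2 = 1 + a'\<^sup>2" "B'\<^sup>2 = 1 + b'\<^sup>2"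
    and pos: "0 < b" "0 < b'" "a \<noteq> 0" "a' \<noteq> 0" "0 < B" "0 < B'"
    and \<tau>: "\<tau> = 1 \<or> \<tau> = -1"
    and unit: "lor p p = -1" "lor p' p' = -1" "lor x x = -1" "lor x' x' = -1"
    and legs: "lor p x = - A" "lor p' x = - B'" "lor p x' = - B" "lor p' x' = - A'" "lor p p' = - (A * B')"
    and s: "0 < \<tau> * a * lor (lcross p x) x'" "0 < \<tau> * a' * lor (lcross p' x') x"
  shows "lor (lcross p x) p' = \<tau> * (a * b')" and "lor (lcross p' x') p = \<tau> * (a' * b)"
    and "((A * B')\<^sup>2 - 1) *\<^sub>R ((a' * b) *\<^sub>R x + (a * b') *\<^sub>R x') =
      (a' * b' * (A * b * b' + B * a * a')) *\<^sub>R p + (a * b * (B' * a * a' + A' * b * b')) *\<^sub>R p'"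
proof -
  define D D' E E2 where "D = lor (lcross p x) p'" and "D' = lor (lcross p' x') p"
    and "E = lor (lcross p x) x'" and "E2 = lor (lcross p' x') x"
  have D'_alt: "lor (lcross p p') x' = D'" unfolding D'_def by (simp add: lor_lcross_cyclic[of p p' x'])
  have E2_alt: "lor (lcross x p') x' = E2" unfolding E2_def by (simp add: lor_lcross_cyclic[of x p' x'])
  have AA: "A * B' = B * A'" using AB by simp
  have rel: "E2 *\<^sub>R p - D' *\<^sub>R x + E *\<^sub>R p' - D *\<^sub>R x' = 0"
    using four_vectors_dependent[of x p' x' p] unfolding D'_alt E2_alt D_def E_def .
  \<comment> \<open>This number is sinh^2 of the distance of the centres and, up to sign, the
    determinant of the system \<open>e1\<close>, \<open>e2\<close> for \<open>E\<close> and
    \<open>E2\<close>.\<close>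
  have Csq: "(A * B')\<^sup>2 - 1 = a\<^sup>2 * b'\<^sup>2 + a\<^sup>2 + b'\<^sup>2"
    by (simp add: power_mult_distrib sq algebra_simps)
  then have Cpos: "0 < (A * B')\<^sup>2 - 1" using pos by (simp add: add_pos_pos)
  have "lor (E2 *\<^sub>R p - D' *\<^sub>R x + E *\<^sub>R p' - D *\<^sub>R x') p = 0" "lor (E2 *\<^sub>R p - D' *\<^sub>R x + E *\<^sub>R p' - D *\<^sub>R x') p' = 0"
    by (simp_all only: rel lor_simps)
  then have e1: "E2 = D' * A + D * B - E * (A * B')" and e2: "E = D' * B' + D * A' - E2 * (A * B')"
    using unit legs by (simp_all add: lor_commute algebra_simps)
  have Ea: "((A * B')\<^sup>2 - 1) * E = D' * B' * a\<^sup>2 + D * A' * b\<^sup>2"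
  proof -
    have "((A * B')\<^sup>2 - 1) * E = D' * B' * (A\<^sup>2 - 1) + D * ((A * B') * B - A')"
      using e2 unfolding e1 by (simp add: power2_eq_square algebra_simps)
    also have "(A * B') * B - A' = A' * (B\<^sup>2 - 1)" unfolding AA by (simp add: power2_eq_square algebra_simps)
    finally show ?thesis using sq by simp
  qed
  have Eb: "((A * B')\<^sup>2 - 1) * E2 = D' * A * b'\<^sup>2 + D * B * a'\<^sup>2"
  proof -
    have "((A * B')\<^sup>2 - 1) * E2 = D' * ((A * B') * B' - A) + D * ((A * B') * A' - B)"
      using e1 unfolding e2 by (simp add: power2_eq_square algebra_simps)
    also have "(A * B') * B' - A = A * (B'\<^sup>2 - 1)" by (simp add: power2_eq_square algebra_simps)
    also have "(A * B') * A' - B = B * (A'\<^sup>2 - 1)" unfolding AA by (simp add: power2_eq_square algebra_simps)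
    finally show ?thesis using sq by (simp add: algebra_simps)
  qed
  have "0 < ((A * B')\<^sup>2 - 1) * (\<tau> * a * E)" "0 < ((A * B')\<^sup>2 - 1) * (\<tau> * a' * E2)"
    using s Cpos unfolding E_def E2_def by simp_all
  then have s1: "0 < \<tau> * a * (D' * B' * a\<^sup>2 + D * A' * b\<^sup>2)" and s2: "0 < \<tau> * a' * (D' * A * b'\<^sup>2 + D * B * a'\<^sup>2)"
    unfolding Ea[symmetric] Eb[symmetric] by (simp_all add: algebra_simps)
  have "D\<^sup>2 = (A\<^sup>2 - 1) * (B'\<^sup>2 - 1)"
    unfolding D_def lor_gram using unit legs
    by (simp add: lor_commute[of x p'] algebra_simps power2_eq_square)
  then have D2: "D\<^sup>2 = (a * b')\<^sup>2" using sq by (simp add: power_mult_distrib)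
  have "D'\<^sup>2 = (A'\<^sup>2 - 1) * (B\<^sup>2 - 1)"
    unfolding D'_def lor_gram using unit legs
    by (simp add: lor_commute[of x' p] lor_commute[of p' p] AA algebra_simps power2_eq_square)
  then have D'2: "D'\<^sup>2 = (a' * b)\<^sup>2" using sq by (simp add: power_mult_distrib)
  have DD: "D = \<tau> * (a * b')" "D' = \<tau> * (a' * b)"
    using kite_signs[OF q AB sq pos \<tau> D2 D'2 s1 s2] by simp_all
  then show "lor (lcross p x) p' = \<tau> * (a * b')" "lor (lcross p' x') p = \<tau> * (a' * b)"
    unfolding D_def D'_def by simp_all
  have \<tau>2: "\<tau> * \<tau> = 1" using \<tau> by auto
  let ?C = "(A * B')\<^sup>2 - 1"
  have "D' *\<^sub>R x + D *\<^sub>R x' = E2 *\<^sub>R p + E *\<^sub>R p'"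
    using rel by (simp add: algebra_simps)
  then have "(?C * \<tau>) *\<^sub>R (D' *\<^sub>R x + D *\<^sub>R x') = (?C * \<tau>) *\<^sub>R (E2 *\<^sub>R p + E *\<^sub>R p')" by simp
  then have 1: "?C *\<^sub>R ((\<tau> * D') *\<^sub>R x + (\<tau> * D) *\<^sub>R x') = (\<tau> * (?C * E2)) *\<^sub>R p + (\<tau> * (?C * E)) *\<^sub>R p'"
    by (simp add: scaleR_add_right mult_ac)
  have "\<tau> * D' = a' * b" "\<tau> * D = a * b'"
    "\<tau> * (?C * E2) = a' * b' * (A * b * b' + B * a * a')" "\<tau> * (?C * E) = a * b * (B' * a * a' + A' * b * b')"
    unfolding Ea Eb DD using \<tau>2 by (auto simp: power2_eq_square algebra_simps \<open>\<tau> = 1 \<or> \<tau> = -1\<close>)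
       (use \<tau> in auto)
  then show "?C *\<^sub>R ((a' * b) *\<^sub>R x + (a * b') *\<^sub>R x') =
      (a' * b' * (A * b * b' + B * a * a')) *\<^sub>R p + (a * b * (B' * a * a' + A' * b * b')) *\<^sub>R p'"
    using 1 by simp
qed

text \<open>Up to the common factor 2 sqrt q, \<rho> is the face radius of the second ring and
  \<delta> the vertex radius of the first. The identities make the closing sum a multiple of the
  kite relation: the coefficients of both points have the same factor, and with it those of the
  centres match.\<close>

lemma kite_closure_scalars:
  fixes q a A b B a' A' b' B' :: real
  assumes AB: "A = q * B" "A' = q * B'" and B: "B \<noteq> 0"
    and sq: "A\<^sup>2 = 1 + a\<^sup>2" "B\<^sup>2 = 1 + b\<^sup>2" "A'\<^sup>2 = 1 + a'\<^sup>2" "B'\<^sup>2 = 1 + b'\<^sup>2"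
  defines "\<rho> \<equiv> q * b' + a'" and "\<delta> \<equiv> (a + b) / B"
  shows "\<rho> * A * b' + \<delta> * a = \<rho> * B * a' + \<delta> * b"
    and "\<rho> * (a + b) * ((A * B')\<^sup>2 - 1) = (\<rho> * A * b' + \<delta> * a) * (A * b * b' + B * a * a')"
    and "\<delta> * (B' * a' + A' * b') * ((A * B')\<^sup>2 - 1) = (\<rho> * A * b' + \<delta> * a) * (B' * a * a' + A' * b * b')"
proof -
  have \<delta>: "\<delta> * B = a + b" using B by (simp add: \<delta>_def)
  have e: "B * (\<rho> * A * b' + \<delta> * a) = \<rho> * q * B\<^sup>2 * b' + (a + b) * a"
    "B * (\<rho> * B * a' + \<delta> * b) = \<rho> * B\<^sup>2 * a' + (a + b) * b"
    unfolding AB \<delta>[symmetric] by (simp_all add: power2_eq_square algebra_simps)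
  have sq': "q\<^sup>2 * B\<^sup>2 = 1 + a\<^sup>2" "q\<^sup>2 * B'\<^sup>2 = 1 + a'\<^sup>2"
    using sq unfolding AB by (simp_all add: power_mult_distrib)
  have rel: "(q * b')\<^sup>2 - a'\<^sup>2 = 1 - q\<^sup>2" "b\<^sup>2 - a\<^sup>2 = B\<^sup>2 * (1 - q\<^sup>2)"
    using sq sq' by (simp_all add: power_mult_distrib algebra_simps)
  have C: "(A * B')\<^sup>2 - 1 = B\<^sup>2 * a'\<^sup>2 + b\<^sup>2"
  proof -
    have "(A * B')\<^sup>2 - 1 = B\<^sup>2 * (q\<^sup>2 * B'\<^sup>2) - 1" unfolding AB by (simp add: power_mult_distrib)
    also have "\<dots> = B\<^sup>2 * a'\<^sup>2 + b\<^sup>2" unfolding sq' using sq(2) by (simp add: algebra_simps)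
    finally show ?thesis .
  qed
  \<comment> \<open>With s = B^2 and w = q b' a single relation between the variables suffices: b^2
    - a^2 and s (w^2 - a'^2) are both B^2 (1 - q^2).\<close>
  have key: "(w + a') * (a + b) * (s * a'\<^sup>2 + b\<^sup>2) = ((w + a') * w * s + (a + b) * a) * (w * b + a * a')"
    if "b\<^sup>2 - a\<^sup>2 = s * (w\<^sup>2 - a'\<^sup>2)" for w s :: real
    using that by algebra
  have main: "\<rho> * (a + b) * ((A * B')\<^sup>2 - 1) = (\<rho> * q * B\<^sup>2 * b' + (a + b) * a) * (q * b * b' + a * a')"
  proof -
    have "b\<^sup>2 - a\<^sup>2 = B\<^sup>2 * ((q * b')\<^sup>2 - a'\<^sup>2)" unfolding rel ..
    from key[OF this] show ?thesis unfolding \<rho>_def C by (simp only: mult_ac)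
  qed
  have "B * (\<rho> * A * b' + \<delta> * a) - B * (\<rho> * B * a' + \<delta> * b) = B\<^sup>2 * ((q * b')\<^sup>2 - a'\<^sup>2) - (b\<^sup>2 - a\<^sup>2)"
    unfolding e unfolding \<rho>_def by (simp add: power2_eq_square algebra_simps)
  then have "B * (\<rho> * A * b' + \<delta> * a) = B * (\<rho> * B * a' + \<delta> * b)"
    unfolding rel by simp
  then show 1: "\<rho> * A * b' + \<delta> * a = \<rho> * B * a' + \<delta> * b" using B by simp
  have "B * (\<rho> * (a + b) * ((A * B')\<^sup>2 - 1)) = B * ((\<rho> * A * b' + \<delta> * a) * (A * b * b' + B * a * a'))"
  proof -
    have "B * ((\<rho> * A * b' + \<delta> * a) * (A * b * b' + B * a * a')) =
        (\<rho> * q * B\<^sup>2 * b' + (a + b) * a) * (B * (q * b * b' + a * a'))"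
      unfolding e(1)[symmetric] AB by (simp add: algebra_simps)
    then show ?thesis using main by (simp add: algebra_simps)
  qed
  then show "\<rho> * (a + b) * ((A * B')\<^sup>2 - 1) = (\<rho> * A * b' + \<delta> * a) * (A * b * b' + B * a * a')" using B by simp
  have "B * (\<delta> * (B' * a' + A' * b') * ((A * B')\<^sup>2 - 1)) = B * ((\<rho> * A * b' + \<delta> * a) * (B' * a * a' + A' * b * b'))"
  proof -
    have "B * ((\<rho> * A * b' + \<delta> * a) * (B' * a * a' + A' * b * b')) =
        B' * ((\<rho> * q * B\<^sup>2 * b' + (a + b) * a) * (a * a' + q * b * b'))"
      unfolding e(1)[symmetric] AB by (simp add: algebra_simps)
    moreover have "B * (\<delta> * (B' * a' + A' * b') * ((A * B')\<^sup>2 - 1)) = B' * ((a + b) * \<rho> * ((A * B')\<^sup>2 - 1))"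
      unfolding \<rho>_def \<delta>[symmetric] AB by (simp add: algebra_simps)
    moreover have "(a + b) * \<rho> * ((A * B')\<^sup>2 - 1) = (\<rho> * q * B\<^sup>2 * b' + (a + b) * a) * (a * a' + q * b * b')"
      using main by (simp add: mult.commute add.commute)
    ultimately show ?thesis by simp
  qed
  then show "\<delta> * (B' * a' + A' * b') * ((A * B')\<^sup>2 - 1) = (\<rho> * A * b' + \<delta> * a) * (B' * a * a' + A' * b * b')" using B by simp
qed

text \<open>The summands are the increments of the dual net along the sides of a quad, up to signs
  and a common factor. The kite relation replaces the two points by the two centres, whose
  coefficients then cancel.\<close>

lemma kite_closure:
  fixes p p' x x' :: "real^3"
  assumes AB: "A = q * B" "A' = q * B'" and B: "B \<noteq> 0"
    and sq: "A\<^sup>2 = 1 + a\<^sup>2" "B\<^sup>2 = 1 + b\<^sup>2" "A'\<^sup>2 = 1 + a'\<^sup>2" "B'\<^sup>2 = 1 + b'\<^sup>2"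
    and nz: "a \<noteq> 0" "b \<noteq> 0" "a' \<noteq> 0" "b' \<noteq> 0"
    and kite: "((A * B')\<^sup>2 - 1) *\<^sub>R ((a' * b) *\<^sub>R x + (a * b') *\<^sub>R x') =
      (a' * b' * (A * b * b' + B * a * a')) *\<^sub>R p + (a * b * (B' * a * a' + A' * b * b')) *\<^sub>R p'"
  defines "\<rho> \<equiv> q * b' + a'" and "\<delta> \<equiv> (a + b) / B"
  shows "\<rho> *\<^sub>R ((1 / a) *\<^sub>R (p - A *\<^sub>R x) + (1 / b) *\<^sub>R (p - B *\<^sub>R x')) +
    \<delta> *\<^sub>R ((1 / b') *\<^sub>R (B' *\<^sub>R p' - x) + (1 / a') *\<^sub>R (A' *\<^sub>R p' - x')) = 0" (is "?Z = 0")
proof -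
  note s = kite_closure_scalars[OF AB B sq, folded \<rho>_def \<delta>_def]
  define \<mu> where "\<mu> = \<rho> * A * b' + \<delta> * a"
  define C where "C = (A * B')\<^sup>2 - 1"
  have "C = a\<^sup>2 * b'\<^sup>2 + a\<^sup>2 + b'\<^sup>2"
    unfolding C_def by (simp add: power_mult_distrib sq algebra_simps)
  then have C: "C \<noteq> 0" using nz by (metis add_nonneg_eq_0_iff mult_nonneg_nonneg power2_less_0 add_nonneg_nonneg zero_le_power2 power_eq_0_iff)
  define Z where "Z = ?Z"
  have "(a * b * a' * b') *\<^sub>R Z = (\<rho> * (a + b) * a' * b') *\<^sub>R p + (\<delta> * (B' * a' + A' * b') * a * b) *\<^sub>R p'
      - ((\<rho> * A * b' + \<delta> * a) *\<^sub>R ((a' * b) *\<^sub>R x)) - ((\<rho> * B * a' + \<delta> * b) *\<^sub>R ((a * b') *\<^sub>R x'))"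
    unfolding Z_def using nz by (simp add: vec3_eq_iff field_simps)
  then have "C *\<^sub>R ((a * b * a' * b') *\<^sub>R Z) = C *\<^sub>R ((\<rho> * (a + b) * a' * b') *\<^sub>R p + (\<delta> * (B' * a' + A' * b') * a * b) *\<^sub>R p'
      - (\<mu> *\<^sub>R ((a' * b) *\<^sub>R x)) - (\<mu> *\<^sub>R ((a * b') *\<^sub>R x')))"
    unfolding s(1)[symmetric] \<mu>_def[symmetric] by (rule arg_cong)
  also have "\<dots> = (C * (\<rho> * (a + b) * a' * b')) *\<^sub>R p + (C * (\<delta> * (B' * a' + A' * b') * a * b)) *\<^sub>R p'
      - \<mu> *\<^sub>R (C *\<^sub>R ((a' * b) *\<^sub>R x + (a * b') *\<^sub>R x'))"
    by (simp add: algebra_simps)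
  also have "\<dots> = (a' * b' * (\<rho> * (a + b) * C - \<mu> * (A * b * b' + B * a * a'))) *\<^sub>R p +
      (a * b * (\<delta> * (B' * a' + A' * b') * C - \<mu> * (B' * a * a' + A' * b * b'))) *\<^sub>R p'"
    unfolding kite[folded C_def] by (simp add: algebra_simps)
  also have "\<dots> = 0" using s(2,3) unfolding C_def \<mu>_def by simp
  finally show ?thesis using C nz unfolding Z_def by simp
qed

text \<open>The last equation makes \<open>x\<close> a continuous function of the two centres, which carries the convergence of
  patterns from centres to points of intersection.\<close>

lemma right_angle_frame:
  fixes p p' x :: "real^3"
  assumes unit: "lor p p = -1" "lor p' p' = -1" "lor x x = -1"
    and sq: "A\<^sup>2 = 1 + a\<^sup>2" "B\<^sup>2 = 1 + b\<^sup>2" and nz: "a \<noteq> 0" "b \<noteq> 0"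
    and legs: "lor p x = - A" "lor p' x = - B" "lor p p' = - (A * B)"
    and det: "lor (lcross p x) p' = a * b"
  defines "u \<equiv> (1 / a) *\<^sub>R (p - A *\<^sub>R x)" and "u' \<equiv> (1 / b) *\<^sub>R (p' - B *\<^sub>R x)"
  shows "lor u x = 0" "lor u u = 1" "u' = lcross u x"
    and "(A\<^sup>2 * b\<^sup>2 + a\<^sup>2) *\<^sub>R x = (A * b\<^sup>2) *\<^sub>R p + (B * a\<^sup>2) *\<^sub>R p' - (a * b) *\<^sub>R lcross p p'"
proof -
  have xp: "lor x p = - A" "lor x p' = - B" "lor p' p = - (A * B)" using legs by (simp_all add: lor_commute)
  have aa: "a * a = A * A - 1" "b * b = B * B - 1" using sq by (simp_all add: power2_eq_square)
  show ux: "lor u x = 0" unfolding u_def using unit legs by simp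
  have "lor u u = (A * A - 1) / (a * a)" unfolding u_def using unit legs xp nz by (simp add: field_simps)
  moreover have "A * A \<noteq> 1" using aa(1) nz(1) by auto
  ultimately show uu: "lor u u = 1" using aa by simp
  show u': "u' = lcross u x"
  proof (rule eq_lcross_if_orthogonal[OF uu unit(3) ux])
    show "lor u' u = 0" unfolding u_def u'_def using unit legs xp by (simp add: algebra_simps)
    show "lor u' x = 0" unfolding u'_def using unit legs by simp
    show "lor (lcross u x) u' = 1" unfolding u_def u'_def using nz det by (simp add: lcross_simps)
  qed
  have p: "p = A *\<^sub>R x + a *\<^sub>R u" "p' = B *\<^sub>R x + b *\<^sub>R u'" unfolding u_def u'_def using nz by simp_all
  have xu: "lor x u = 0" using ux by (simp add: lor_commute)
  have "lcross x u' = u" unfolding u' using lcross_minus[of x "lcross u x"] lcross_lcross[of u x x] ux unit by simp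
  moreover have "lcross u u' = x" unfolding u' using lcross_minus[of u "lcross u x"] lcross_lcross[of u x u] xu uu by simp
  ultimately have c: "lcross p p' = (A * b) *\<^sub>R u + (a * B) *\<^sub>R u' + (a * b) *\<^sub>R x"
    unfolding p lcross_simps using u' by (simp add: algebra_simps)
  have "(A * b\<^sup>2) *\<^sub>R p + (B * a\<^sup>2) *\<^sub>R p' - (a * b) *\<^sub>R lcross p p' = (A\<^sup>2 * b\<^sup>2 + B\<^sup>2 * a\<^sup>2 - a\<^sup>2 * b\<^sup>2) *\<^sub>R x"
    unfolding c by (subst p(1), subst p(2)) (simp add: vec3_eq_iff power2_eq_square algebra_simps)
  also have "A\<^sup>2 * b\<^sup>2 + B\<^sup>2 * a\<^sup>2 - a\<^sup>2 * b\<^sup>2 = A\<^sup>2 * b\<^sup>2 + a\<^sup>2" unfolding sq(2) by (simp add: algebra_simps)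
  finally show "(A\<^sup>2 * b\<^sup>2 + a\<^sup>2) *\<^sub>R x = (A * b\<^sup>2) *\<^sub>R p + (B * a\<^sup>2) *\<^sub>R p' - (a * b) *\<^sub>R lcross p p'" by simp
qed

section \<open>Jacobi elliptic functions near modulus 1\<close>

definition elliptic_integrand :: "real \<Rightarrow> real \<Rightarrow> real" where
  "elliptic_integrand k \<theta> = 1 / sqrt (1 - k\<^sup>2 * (sin \<theta>)\<^sup>2)"

lemma elliptic_integrand_even: "elliptic_integrand k (- \<theta>) = elliptic_integrand k \<theta>"
  by (simp add: elliptic_integrand_def)

lemma elliptic_radicand:
  assumes "0 \<le> k" "k \<le> 1"
  shows "0 \<le> 1 - k\<^sup>2 * (sin \<theta>)\<^sup>2" and "k < 1 \<or> \<bar>\<theta>\<bar> < pi / 2 \<Longrightarrow> 0 < 1 - k\<^sup>2 * (sin \<theta>)\<^sup>2"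
proof -
  have s: "(sin \<theta>)\<^sup>2 \<le> 1" by (simp add: abs_square_le_1)
  have k: "k\<^sup>2 \<le> 1" using assms by (simp add: abs_square_le_1)
  show "0 \<le> 1 - k\<^sup>2 * (sin \<theta>)\<^sup>2"
    using mult_mono[OF k s] by simp
  show "0 < 1 - k\<^sup>2 * (sin \<theta>)\<^sup>2" if "k < 1 \<or> \<bar>\<theta>\<bar> < pi / 2"
    using that
  proof
    assume "k < 1"
    then have "k\<^sup>2 < 1" using assms by (simp add: abs_square_less_1)
    moreover have "k\<^sup>2 * (sin \<theta>)\<^sup>2 \<le> k\<^sup>2" using s by (simp add: mult_left_le)
    ultimately show ?thesis by simp
  next
    assume "\<bar>\<theta>\<bar> < pi / 2"
    then have "0 < cos \<theta>" by (intro cos_gt_zero_pi) auto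
    then have "(sin \<theta>)\<^sup>2 < 1" by (simp add: sin_squared_eq)
    moreover have "k\<^sup>2 * (sin \<theta>)\<^sup>2 \<le> (sin \<theta>)\<^sup>2" using k by (simp add: mult_left_le_one_le)
    ultimately show ?thesis by simp
  qed
qed

lemma elliptic_integrand_nonneg: "0 \<le> k \<Longrightarrow> k \<le> 1 \<Longrightarrow> 0 \<le> elliptic_integrand k \<theta>"
  using elliptic_radicand(1) by (simp add: elliptic_integrand_def)

lemma elliptic_integrand_ge_1:
  assumes "0 \<le> k" "k \<le> 1" "k < 1 \<or> \<bar>\<theta>\<bar> < pi / 2"
  shows "1 \<le> elliptic_integrand k \<theta>"
proof -
  have "0 < sqrt (1 - k\<^sup>2 * (sin \<theta>)\<^sup>2)" using elliptic_radicand(2)[OF assms] by simp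
  moreover have "sqrt (1 - k\<^sup>2 * (sin \<theta>)\<^sup>2) \<le> 1" by simp
  ultimately show ?thesis by (simp add: elliptic_integrand_def)
qed

lemma elliptic_integrand_integrable:
  assumes "0 \<le> k" "k \<le> 1" "k < 1 \<or> (- (pi / 2) < a \<and> b < pi / 2)"
  shows "elliptic_integrand k integrable_on {a..b}"
proof -
  have "continuous_on {a..b} (elliptic_integrand k)"
    unfolding elliptic_integrand_def
  proof (intro continuous_intros ballI)
    fix \<theta> assume "\<theta> \<in> {a..b}"
    then have "k < 1 \<or> \<bar>\<theta>\<bar> < pi / 2" using assms(3) by auto
    from elliptic_radicand(2)[OF assms(1,2) this] show "sqrt (1 - k\<^sup>2 * (sin \<theta>)\<^sup>2) \<noteq> 0" by simp
  qed
  then show ?thesis by (rule integrable_continuous_real)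
qed

text \<open>For modulus 1 the interval may reach beyond the pole at \<open>pi / 2\<close>. Up to
  \<open>min \<phi> 1\<close>, which is below the pole, the integrand is at least 1; on the rest it
  is merely nonnegative.\<close>

lemma elliptic_integral_pos:
  assumes k: "0 \<le> k" "k \<le> 1" and "0 < \<phi>" "(elliptic_integrand k has_integral v) {0..\<phi>}"
  shows "0 < v"
proof -
  define t where "t = min \<phi> 1"
  have t: "0 < t" "t \<le> \<phi>" "t < pi / 2" using assms pi_half_gt_zero pi_gt3 by (auto simp: t_def)
  have int: "elliptic_integrand k integrable_on {0..t}"
    using t by (intro elliptic_integrand_integrable k) auto
  have "integral {0..t} (\<lambda>_. 1) \<le> integral {0..t} (elliptic_integrand k)"
  proof (rule integral_le[OF _ int])
    show "(\<lambda>_. 1::real) integrable_on {0..t}" by (rule integrable_const_ivl)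
    show "1 \<le> elliptic_integrand k x" if "x \<in> {0..t}" for x
      using that t by (intro elliptic_integrand_ge_1 k) auto
  qed
  moreover have "integral {0..t} (elliptic_integrand k) \<le> v"
    using has_integral_subset_le[OF _ integrable_integral[OF int] assms(4)] elliptic_integrand_nonneg[OF k] t by auto
  ultimately show ?thesis using t by simp
qed

definition amplitude_of :: "real \<Rightarrow> real \<Rightarrow> real \<Rightarrow> bool" where
  "amplitude_of k u \<phi> \<longleftrightarrow> (0 \<le> \<phi> \<and> (elliptic_integrand k has_integral u) {0..\<phi>}) \<or>
     (\<phi> \<le> 0 \<and> (elliptic_integrand k has_integral - u) {\<phi>..0})"

lemma jacobi_am_alt: "jacobi_am u k = (THE \<phi>. amplitude_of k u \<phi>)"
  by (simp add: jacobi_am_def amplitude_of_def elliptic_integrand_def[abs_def])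

lemma elliptic_integral_reflect:
  "(elliptic_integrand k has_integral v) {- \<phi>..0} \<longleftrightarrow> (elliptic_integrand k has_integral v) {0..\<phi>}"
  using has_integral_reflect_real[of "elliptic_integrand k" v \<phi> 0] by (simp add: elliptic_integrand_even)

lemma amplitude_of_minus: "amplitude_of k (- u) (- \<phi>) \<longleftrightarrow> amplitude_of k u \<phi>"
  using elliptic_integral_reflect[of k "u" \<phi>] elliptic_integral_reflect[of k "- u" "- \<phi>"]
  by (auto simp: amplitude_of_def)

text \<open>The negative branch would, after reflection, be a positive integral with the value
  \<open>- u\<close>.\<close>

lemma amplitude_of_nonneg:
  assumes k: "0 \<le> k" "k \<le> 1" and u: "0 \<le> u" and "amplitude_of k u \<phi>"
  shows "0 \<le> \<phi>" "(elliptic_integrand k has_integral u) {0..\<phi>}"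
proof -
  have *: "\<not> \<phi> < 0" if "(elliptic_integrand k has_integral - u) {\<phi>..0}"
    using elliptic_integral_pos[OF k, of "- \<phi>" "- u"] elliptic_integral_reflect[of k "- u" "- \<phi>"] that u by auto
  then show \<phi>: "0 \<le> \<phi>"
    using assms(4) by (force simp: amplitude_of_def)
  show "(elliptic_integrand k has_integral u) {0..\<phi>}"
  proof (cases "\<phi> = 0")
    case True
    then show ?thesis using assms(4) by (auto simp: amplitude_of_def has_integral_refl dest: has_integral_unique[of _ _ _ 0])
  next
    case False
    then show ?thesis using assms(4) \<phi> by (auto simp: amplitude_of_def)
  qed
qed

lemma elliptic_integral_strict_mono:
  assumes k: "0 \<le> k" "k < 1" and "0 \<le> \<phi>" "\<phi> < \<psi>"
  shows "integral {0..\<phi>} (elliptic_integrand k) < integral {0..\<psi>} (elliptic_integrand k)"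
proof -
  have int: "elliptic_integrand k integrable_on {a..b}" for a b
    using k by (intro elliptic_integrand_integrable) auto
  have "integral {0..\<phi>} (elliptic_integrand k) + integral {\<phi>..\<psi>} (elliptic_integrand k) = integral {0..\<psi>} (elliptic_integrand k)"
    using assms int by (intro Henstock_Kurzweil_Integration.integral_combine) auto
  moreover have "integral {\<phi>..\<psi>} (\<lambda>_. 1) \<le> integral {\<phi>..\<psi>} (elliptic_integrand k)"
    using k by (intro integral_le int integrable_const_ivl elliptic_integrand_ge_1) auto
  ultimately show ?thesis using assms by simp
qed

text \<open>An integrand of at least 1 makes the integral reach \<open>u\<close> no later than at
  the upper limit \<open>u\<close>: existence is the intermediate value theorem, uniqueness is
  strict monotonicity.\<close>

lemma jacobi_am_inverse:
  assumes k: "0 \<le> k" "k < 1" and u: "0 < u"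
  shows "0 < jacobi_am u k" "integral {0..jacobi_am u k} (elliptic_integrand k) = u"
proof -
  have int: "elliptic_integrand k integrable_on {a..b}" for a b
    using k by (intro elliptic_integrand_integrable) auto
  have "integral {0..u} (\<lambda>_. 1) \<le> integral {0..u} (elliptic_integrand k)"
    using k by (intro integral_le int integrable_const_ivl elliptic_integrand_ge_1) auto
  then have "u \<le> integral {0..u} (elliptic_integrand k)" using u by simp
  then obtain \<phi> where \<phi>: "0 \<le> \<phi>" "integral {0..\<phi>} (elliptic_integrand k) = u"
    using IVT'[of "\<lambda>\<phi>. integral {0..\<phi>} (elliptic_integrand k)" 0 u u] u indefinite_integral_continuous_1[OF int, of 0 u]
    by auto
  have "jacobi_am u k = \<phi>"
    unfolding jacobi_am_alt
  proof (rule the_equality)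
    show "amplitude_of k u \<phi>"
      unfolding amplitude_of_def using \<phi> integrable_integral[OF int, of 0 \<phi>] by auto
    fix \<psi> assume "amplitude_of k u \<psi>"
    from amplitude_of_nonneg[OF _ _ _ this] have "0 \<le> \<psi>" "integral {0..\<psi>} (elliptic_integrand k) = u"
      using k u by (auto intro: integral_unique)
    then show "\<psi> = \<phi>"
      using elliptic_integral_strict_mono[OF k, of \<phi> \<psi>] elliptic_integral_strict_mono[OF k, of \<psi> \<phi>] \<phi> by force
  qed
  moreover have "\<phi> \<noteq> 0" using \<phi> u by auto
  ultimately show "0 < jacobi_am u k" "integral {0..jacobi_am u k} (elliptic_integrand k) = u"
    using \<phi> by auto
qed

text \<open>Before the pole the integrand is the secant; its antiderivative is the inverse
  Gudermannian function.\<close>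

lemma elliptic_integral_modulus_1:
  assumes "0 \<le> \<phi>" "\<phi> < pi / 2"
  shows "(elliptic_integrand 1 has_integral arsinh (tan \<phi>)) {0..\<phi>}"
proof -
  have "((\<lambda>\<theta>. arsinh (tan \<theta>)) has_vector_derivative elliptic_integrand 1 \<theta>) (at \<theta> within {0..\<phi>})"
    if "\<theta> \<in> {0..\<phi>}" for \<theta>
  proof -
    have c: "0 < cos \<theta>" using that assms by (intro cos_gt_zero_pi) auto
    have s: "sqrt (1 - (sin \<theta>)\<^sup>2) = cos \<theta>" using c by (simp add: cos_squared_eq[symmetric])
    have t: "sqrt ((tan \<theta>)\<^sup>2 + 1) = inverse (cos \<theta>)"
      using c tan_sec[of \<theta>] by (simp add: add.commute real_sqrt_unique)
    have "((\<lambda>\<theta>. arsinh (tan \<theta>)) has_real_derivative 1 / sqrt ((tan \<theta>)\<^sup>2 + 1) * inverse ((cos \<theta>)\<^sup>2)) (at \<theta>)"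
      using c by (intro DERIV_chain2[OF arsinh_real_has_field_derivative] DERIV_tan) simp
    also have "1 / sqrt ((tan \<theta>)\<^sup>2 + 1) * inverse ((cos \<theta>)\<^sup>2) = elliptic_integrand 1 \<theta>"
      unfolding t elliptic_integrand_def using c s by (simp add: power2_eq_square field_simps)
    finally show ?thesis
      by (simp add: has_field_derivative_at_within has_real_derivative_iff_has_vector_derivative[symmetric])
  qed
  from fundamental_theorem_of_calculus[OF assms(1) this] show ?thesis by simp
qed

lemma amplitude_of_modulus_1_iff:
  assumes u: "0 \<le> u"
  shows "amplitude_of 1 u \<phi> \<longleftrightarrow> \<phi> = arctan (sinh u)"
proof
  have *: "0 \<le> arctan (sinh t)" "arctan (sinh t) < pi / 2" if "0 \<le> t" for t :: real
    using that arctan_ubound by simp_all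
  show "amplitude_of 1 u \<phi>" if "\<phi> = arctan (sinh u)"
    unfolding amplitude_of_def that using elliptic_integral_modulus_1[OF *[OF u]] *[OF u] by (simp add: tan_arctan arsinh_sinh_real)
  assume "amplitude_of 1 u \<phi>"
  from amplitude_of_nonneg[OF _ _ u this] have \<phi>: "0 \<le> \<phi>" "(elliptic_integrand 1 has_integral u) {0..\<phi>}"
    by simp_all
  show "\<phi> = arctan (sinh u)"
  proof (cases "\<phi> < pi / 2")
    case True
    then have "arsinh (tan \<phi>) = u"
      using has_integral_unique[OF elliptic_integral_modulus_1[OF \<phi>(1)] \<phi>(2)] by simp
    then have "tan \<phi> = sinh u" by (metis sinh_arsinh_real)
    then show ?thesis using True \<phi>(1) pi_half_gt_zero arctan_tan[of \<phi>] by simp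
  next
    case False
    \<comment> \<open>An integral reaching \<open>pi / 2\<close> would bound the one up to
      \<open>t\<close>, which already has the value \<open>u + 1\<close>.\<close>
    define t where "t = arctan (sinh (u + 1))"
    have t: "0 \<le> t" "t < pi / 2" using *[of "u + 1"] u by (auto simp: t_def)
    have "(elliptic_integrand 1 has_integral (u + 1)) {0..t}"
      using elliptic_integral_modulus_1[OF t] by (simp add: t_def tan_arctan arsinh_sinh_real)
    then have "u + 1 \<le> u"
      using t False \<phi> elliptic_integrand_nonneg[of 1] by (intro has_integral_subset_le[of "{0..t}" "{0..\<phi>}"]) auto
    then show ?thesis by simp
  qed
qed

lemma jacobi_am_modulus_1: "jacobi_am u 1 = arctan (sinh u)"
proof (cases "0 \<le> u")
  case True
  then show ?thesis by (simp add: jacobi_am_alt amplitude_of_modulus_1_iff)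
next
  case False
  then have "amplitude_of 1 u \<phi> \<longleftrightarrow> - \<phi> = arctan (sinh (- u))" for \<phi>
    using amplitude_of_minus[of 1 u \<phi>] amplitude_of_modulus_1_iff[of "- u" "- \<phi>"] by simp
  then have "amplitude_of 1 u \<phi> \<longleftrightarrow> \<phi> = arctan (sinh u)" for \<phi>
    by (auto simp: arctan_minus)
  then show ?thesis by (simp add: jacobi_am_alt)
qed

lemma elliptic_integral_tendsto:
  assumes k: "(k \<longlongrightarrow> 1) F" "\<forall>\<^sub>F x in F. 0 \<le> k x \<and> k x \<le> 1" and a: "0 \<le> a" "a < pi / 2"
  shows "((\<lambda>x. integral {0..a} (elliptic_integrand (k x))) \<longlongrightarrow> arsinh (tan a)) F"
proof -
  have "continuous_on ({0..1} \<times> cbox 0 a) (\<lambda>(k, \<theta>). elliptic_integrand k \<theta>)"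
    unfolding elliptic_integrand_def split_beta
  proof (intro continuous_intros ballI)
    fix z :: "real \<times> real" assume "z \<in> {0..1} \<times> cbox 0 a"
    then show "sqrt (1 - (fst z)\<^sup>2 * (sin (snd z))\<^sup>2) \<noteq> 0"
      using elliptic_radicand(2)[of "fst z" "snd z"] a by auto
  qed
  then have "continuous_on {0..1} (\<lambda>k. integral (cbox 0 a) (elliptic_integrand k))"
    by (rule integral_continuous_on_param)
  then have "((\<lambda>x. integral {0..a} (elliptic_integrand (k x))) \<longlongrightarrow> integral {0..a} (elliptic_integrand 1)) F"
    using continuous_on_tendsto_compose[of "{0..1}" "\<lambda>k. integral {0..a} (elliptic_integrand k)" k 1 F] k by simp
  then show ?thesis using integral_unique[OF elliptic_integral_modulus_1[OF a]] by simp
qed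

text \<open>By monotonicity a bound on the amplitude is a bound on the integral up to a fixed
  number. Below \<open>pi / 2\<close> this integral is continuous in the modulus up to 1, so the
  bound at the limit is strict and persists nearby.\<close>

lemma jacobi_am_tendsto:
  assumes u: "(u \<longlongrightarrow> u0) F" "0 < u0" and k: "(k \<longlongrightarrow> 1) F" "\<forall>\<^sub>F x in F. 0 \<le> k x \<and> k x < 1"
  shows "((\<lambda>x. jacobi_am (u x) (k x)) \<longlongrightarrow> jacobi_am u0 1) F"
proof (rule order_tendstoI)
  have u_pos: "\<forall>\<^sub>F x in F. 0 < u x" using u by (rule order_tendstoD(1))
  have k': "\<forall>\<^sub>F x in F. 0 \<le> k x \<and> k x \<le> 1" using k(2) by (rule eventually_mono) auto
  have am0: "jacobi_am u0 1 = arctan (sinh u0)" using u by (simp add: jacobi_am_modulus_1)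
  have mono: "integral {0..a} (elliptic_integrand k) < integral {0..b} (elliptic_integrand k) \<longleftrightarrow> a < b"
    if "0 \<le> a" "0 \<le> b" "0 \<le> k" "k < 1" for a b k
    using elliptic_integral_strict_mono[of k a b] elliptic_integral_strict_mono[of k b a] that
    by (metis linorder_neqE_linordered_idom order_less_asym order_less_irrefl)
  fix a
  show "\<forall>\<^sub>F x in F. a < jacobi_am (u x) (k x)" if "a < jacobi_am u0 1"
  proof (cases "a < 0")
    case True
    show ?thesis
      using u_pos k(2)
    proof eventually_elim
      case (elim x)
      then show ?case using jacobi_am_inverse(1)[of "k x" "u x"] True by linarith
    qed
  next
    case False
    then have a: "0 \<le> a" "a < pi / 2" using that am0 arctan_ubound[of "sinh u0"] by linarith+
    have "tan a < sinh u0"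
      using that a arctan_less_iff[of "tan a" "sinh u0"] arctan_tan[of a] am0 by simp
    then have "arsinh (tan a) < u0" by (metis arsinh_less_iff_real arsinh_sinh_real)
    then have "\<forall>\<^sub>F x in F. integral {0..a} (elliptic_integrand (k x)) < u x"
      using order_tendstoD(2)[OF tendsto_diff[OF elliptic_integral_tendsto[OF k(1) k' a] u(1)], of 0] by simp
    then show ?thesis
      using u_pos k(2)
    proof eventually_elim
      case (elim x)
      then show ?case using mono[of a "jacobi_am (u x) (k x)" "k x"] jacobi_am_inverse[of "k x" "u x"] a by simp
    qed
  qed
  show "\<forall>\<^sub>F x in F. jacobi_am (u x) (k x) < a" if "jacobi_am u0 1 < a"
  proof -
    \<comment> \<open>The upper bound is lowered below \<open>pi / 2\<close>, as the limit of the
      integral is available only there.\<close>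
    define c where "c = min a ((jacobi_am u0 1 + pi / 2) / 2)"
    have c0: "jacobi_am u0 1 < c" "c \<le> a" "c < pi / 2"
      using that am0 arctan_ubound[of "sinh u0"] by (auto simp: c_def min_def)
    have c: "0 \<le> c" "c < pi / 2" using c0 am0 u by simp_all (smt (verit) zero_less_arctan_iff sinh_real_pos_iff)
    have "sinh u0 < tan c"
      using c0 c arctan_less_iff[of "sinh u0" "tan c"] arctan_tan[of c] am0 by simp
    then have "u0 < arsinh (tan c)" by (metis arsinh_less_iff_real arsinh_sinh_real)
    then have "\<forall>\<^sub>F x in F. u x < integral {0..c} (elliptic_integrand (k x))"
      using order_tendstoD(1)[OF tendsto_diff[OF elliptic_integral_tendsto[OF k(1) k' c] u(1)], of 0] by simp
    then show ?thesis
      using u_pos k(2)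
    proof eventually_elim
      case (elim x)
      then have "jacobi_am (u x) (k x) < c"
        using mono[of "jacobi_am (u x) (k x)" c "k x"] jacobi_am_inverse[of "k x" "u x"] c by simp
      then show ?case using c0 by simp
    qed
  qed
qed

text \<open>Together with the positivity of \<open>sn\<close> this makes all inner radii of the
  limit pattern positive.\<close>

lemma jacobi_cn_modulus_1_pos: "0 < jacobi_cn u 1"
  unfolding jacobi_cn_def jacobi_am_modulus_1 by (simp add: cos_arctan add_pos_nonneg)

lemma jacobi_sn_modulus_1_pos_iff: "0 < jacobi_sn u 1 \<longleftrightarrow> 0 < u"
proof -
  have "jacobi_sn u 1 = sinh u / sqrt (1 + (sinh u)\<^sup>2)"
    unfolding jacobi_sn_def jacobi_am_modulus_1 by (simp add: sin_arctan)
  moreover have "0 < sqrt (1 + (sinh u)\<^sup>2)" by (simp add: add_pos_nonneg)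
  ultimately show ?thesis by (simp add: zero_less_divide_iff)
qed

lemma jacobi_tendsto:
  fixes F :: "real filter"
  assumes "(u \<longlongrightarrow> u0) F" "0 < u0" "(k \<longlongrightarrow> 1) F" "\<forall>\<^sub>F x in F. 0 \<le> k x \<and> k x < 1"
  shows "((\<lambda>x. jacobi_sn (u x) (k x)) \<longlongrightarrow> jacobi_sn u0 1) F"
    and "((\<lambda>x. jacobi_cn (u x) (k x)) \<longlongrightarrow> jacobi_cn u0 1) F"
    and "((\<lambda>x. jacobi_dn (u x) (k x)) \<longlongrightarrow> jacobi_dn u0 1) F"
proof -
  show s: "((\<lambda>x. jacobi_sn (u x) (k x)) \<longlongrightarrow> jacobi_sn u0 1) F"
    unfolding jacobi_sn_def by (rule tendsto_sin[OF jacobi_am_tendsto[OF assms]])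
  show "((\<lambda>x. jacobi_cn (u x) (k x)) \<longlongrightarrow> jacobi_cn u0 1) F"
    unfolding jacobi_cn_def by (rule tendsto_cos[OF jacobi_am_tendsto[OF assms]])
  show "((\<lambda>x. jacobi_dn (u x) (k x)) \<longlongrightarrow> jacobi_dn u0 1) F"
    unfolding jacobi_dn_def by (intro tendsto_intros s assms)
qed

section \<open>Ring patterns\<close>

text \<open>The reversed Cauchy-Schwarz inequality, by which \<open>arcosh\<close> in the hyperbolic
  distance can be inverted.\<close>

lemma hyperbolic_plane_lor_le:
  assumes "x \<in> hyperbolic_plane" "y \<in> hyperbolic_plane"
  shows "lor x y \<le> -1"
proof -
  obtain x1 x2 x3 y1 y2 y3 where c: "x $ 1 = x1" "x $ 2 = x2" "x $ 3 = x3" "y $ 1 = y1" "y $ 2 = y2" "y $ 3 = y3" by blast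
  have x: "x3 * x3 = 1 + x1 * x1 + x2 * x2" "0 < x3" and y: "y3 * y3 = 1 + y1 * y1 + y2 * y2" "0 < y3"
    using assms unfolding hyperbolic_plane_def lor_def c mem_Collect_eq by linarith+
  have "(1 + (x1 * y1 + x2 * y2))\<^sup>2 \<le> (x3 * y3)\<^sup>2"
  proof -
    have "(x3 * y3)\<^sup>2 = (x3 * x3) * (y3 * y3)" by (simp add: power2_eq_square)
    then have "(x3 * y3)\<^sup>2 - (1 + (x1 * y1 + x2 * y2))\<^sup>2 = (x1 - y1)\<^sup>2 + (x2 - y2)\<^sup>2 + (x1 * y2 - x2 * y1)\<^sup>2"
      unfolding x(1) y(1) by (simp add: power2_eq_square algebra_simps)
    moreover have "0 \<le> (x1 - y1)\<^sup>2 + (x2 - y2)\<^sup>2 + (x1 * y2 - x2 * y1)\<^sup>2" by simp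
    ultimately show ?thesis by linarith
  qed
  then have "1 + (x1 * y1 + x2 * y2) \<le> x3 * y3"
    by (rule power2_le_imp_le) (rule mult_nonneg_nonneg[OF less_imp_le[OF x(2)] less_imp_le[OF y(2)]])
  then show ?thesis by (simp add: lor_def c)
qed

lemma hcircle_lor:
  assumes "p \<in> hyperbolic_plane" "x \<in> hcircle p \<rho>"
  shows "lor p x = - cosh \<rho>" "lor x x = -1"
proof -
  have x: "x \<in> hyperbolic_plane" "arcosh (- lor p x) = \<rho>" using assms by (auto simp: hcircle_def hdist_def)
  then show "lor p x = - cosh \<rho>" using hyperbolic_plane_lor_le[OF assms(1) x(1)] by auto
  show "lor x x = -1" using x by (simp add: hyperbolic_plane_def)
qed

definition ring_cosh :: "lattice_graph \<Rightarrow> ring_data \<Rightarrow> lattice_point \<Rightarrow> lattice_point \<Rightarrow> real" where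
  "ring_cosh G P v b = (if horizontal G v b then cosh (inner_rad P v) else cosh (outer_rad P v))"

definition ring_sinh :: "lattice_graph \<Rightarrow> ring_data \<Rightarrow> lattice_point \<Rightarrow> lattice_point \<Rightarrow> real" where
  "ring_sinh G P v b = (if horizontal G v b then sinh (inner_rad P v) else sinh (outer_rad P v))"

text \<open>The linear dependence of the centres and points of a quad found in
  \<open>kite_orientation\<close>. Being linear, it survives motions.\<close>

definition kite_relation :: "ring_data \<Rightarrow> lattice_point \<Rightarrow> lattice_point \<Rightarrow> lattice_point \<Rightarrow> lattice_point \<Rightarrow> bool" where
  "kite_relation P v b v' b' \<longleftrightarrow>
     (let A = cosh (inner_rad P v); a = sinh (inner_rad P v); B = cosh (outer_rad P v); b1 = sinh (outer_rad P v);
          A' = cosh (inner_rad P v'); a' = sinh (inner_rad P v'); B' = cosh (outer_rad P v'); b1' = sinh (outer_rad P v')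
      in ((A * B')\<^sup>2 - 1) *\<^sub>R ((a' * b1) *\<^sub>R pt P b + (a * b1') *\<^sub>R pt P b') =
         (a' * b1' * (A * b1 * b1' + B * a * a')) *\<^sub>R ctr P v + (a * b1 * (B' * a * a' + A' * b1 * b1')) *\<^sub>R ctr P v')"

text \<open>The metric content of a ring pattern, with the orientations of the rings turned into the signs of
  determinants.\<close>

definition lorentz_pattern :: "lattice_graph \<Rightarrow> real \<Rightarrow> ring_data \<Rightarrow> bool" where
  "lorentz_pattern G q P \<longleftrightarrow>
     0 < q \<and> q \<le> 1 \<and>
     (\<forall>v \<in> white_vertices G. lor (ctr P v) (ctr P v) = -1 \<and> outer_rad P v > 0 \<and> inner_rad P v \<noteq> 0 \<and>
        q * cosh (outer_rad P v) = cosh (inner_rad P v)) \<and>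
     (\<forall>v b. incident G v b \<longrightarrow> lor (pt P b) (pt P b) = -1 \<and> lor (ctr P v) (pt P b) = - ring_cosh G P v b) \<and>
     (\<forall>v b v' b'. quad G v b v' b' \<longrightarrow>
        lor (ctr P v) (ctr P v') = - (ring_cosh G P v b * ring_cosh G P v' b) \<and>
        lor (lcross (ctr P v) (pt P b)) (ctr P v') = ring_sinh G P v b * ring_sinh G P v' b) \<and>
     (\<forall>v b v' b'. (quad G v b v' b' \<or> quad G v b' v' b) \<and> horizontal G v b \<longrightarrow> kite_relation P v b v' b')"

text \<open>Every quad is read so that the step from \<open>v\<close> to \<open>b\<close> is
  horizontal; \<tau> records whether this reverses its orientation.\<close>

lemma ring_pattern_kite:
  assumes G: "s_quad_graph G" and P: "ring_pattern G q P"
    and \<tau>: "\<tau> = 1 \<and> quad G v b v' b' \<or> \<tau> = -1 \<and> quad G v b' v' b" and h: "horizontal G v b"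
  shows "lor (ctr P v) (ctr P v') = - (ring_cosh G P v b * ring_cosh G P v' b)"
    and "lor (lcross (ctr P v) (pt P b)) (ctr P v') = \<tau> * (ring_sinh G P v b * ring_sinh G P v' b)"
    and "kite_relation P v b v' b'"
proof -
  have q: "0 < q" "q \<le> 1" using P by (auto simp: ring_pattern_def)
  have f: "incident G v b" "incident G v b'" "incident G v' b" "incident G v' b'" "v \<in> white_vertices G" "v' \<in> white_vertices G"
    "\<not> horizontal G v b'" "\<not> horizontal G v' b" "horizontal G v' b'"
  proof -
    have "incident G v b \<and> incident G v b' \<and> incident G v' b \<and> incident G v' b' \<and> v \<in> white_vertices G \<and>
      v' \<in> white_vertices G \<and> \<not> horizontal G v b' \<and> \<not> horizontal G v' b \<and> horizontal G v' b'"
      using \<tau>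
    proof (elim disjE conjE)
      assume "quad G v b v' b'"
      from quad_facts[OF G this] h show ?thesis by simp
    next
      assume "quad G v b' v' b"
      from quad_facts[OF G this] h show ?thesis by simp
    qed
    then show "incident G v b" "incident G v b'" "incident G v' b" "incident G v' b'" "v \<in> white_vertices G" "v' \<in> white_vertices G"
    "\<not> horizontal G v b'" "\<not> horizontal G v' b" "horizontal G v' b'" by simp_all
  qed
  have white: "ctr P u \<in> hyperbolic_plane" "outer_rad P u > 0" "inner_rad P u \<noteq> 0" "cosh (inner_rad P u) = q * cosh (outer_rad P u)"
    if "u \<in> white_vertices G" for u using P that unfolding ring_pattern_def by auto
  have circ: "pt P c \<in> hcircle (ctr P u) (if horizontal G u c then \<bar>inner_rad P u\<bar> else outer_rad P u)" if "incident G u c" for u c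
    using P that unfolding ring_pattern_def by blast
  have mem: "pt P b \<in> hcircle (ctr P v) \<bar>inner_rad P v\<bar>" "pt P b' \<in> hcircle (ctr P v) (outer_rad P v)"
    "pt P b \<in> hcircle (ctr P v') (outer_rad P v')" "pt P b' \<in> hcircle (ctr P v') \<bar>inner_rad P v'\<bar>"
    using circ[OF f(1)] circ[OF f(2)] circ[OF f(3)] circ[OF f(4)] f h by simp_all
  note L = hcircle_lor[OF white(1)[OF f(5)] mem(1)] hcircle_lor[OF white(1)[OF f(5)] mem(2)]
    hcircle_lor[OF white(1)[OF f(6)] mem(3)] hcircle_lor[OF white(1)[OF f(6)] mem(4)]
  have orth: "lor (hdirection (pt P b') (ctr P v)) (hdirection (pt P b') (ctr P v')) = 0"
  proof -
    have "\<exists>c c'. quad G v c v' c'" using \<tau> by blast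
    then have "orthogonal_hcircles (ctr P v) (outer_rad P v) (ctr P v') \<bar>inner_rad P v'\<bar>"
      using P unfolding ring_pattern_def by blast
    then show ?thesis using mem unfolding orthogonal_hcircles_def by blast
  qed
  have unit: "lor (ctr P v) (ctr P v) = -1" "lor (ctr P v') (ctr P v') = -1"
    using white(1) f by (auto simp: hyperbolic_plane_def)
  have xv: "lor (pt P b') (ctr P v) = - cosh (outer_rad P v)" "lor (pt P b') (ctr P v') = - cosh (inner_rad P v')"
    unfolding lor_commute[of "pt P b'" "ctr P v"] lor_commute[of "pt P b'" "ctr P v'"] using L by simp_all
  have "lor (ctr P v) (ctr P v') = - (cosh (outer_rad P v) * cosh (inner_rad P v'))"
    using orth L xv by (simp add: hdirection_def algebra_simps)
  \<comment> \<open>The assumed right angle is the one at \<open>b'\<close>. Since q cosh R = cosh r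
    for both rings, the products of the legs at \<open>b'\<close> and at \<open>b\<close> agree, so
    there is a right angle at \<open>b\<close> as well.\<close>
  then have pp: "lor (ctr P v) (ctr P v') = - (cosh (inner_rad P v) * cosh (outer_rad P v'))"
    unfolding white(4)[OF f(5)] white(4)[OF f(6)] by simp
  \<comment> \<open>A negative radius reverses the cyclic order of the points; the factor sinh r
    merges both cases into one sign condition.\<close>
  have ccw: "0 < sinh (inner_rad P u) * lor (lcross (ctr P u) (pt P c)) (pt P c')" if "quad G u c u' c'" for u c u' c'
  proof -
    have u: "inner_rad P u \<noteq> 0" using white(3) quad_facts(5)[OF G that] by blast
    have "(inner_rad P u > 0 \<longrightarrow> hccw (ctr P u) (pt P c) (pt P c')) \<and> (inner_rad P u < 0 \<longrightarrow> hccw (ctr P u) (pt P c') (pt P c))"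
      using P that unfolding ring_pattern_def by blast
    moreover have "lor (lcross (ctr P u) (pt P c')) (pt P c) = - lor (lcross (ctr P u) (pt P c)) (pt P c')"
      by (simp add: lor_def algebra_simps)
    ultimately show ?thesis
      using u by (cases "inner_rad P u > 0") (auto simp: hccw_def det_eq_lor_lcross zero_less_mult_iff)
  qed
  have sw: "lor (lcross x z) y = - lor (lcross x y) z" for x y z by (simp add: lor_def algebra_simps)
  have s: "0 < \<tau> * sinh (inner_rad P v) * lor (lcross (ctr P v) (pt P b)) (pt P b')"
    "0 < \<tau> * sinh (inner_rad P v') * lor (lcross (ctr P v') (pt P b')) (pt P b)"
    using \<tau> ccw[of v b v' b'] ccw[of v' b' v b] ccw[of v b' v' b] ccw[of v' b v b']
      quad_swap[OF G, of v b v' b'] quad_swap[OF G, of v b' v' b]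
      sw[of "ctr P v" "pt P b" "pt P b'"] sw[of "ctr P v'" "pt P b" "pt P b'"]
    by auto
  have c2: "(cosh x)\<^sup>2 = 1 + (sinh x)\<^sup>2" for x :: real by (simp add: cosh_square_eq)
  have pos: "0 < sinh (outer_rad P v)" "0 < sinh (outer_rad P v')" "sinh (inner_rad P v) \<noteq> 0" "sinh (inner_rad P v') \<noteq> 0"
    "0 < cosh (outer_rad P v)" "0 < cosh (outer_rad P v')"
    using white(2,3)[OF f(5)] white(2,3)[OF f(6)] by simp_all
  have legs: "lor (ctr P v) (pt P b) = - cosh (inner_rad P v)" "lor (ctr P v') (pt P b) = - cosh (outer_rad P v')"
    "lor (ctr P v) (pt P b') = - cosh (outer_rad P v)" "lor (ctr P v') (pt P b') = - cosh (inner_rad P v')"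
    using L(1,3,5,7) by simp_all
  have \<tau>': "\<tau> = 1 \<or> \<tau> = -1" using \<tau> by blast
  have K: "lor (lcross (ctr P v) (pt P b)) (ctr P v') = \<tau> * (sinh (inner_rad P v) * sinh (outer_rad P v'))"
    "((cosh (inner_rad P v) * cosh (outer_rad P v'))\<^sup>2 - 1) *\<^sub>R ((sinh (inner_rad P v') * sinh (outer_rad P v)) *\<^sub>R pt P b + (sinh (inner_rad P v) * sinh (outer_rad P v')) *\<^sub>R pt P b') =
      (sinh (inner_rad P v') * sinh (outer_rad P v') * (cosh (inner_rad P v) * sinh (outer_rad P v) * sinh (outer_rad P v') + cosh (outer_rad P v) * sinh (inner_rad P v) * sinh (inner_rad P v'))) *\<^sub>R ctr P v +
      (sinh (inner_rad P v) * sinh (outer_rad P v) * (cosh (outer_rad P v') * sinh (inner_rad P v) * sinh (inner_rad P v') + cosh (inner_rad P v') * sinh (outer_rad P v) * sinh (outer_rad P v'))) *\<^sub>R ctr P v'"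
    using kite_orientation(1,3)[OF q white(4)[OF f(5)] white(4)[OF f(6)] c2 c2 c2 c2
        pos \<tau>' unit L(2) L(4) legs pp s] by simp_all
  show "lor (ctr P v) (ctr P v') = - (ring_cosh G P v b * ring_cosh G P v' b)"
    "lor (lcross (ctr P v) (pt P b)) (ctr P v') = \<tau> * (ring_sinh G P v b * ring_sinh G P v' b)"
    using pp K f h by (simp_all add: ring_cosh_def ring_sinh_def)
  show "kite_relation P v b v' b'" unfolding kite_relation_def Let_def by (rule K(2))
qed

lemma ring_pattern_lorentz_pattern:
  assumes G: "s_quad_graph G" and P: "ring_pattern G q P"
  shows "lorentz_pattern G q P"
  unfolding lorentz_pattern_def
proof (intro conjI allI impI ballI)
  show "0 < q" "q \<le> 1" using P by (auto simp: ring_pattern_def)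
  show "lor (ctr P v) (ctr P v) = -1" "outer_rad P v > 0" "inner_rad P v \<noteq> 0" "q * cosh (outer_rad P v) = cosh (inner_rad P v)"
    if "v \<in> white_vertices G" for v
    using P that by (auto simp: ring_pattern_def hyperbolic_plane_def)
  show "lor (pt P b) (pt P b) = -1" "lor (ctr P v) (pt P b) = - ring_cosh G P v b" if "incident G v b" for v b
  proof -
    have "ctr P v \<in> hyperbolic_plane" using P incident_lattice_edge(4)[OF G that] by (auto simp: ring_pattern_def)
    moreover have "pt P b \<in> hcircle (ctr P v) (if horizontal G v b then \<bar>inner_rad P v\<bar> else outer_rad P v)"
      using P that unfolding ring_pattern_def by blast
    ultimately show "lor (pt P b) (pt P b) = -1" "lor (ctr P v) (pt P b) = - ring_cosh G P v b"
      using hcircle_lor by (auto simp: ring_cosh_def split: if_splits)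
  qed
  show "kite_relation P v b v' b'" if "(quad G v b v' b' \<or> quad G v b' v' b) \<and> horizontal G v b" for v b v' b'
    using that ring_pattern_kite(3)[OF G P, of 1 v b v' b'] ring_pattern_kite(3)[OF G P, of "-1" v b v' b'] by blast
  fix v b v' b' assume quad: "quad G v b v' b'"
  have "lor (ctr P v) (ctr P v') = - (ring_cosh G P v b * ring_cosh G P v' b) \<and>
      lor (lcross (ctr P v) (pt P b)) (ctr P v') = ring_sinh G P v b * ring_sinh G P v' b"
  proof (cases "horizontal G v b")
    case True
    then show ?thesis using ring_pattern_kite[OF G P, of 1 v b v' b'] quad by simp
  next
    case False
    then have h: "horizontal G v' b" using quad_facts(14)[OF G quad] by blast
    have "lor (lcross (ctr P v) (pt P b)) (ctr P v') = - lor (lcross (ctr P v') (pt P b)) (ctr P v)"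
      by (simp add: lor_def algebra_simps)
    then show ?thesis
      using ring_pattern_kite[OF G P, of "-1" v' b v b'] quad_swap[OF G quad] h
      by (simp add: lor_commute mult.commute)
  qed
  then show "lor (ctr P v) (ctr P v') = - (ring_cosh G P v b * ring_cosh G P v' b)"
    "lor (lcross (ctr P v) (pt P b)) (ctr P v') = ring_sinh G P v b * ring_sinh G P v' b" by blast+
qed

lemma det_vector_matrix_mult:
  "det (vector [M *v x, M *v y, M *v z] :: real^3^3) = det M * det (vector [x, y, z] :: real^3^3)"
proof -
  have "(vector [M *v x, M *v y, M *v z] :: real^3^3) = vector [x, y, z] ** transpose M"
    by (simp add: vec_eq_iff forall_3 matrix_matrix_mult_def matrix_vector_mult_def transpose_def mult.commute)
  then show ?thesis by (simp add: det_mul det_transpose)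
qed

lemma motion_lor_lcross:
  assumes "hyperbolic_motion M"
  shows "lor (lcross (M *v x) (M *v y)) (M *v z) = lor (lcross x y) z"
  using assms det_vector_matrix_mult[of M x y z] by (simp add: hyperbolic_motion_def det_eq_lor_lcross)

lemma lorentz_pattern_move:
  assumes "lorentz_pattern G q P" and M: "hyperbolic_motion M"
  shows "lorentz_pattern G q (move_pattern M P)"
proof -
  have lor: "lor (M *v x) (M *v y) = lor x y" for x y using M by (simp add: hyperbolic_motion_def)
  have kite: "kite_relation (move_pattern M P) v b v' b'" if "kite_relation P v b v' b'" for v b v' b'
    using arg_cong[OF that[unfolded kite_relation_def Let_def], of "\<lambda>x. M *v x"]
    unfolding kite_relation_def Let_def
    by (simp add: move_pattern_def matrix_vector_right_distrib matrix_vector_mult_scaleR)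
  show ?thesis
    using assms(1) kite unfolding lorentz_pattern_def
    by (simp add: move_pattern_def lor motion_lor_lcross[OF M] ring_cosh_def ring_sinh_def)
qed

section \<open>The dual net and the primal net\<close>

definition radial_dir :: "lattice_graph \<Rightarrow> ring_data \<Rightarrow> lattice_point \<Rightarrow> lattice_point \<Rightarrow> real^3" where
  "radial_dir G P v b = (1 / ring_sinh G P v b) *\<^sub>R (ctr P v - ring_cosh G P v b *\<^sub>R pt P b)"

text \<open>The boost that carries \<open>pt P b\<close> to the centre carries
  \<open>radial_dir\<close> to this vector. It is tangent to the hyperbolic plane at the centre,
  hence parallel to the plane of the face.\<close>

definition face_dir :: "lattice_graph \<Rightarrow> ring_data \<Rightarrow> lattice_point \<Rightarrow> lattice_point \<Rightarrow> real^3" where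
  "face_dir G P w b = (1 / ring_sinh G P w b) *\<^sub>R (ring_cosh G P w b *\<^sub>R ctr P w - pt P b)"

text \<open>The prescribed radius of the vertex sphere, with \<open>dn\<close> and \<open>cn\<close>
  replaced by the hyperbolic tangents that they equal; the geometry then contains no elliptic
  functions.\<close>

definition vertex_rad :: "real \<Rightarrow> ring_data \<Rightarrow> lattice_point \<Rightarrow> real" where
  "vertex_rad q P v = (tanh (outer_rad P v) + q * tanh (inner_rad P v)) / (2 * sqrt q)"

text \<open>The counterpart at c-vertices: the radius of the circle through the points of tangency
  of a face of \<open>s\<close>.\<close>

definition face_rad :: "real \<Rightarrow> ring_data \<Rightarrow> lattice_point \<Rightarrow> real" where
  "face_rad q P w = (q * sinh (outer_rad P w) + sinh (inner_rad P w)) / (2 * sqrt q)"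

definition edge_sign :: "lattice_graph \<Rightarrow> lattice_point \<Rightarrow> real" where
  "edge_sign G b = (if hor G b then 1 else -1)"

definition dual_factor :: "real \<Rightarrow> real" where
  "dual_factor q = (1 + q) / (4 * q)"

text \<open>Signed radii of neighbours differ in sign on vertical edges, so the Christoffel dual
  runs backwards there; this is the origin of \<open>edge_sign\<close>.\<close>

definition dual_net :: "lattice_graph \<Rightarrow> real \<Rightarrow> ring_data \<Rightarrow> (lattice_point \<Rightarrow> real^3) \<Rightarrow> bool" where
  "dual_net G q P F \<longleftrightarrow> (\<forall>v b. incident G v b \<longrightarrow>
     F b - F v = (edge_sign G b * dual_factor q) *\<^sub>R
       (if svert G v then - (1 / vertex_rad q P v) *\<^sub>R radial_dir G P v b else (1 / face_rad q P v) *\<^sub>R face_dir G P v b))"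

lemma edge_sign_square [simp]: "edge_sign G b * edge_sign G b = 1" "edge_sign G b \<noteq> 0" "edge_sign G b * (edge_sign G b * x) = x"
  by (auto simp: edge_sign_def)

text \<open>The assumption \<open>positive\<close> keeps vertex and face radii away from zero. For q
  < 1 every pattern satisfies it; at q = 1, where |r| = R, it says that r is positive.\<close>

locale ring_geometry =
  fixes G :: lattice_graph and q :: real and P :: ring_data
  assumes G: "s_quad_graph G" and P: "lorentz_pattern G q P"
    and positive: "\<And>v. v \<in> white_vertices G \<Longrightarrow> 0 < q * sinh (outer_rad P v) + sinh (inner_rad P v)"
begin

lemma q: "0 < q" "q \<le> 1"
  using P by (auto simp: lorentz_pattern_def)

lemma white:
  assumes "v \<in> white_vertices G"
  shows "lor (ctr P v) (ctr P v) = -1" "0 < sinh (outer_rad P v)" "sinh (inner_rad P v) \<noteq> 0"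
    "cosh (inner_rad P v) = q * cosh (outer_rad P v)" "0 < vertex_rad q P v" "0 < face_rad q P v"
    "vertex_rad q P v = ((sinh (inner_rad P v) + sinh (outer_rad P v)) / cosh (outer_rad P v)) / (2 * sqrt q)"
proof -
  have w: "lor (ctr P v) (ctr P v) = -1 \<and> outer_rad P v > 0 \<and> inner_rad P v \<noteq> 0 \<and>
        q * cosh (outer_rad P v) = cosh (inner_rad P v)"
    using P assms unfolding lorentz_pattern_def by blast
  then show "lor (ctr P v) (ctr P v) = -1" and s: "0 < sinh (outer_rad P v)" and "sinh (inner_rad P v) \<noteq> 0"
    and c: "cosh (inner_rad P v) = q * cosh (outer_rad P v)" by simp_all
  show "0 < face_rad q P v" using positive[OF assms] q by (simp add: face_rad_def)
  show e: "vertex_rad q P v = ((sinh (inner_rad P v) + sinh (outer_rad P v)) / cosh (outer_rad P v)) / (2 * sqrt q)"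
    unfolding vertex_rad_def tanh_def c using q by (simp add: add_divide_distrib)
  have "q * sinh (outer_rad P v) \<le> sinh (outer_rad P v)" using s q by (simp add: mult_left_le_one_le)
  then show "0 < vertex_rad q P v" unfolding e using positive[OF assms] q by (simp add: cosh_real_pos)
qed

lemma incident_white: "incident G v b \<Longrightarrow> v \<in> white_vertices G"
  by (rule incident_lattice_edge(4)[OF G])

lemma ring_cosh_sinh:
  assumes "incident G v b"
  shows "ring_sinh G P v b \<noteq> 0" "(ring_cosh G P v b)\<^sup>2 = 1 + (ring_sinh G P v b)\<^sup>2" "0 < ring_cosh G P v b"
  using white(2,3)[OF incident_white[OF assms]] by (auto simp: ring_cosh_def ring_sinh_def cosh_square_eq cosh_real_pos)

lemma incident_lor:
  assumes "incident G v b"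
  shows "lor (pt P b) (pt P b) = -1" "lor (ctr P v) (pt P b) = - ring_cosh G P v b"
  using P assms unfolding lorentz_pattern_def by blast+

lemma quad_dirs:
  assumes quad: "quad G v b v' b'"
  shows "lor (radial_dir G P v b) (pt P b) = 0" "lor (radial_dir G P v b) (radial_dir G P v b) = 1"
    "radial_dir G P v' b = lcross (radial_dir G P v b) (pt P b)"
    "((ring_cosh G P v b)\<^sup>2 * (ring_sinh G P v' b)\<^sup>2 + (ring_sinh G P v b)\<^sup>2) *\<^sub>R pt P b =
      (ring_cosh G P v b * (ring_sinh G P v' b)\<^sup>2) *\<^sub>R ctr P v + (ring_cosh G P v' b * (ring_sinh G P v b)\<^sup>2) *\<^sub>R ctr P v'
      - (ring_sinh G P v b * ring_sinh G P v' b) *\<^sub>R lcross (ctr P v) (ctr P v')"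
proof -
  have i: "incident G v b" "incident G v' b" using quad_facts[OF G quad] by simp_all
  have d: "lor (ctr P v) (ctr P v') = - (ring_cosh G P v b * ring_cosh G P v' b)"
    "lor (lcross (ctr P v) (pt P b)) (ctr P v') = ring_sinh G P v b * ring_sinh G P v' b"
    using P quad unfolding lorentz_pattern_def by blast+
  note f = right_angle_frame[OF white(1)[OF incident_white[OF i(1)]] white(1)[OF incident_white[OF i(2)]] incident_lor(1)[OF i(1)]
      ring_cosh_sinh(2)[OF i(1)] ring_cosh_sinh(2)[OF i(2)] ring_cosh_sinh(1)[OF i(1)] ring_cosh_sinh(1)[OF i(2)]
      incident_lor(2)[OF i(1)] incident_lor(2)[OF i(2)] d, folded radial_dir_def]
  show "lor (radial_dir G P v b) (pt P b) = 0" "lor (radial_dir G P v b) (radial_dir G P v b) = 1"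
    "radial_dir G P v' b = lcross (radial_dir G P v b) (pt P b)"
    "((ring_cosh G P v b)\<^sup>2 * (ring_sinh G P v' b)\<^sup>2 + (ring_sinh G P v b)\<^sup>2) *\<^sub>R pt P b =
      (ring_cosh G P v b * (ring_sinh G P v' b)\<^sup>2) *\<^sub>R ctr P v + (ring_cosh G P v' b * (ring_sinh G P v b)\<^sup>2) *\<^sub>R ctr P v'
      - (ring_sinh G P v b * ring_sinh G P v' b) *\<^sub>R lcross (ctr P v) (ctr P v')"
    by (rule f)+
qed

lemma radial_dir:
  assumes "incident G v b"
  shows "lor (radial_dir G P v b) (pt P b) = 0" "lor (radial_dir G P v b) (radial_dir G P v b) = 1"
    "ctr P v = ring_cosh G P v b *\<^sub>R pt P b + ring_sinh G P v b *\<^sub>R radial_dir G P v b"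
proof -
  show "ctr P v = ring_cosh G P v b *\<^sub>R pt P b + ring_sinh G P v b *\<^sub>R radial_dir G P v b"
    using ring_cosh_sinh(1)[OF assms] by (simp add: radial_dir_def)
  have "lor (radial_dir G P v b) (pt P b) = 0 \<and> lor (radial_dir G P v b) (radial_dir G P v b) = 1"
    using G assms
  proof (cases rule: incident_quad)
    case (1 v' b')
    then show ?thesis using quad_dirs by blast
  next
    case (2 v' b')
    show ?thesis
      unfolding quad_dirs(3)[OF 2(2)] using quad_dirs(1,2)[OF 2(2)] incident_lor(1)[OF assms]
      by (simp add: lor_lcross_lcross lor_commute[of "pt P b" "radial_dir G P v' b"])
  qed
  then show "lor (radial_dir G P v b) (pt P b) = 0" "lor (radial_dir G P v b) (radial_dir G P v b) = 1" by simp_all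
qed

lemma face_dir_eq:
  assumes "incident G w b"
  shows "face_dir G P w b = ring_sinh G P w b *\<^sub>R pt P b + ring_cosh G P w b *\<^sub>R radial_dir G P w b"
proof -
  define C S where "C = ring_cosh G P w b" and "S = ring_sinh G P w b"
  have CS: "C * C = 1 + S * S" "S \<noteq> 0" using ring_cosh_sinh[OF assms] by (simp_all add: C_def S_def power2_eq_square)
  have "S *\<^sub>R face_dir G P w b = C *\<^sub>R ctr P w - pt P b"
    using CS by (simp add: face_dir_def C_def S_def)
  also have "\<dots> = S *\<^sub>R (S *\<^sub>R pt P b + C *\<^sub>R radial_dir G P w b)"
    by (subst radial_dir(3)[OF assms]) (simp add: C_def[symmetric] S_def[symmetric] scaleR_add_right CS(1) algebra_simps)
  finally show ?thesis using CS unfolding C_def S_def by simp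
qed

lemma fan_incident:
  assumes "fan G b v w v'"
  shows "incident G v b" "incident G w b" "incident G v' b"
  using assms quad_facts[OF G] unfolding fan_def by blast+

text \<open>Two quarter turns reverse the radial direction. The remaining claims are computed in the
  orthonormal frame formed by the point, the radial direction and its quarter turn.\<close>

lemma fan_dirs:
  assumes fan: "fan G b v w v'"
  shows "radial_dir G P v' b = - radial_dir G P v b"
    "lor (ctr P w) (radial_dir G P v b) = 0" "lor (ctr P w) (face_dir G P w b) = 0"
    "lor (face_dir G P w b) (face_dir G P w b) = 1" "lor (face_dir G P w b) (radial_dir G P v b) = 0"
    "lor (lcross (face_dir G P w b) (radial_dir G P v b)) (ctr P w) = 1"
proof -
  obtain c c' where quad: "quad G v b w c" "quad G w b v' c'" using fan unfolding fan_def by blast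
  note i = fan_incident[OF fan]
  define u x z C S where "u = radial_dir G P v b" and "x = pt P b" and "z = radial_dir G P w b"
    and "C = ring_cosh G P w b" and "S = ring_sinh G P w b"
  have u: "lor u u = 1" "lor u x = 0" "lor x x = -1" "lor x u = 0"
    using radial_dir[OF i(1)] incident_lor(1)[OF i(1)] lor_commute[of "pt P b" "radial_dir G P v b"] by (simp_all add: u_def x_def)
  have z: "z = lcross u x" using quad_dirs(3)[OF quad(1)] by (simp add: z_def u_def x_def)
  have zz: "lor z z = 1" "lor z x = 0" "lor x z = 0" "lor z u = 0" "lor u z = 0"
    unfolding z using u by (simp_all add: lor_lcross_lcross)
  have w: "ctr P w = C *\<^sub>R x + S *\<^sub>R z" "face_dir G P w b = S *\<^sub>R x + C *\<^sub>R z"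
    using radial_dir(3)[OF i(2)] face_dir_eq[OF i(2)] by (simp_all add: C_def S_def x_def z_def)
  have CS: "C * C = 1 + S * S" using ring_cosh_sinh[OF i(2)] by (simp add: C_def S_def power2_eq_square)
  have "radial_dir G P v' b = lcross z x"
    using quad_dirs(3)[OF quad(2)] by (simp add: z_def x_def)
  also have "\<dots> = - u" unfolding z lcross_lcross using u by simp
  finally show "radial_dir G P v' b = - radial_dir G P v b" by (simp add: u_def)
  have "lcross x u = - z" unfolding z by (rule lcross_minus)
  moreover have "lcross z u = - x" unfolding z lcross_lcross using u by simp
  ultimately have c: "lcross (S *\<^sub>R x + C *\<^sub>R z) u = - (S *\<^sub>R z) - C *\<^sub>R x" unfolding lcross_simps by simp
  have "lor (lcross (face_dir G P w b) u) (ctr P w) = 1"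
    unfolding w c using u zz CS by (simp add: algebra_simps)
  then show "lor (lcross (face_dir G P w b) (radial_dir G P v b)) (ctr P w) = 1" by (simp add: u_def)
  show "lor (ctr P w) (radial_dir G P v b) = 0" "lor (ctr P w) (face_dir G P w b) = 0"
    "lor (face_dir G P w b) (face_dir G P w b) = 1" "lor (face_dir G P w b) (radial_dir G P v b) = 0"
    unfolding w u_def[symmetric] using u zz CS by (simp_all add: algebra_simps)
qed

text \<open>The kite relation is symmetric under exchanging both rings together with both points, so
  \<open>kite_closure\<close> applies twice. Which result closes the quad depends on which of the
  rings belongs to an s-vertex.\<close>

lemma dual_closure:
  assumes quad: "quad G v b v' b' \<or> quad G v b' v' b" and h: "horizontal G v b"
  shows "(1 / vertex_rad q P v) *\<^sub>R (radial_dir G P v b + radial_dir G P v b') +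
    (1 / face_rad q P v') *\<^sub>R (face_dir G P v' b + face_dir G P v' b') = 0"
    and "(1 / face_rad q P v) *\<^sub>R (face_dir G P v b + face_dir G P v b') +
    (1 / vertex_rad q P v') *\<^sub>R (radial_dir G P v' b + radial_dir G P v' b') = 0"
proof -
  have f: "v \<in> white_vertices G" "v' \<in> white_vertices G"
    "\<not> horizontal G v b'" "\<not> horizontal G v' b" "horizontal G v' b'"
  proof -
    have "v \<in> white_vertices G \<and> v' \<in> white_vertices G \<and> \<not> horizontal G v b' \<and> \<not> horizontal G v' b \<and> horizontal G v' b'"
      using quad
    proof
      assume "quad G v b v' b'"
      from quad_facts[OF G this] h show ?thesis by simp
    next
      assume "quad G v b' v' b"
      from quad_facts[OF G this] h show ?thesis by simp
    qed
    then show "v \<in> white_vertices G" "v' \<in> white_vertices G"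
      "\<not> horizontal G v b'" "\<not> horizontal G v' b" "horizontal G v' b'" by simp_all
  qed
  have K: "kite_relation P v b v' b'" using P quad h unfolding lorentz_pattern_def by blast
  have c2: "(cosh x)\<^sup>2 = 1 + (sinh x)\<^sup>2" for x :: real by (simp add: cosh_square_eq)
  have nz: "cosh (outer_rad P v) \<noteq> 0" "cosh (outer_rad P v') \<noteq> 0" by simp_all
  note w = white[OF f(1)] white[OF f(2)]
  have rad: "vertex_rad q P v * (2 * sqrt q) = (sinh (inner_rad P v) + sinh (outer_rad P v)) / cosh (outer_rad P v)"
    "face_rad q P v * (2 * sqrt q) = q * sinh (outer_rad P v) + sinh (inner_rad P v)" if "v \<in> white_vertices G" for v
    using white(7)[OF that] q by (simp_all add: face_rad_def)
  have *: "(1 / \<delta>) *\<^sub>R X + (1 / \<rho>) *\<^sub>R Y = 0" if "(\<rho> * s) *\<^sub>R X + (\<delta> * s) *\<^sub>R Y = 0" "s \<noteq> 0" "\<rho> \<noteq> 0" "\<delta> \<noteq> 0" for \<rho> \<delta> s :: real and X Y :: "real^3"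
  proof -
    have "(1 / \<delta>) *\<^sub>R X + (1 / \<rho>) *\<^sub>R Y = (1 / (\<rho> * \<delta> * s)) *\<^sub>R ((\<rho> * s) *\<^sub>R X + (\<delta> * s) *\<^sub>R Y)"
      using that(2-) by (simp add: scaleR_add_right)
    then show ?thesis using that(1) by simp
  qed
  have s: "2 * sqrt q \<noteq> 0" using q by simp
  have "(face_rad q P v' * (2 * sqrt q)) *\<^sub>R (radial_dir G P v b + radial_dir G P v b') +
    (vertex_rad q P v * (2 * sqrt q)) *\<^sub>R (face_dir G P v' b + face_dir G P v' b') = 0"
    unfolding rad(2)[OF f(2)] rad(1)[OF f(1)] radial_dir_def face_dir_def ring_sinh_def ring_cosh_def
    using kite_closure[OF w(4) w(11) nz(1) c2 c2 c2 c2 w(3) _ w(10) _ K[unfolded kite_relation_def Let_def]] w f h by simp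
  then show "(1 / vertex_rad q P v) *\<^sub>R (radial_dir G P v b + radial_dir G P v b') +
    (1 / face_rad q P v') *\<^sub>R (face_dir G P v' b + face_dir G P v' b') = 0"
    using * s w(5,6,12,13) by (metis order_less_irrefl)
  have K': "((cosh (inner_rad P v') * cosh (outer_rad P v))\<^sup>2 - 1) *\<^sub>R ((sinh (inner_rad P v) * sinh (outer_rad P v')) *\<^sub>R pt P b' + (sinh (inner_rad P v') * sinh (outer_rad P v)) *\<^sub>R pt P b) =
      (sinh (inner_rad P v) * sinh (outer_rad P v) * (cosh (inner_rad P v') * sinh (outer_rad P v') * sinh (outer_rad P v) + cosh (outer_rad P v') * sinh (inner_rad P v') * sinh (inner_rad P v))) *\<^sub>R ctr P v' +
      (sinh (inner_rad P v') * sinh (outer_rad P v') * (cosh (outer_rad P v) * sinh (inner_rad P v') * sinh (inner_rad P v) + cosh (inner_rad P v) * sinh (outer_rad P v') * sinh (outer_rad P v))) *\<^sub>R ctr P v"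
    using K[unfolded kite_relation_def Let_def] w(4,11) by (simp add: mult_ac add_ac)
  have "(face_rad q P v * (2 * sqrt q)) *\<^sub>R (radial_dir G P v' b' + radial_dir G P v' b) +
    (vertex_rad q P v' * (2 * sqrt q)) *\<^sub>R (face_dir G P v b' + face_dir G P v b) = 0"
    unfolding rad(2)[OF f(1)] rad(1)[OF f(2)] radial_dir_def face_dir_def ring_sinh_def ring_cosh_def
    using kite_closure[OF w(11) w(4) nz(2) c2 c2 c2 c2 w(10) _ w(3) _ K'] w f h by simp
  then have "(1 / vertex_rad q P v') *\<^sub>R (radial_dir G P v' b' + radial_dir G P v' b) +
    (1 / face_rad q P v) *\<^sub>R (face_dir G P v b' + face_dir G P v b) = 0"
    using * s w(5,6,12,13) by (metis order_less_irrefl)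
  then show "(1 / face_rad q P v) *\<^sub>R (face_dir G P v b + face_dir G P v b') +
    (1 / vertex_rad q P v') *\<^sub>R (radial_dir G P v' b + radial_dir G P v' b') = 0"
    by (simp add: add.commute)
qed

end

section \<open>Lifts of spheres to the space of signature (3,2)\<close>

lemma UNIV_5_cases: "(\<forall>i::5. Q i) \<longleftrightarrow> Q 1 \<and> Q 2 \<and> Q 3 \<and> Q 4 \<and> Q 5"
proof -
  have "i = 1 \<or> i = 2 \<or> i = 3 \<or> i = 4 \<or> i = 5" for i :: 5
  proof (induct i)
    case (of_int z)
    then have "z = 0 \<or> z = 1 \<or> z = 2 \<or> z = 3 \<or> z = 4" by simp presburger
    then show ?case by auto
  qed
  then show ?thesis by metis
qed

lemma sphere_lift_nth:
  "sphere_lift (c, d) $ 1 = c$1 / d" "sphere_lift (c, d) $ 2 = c$2 / d"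
  "sphere_lift (c, d) $ 3 = ((lor c c - d\<^sup>2) - 1) / (2 * d)"
  "sphere_lift (c, d) $ 4 = c$3 / d"
  "sphere_lift (c, d) $ 5 = ((lor c c - d\<^sup>2) + 1) / (2 * d)"
  by (simp_all add: sphere_lift_def embed32_def e_zero_def e_inf_def axis_def diff_divide_distrib add_divide_distrib)

lemma inner32_sphere_lift:
  assumes "d \<noteq> 0" "d' \<noteq> 0"
  shows "inner32 (sphere_lift (c, d)) (sphere_lift (c', d')) = (d\<^sup>2 + d'\<^sup>2 - lor (c - c') (c - c')) / (2 * d * d')"
proof -
  have *: "lor (c - c') (c - c') = lor c c + lor c' c' - 2 * (c$1 * c'$1 + c$2 * c'$2 - c$3 * c'$3)"
    by (simp add: lor_def algebra_simps)
  show ?thesis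
    unfolding * using assms by (simp add: inner32_def sphere_lift_nth field_simps power2_eq_square)
qed

text \<open>Coordinates 3 and 5 are half the difference and half the sum of the \<open>e_inf\<close>
  and \<open>e_zero\<close> coefficients, which yield the two scalar equations.\<close>

lemma sphere_lift_relation_iff:
  "sphere_lift (c, d) - sphere_lift (c', d') = a *\<^sub>R (sphere_lift (b, e) - sphere_lift (b', e')) \<longleftrightarrow>
     (1 / d) *\<^sub>R c - (1 / d') *\<^sub>R c' = a *\<^sub>R ((1 / e) *\<^sub>R b - (1 / e') *\<^sub>R b') \<and>
     1 / d - 1 / d' = a * (1 / e - 1 / e') \<and>
     (lor c c - d\<^sup>2) / d - (lor c' c' - d'\<^sup>2) / d' = a * ((lor b b - e\<^sup>2) / e - (lor b' b' - e'\<^sup>2) / e')"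
proof -
  have half: "(x - 1) / (2 * d) = x / d / 2 - 1 / d / 2" "(x + 1) / (2 * d) = x / d / 2 + 1 / d / 2" for x d :: real
    by (simp_all add: diff_divide_distrib add_divide_distrib)
  define X1 X2 where "X1 = (lor c c - d\<^sup>2) / d - (lor c' c' - d'\<^sup>2) / d'" and "X2 = (lor b b - e\<^sup>2) / e - (lor b' b' - e'\<^sup>2) / e'"
  define Y1 Y2 where "Y1 = 1 / d - 1 / d'" and "Y2 = 1 / e - 1 / e'"
  have "(X1 / 2 - Y1 / 2 = a * (X2 / 2 - Y2 / 2) \<and> X1 / 2 + Y1 / 2 = a * (X2 / 2 + Y2 / 2)) \<longleftrightarrow> Y1 = a * Y2 \<and> X1 = a * X2"
    by (auto simp: algebra_simps)
  then show ?thesis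
    unfolding vec_eq_iff[of "sphere_lift (c, d) - sphere_lift (c', d')"] UNIV_5_cases
      vec3_eq_iff[of "(1 / d) *\<^sub>R c - (1 / d') *\<^sub>R c'"]
    by (simp add: sphere_lift_nth half X1_def X2_def Y1_def Y2_def algebra_simps) argo
qed

text \<open>Two closing conditions, for the centres and for their Christoffel dual, and a common orthogonal
  sphere of the four spheres give the relation of the lifts.\<close>

lemma isothermic_face:
  fixes c0 c1 c2 c3 :: "real^3"
  assumes nz: "d0 \<noteq> 0" "d1 \<noteq> 0" "d2 \<noteq> 0" "d3 \<noteq> 0" and ne: "1 / d3 \<noteq> 1 / d1"
    and closed: "(1 / (d0 * d1)) *\<^sub>R (c1 - c0) + (1 / (d1 * d2)) *\<^sub>R (c2 - c1) +
      (1 / (d2 * d3)) *\<^sub>R (c3 - c2) + (1 / (d3 * d0)) *\<^sub>R (c0 - c3) = 0"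
    and orth: "lor (c0 - m) (c0 - m) = r + d0\<^sup>2" "lor (c1 - m) (c1 - m) = r + d1\<^sup>2"
      "lor (c2 - m) (c2 - m) = r + d2\<^sup>2" "lor (c3 - m) (c3 - m) = r + d3\<^sup>2"
  shows "\<exists>a. sphere_lift (c2, d2) - sphere_lift (c0, d0) = a *\<^sub>R (sphere_lift (c3, d3) - sphere_lift (c1, d1))"
proof -
  define e0 e1 e2 e3 where e: "e0 = 1 / d0" "e1 = 1 / d1" "e2 = 1 / d2" "e3 = 1 / d3"
  define a where "a = (e2 - e0) / (e3 - e1)"
  have ne': "e3 - e1 \<noteq> 0" using ne by (simp add: e)
  have "(e0 * e1) *\<^sub>R (c1 - c0) + (e1 * e2) *\<^sub>R (c2 - c1) + (e2 * e3) *\<^sub>R (c3 - c2) + (e3 * e0) *\<^sub>R (c0 - c3) = 0"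
    using closed by (simp add: e)
  then have "(e3 - e1) *\<^sub>R (e2 *\<^sub>R c2 - e0 *\<^sub>R c0) = (e2 - e0) *\<^sub>R (e3 *\<^sub>R c3 - e1 *\<^sub>R c1)"
    by (simp add: vec3_eq_iff algebra_simps)
  then have "(1 / (e3 - e1)) *\<^sub>R ((e3 - e1) *\<^sub>R (e2 *\<^sub>R c2 - e0 *\<^sub>R c0)) = (1 / (e3 - e1)) *\<^sub>R ((e2 - e0) *\<^sub>R (e3 *\<^sub>R c3 - e1 *\<^sub>R c1))"
    by simp
  then have V: "e2 *\<^sub>R c2 - e0 *\<^sub>R c0 = a *\<^sub>R (e3 *\<^sub>R c3 - e1 *\<^sub>R c1)"
    using ne' by (simp add: a_def)
  have W: "e2 - e0 = a * (e3 - e1)" using ne' by (simp add: a_def)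
  have quad: "(lor c c - d\<^sup>2) / d = (r - lor m m) * (1 / d) + 2 * lor ((1 / d) *\<^sub>R c) m"
    if "lor (c - m) (c - m) = r + d\<^sup>2" "d \<noteq> 0" for c d
  proof -
    have "lor c c - d\<^sup>2 = r - lor m m + 2 * lor c m" using that(1) by (simp add: lor_commute[of m c] algebra_simps)
    then show ?thesis using that(2) by (simp add: add_divide_distrib)
  qed
  have "(lor c2 c2 - d2\<^sup>2) / d2 - (lor c0 c0 - d0\<^sup>2) / d0 =
      (r - lor m m) * (e2 - e0) + 2 * lor (e2 *\<^sub>R c2 - e0 *\<^sub>R c0) m"
    unfolding quad[OF orth(3) nz(3)] quad[OF orth(1) nz(1)] e by (simp add: algebra_simps)
  also have "\<dots> = a * ((r - lor m m) * (e3 - e1) + 2 * lor (e3 *\<^sub>R c3 - e1 *\<^sub>R c1) m)"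
    unfolding V W by (simp add: algebra_simps)
  also have "(r - lor m m) * (e3 - e1) + 2 * lor (e3 *\<^sub>R c3 - e1 *\<^sub>R c1) m =
      (lor c3 c3 - d3\<^sup>2) / d3 - (lor c1 c1 - d1\<^sup>2) / d1"
    unfolding quad[OF orth(4) nz(4)] quad[OF orth(2) nz(2)] e by (simp add: algebra_simps)
  finally show ?thesis
    unfolding sphere_lift_relation_iff using V W by (auto simp: e)
qed

section \<open>Nets integrated from a pattern\<close>

context ring_geometry
begin

lemma dual_net_exists: "\<exists>F. dual_net G q P F"
proof -
  define X where "X v b = (if svert G v then - (1 / vertex_rad q P v) *\<^sub>R radial_dir G P v b else (1 / face_rad q P v) *\<^sub>R face_dir G P v b)" for v b
  have closed: "(edge_sign G b * dual_factor q) *\<^sub>R X v b - (edge_sign G b * dual_factor q) *\<^sub>R X v' b +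
      (edge_sign G b' * dual_factor q) *\<^sub>R X v' b' - (edge_sign G b' * dual_factor q) *\<^sub>R X v b' = 0"
    if quad: "quad G v b v' b'" for v b v' b'
  proof -
    note f = quad_facts[OF G quad]
    have c: "(1 / vertex_rad q P v) *\<^sub>R (radial_dir G P v b + radial_dir G P v b') +
          (1 / face_rad q P v') *\<^sub>R (face_dir G P v' b + face_dir G P v' b') = 0"
        "(1 / face_rad q P v) *\<^sub>R (face_dir G P v b + face_dir G P v b') +
          (1 / vertex_rad q P v') *\<^sub>R (radial_dir G P v' b + radial_dir G P v' b') = 0"
    proof -
      have "horizontal G v b \<or> horizontal G v b'" using f(13) by blast
      then show "(1 / vertex_rad q P v) *\<^sub>R (radial_dir G P v b + radial_dir G P v b') +
          (1 / face_rad q P v') *\<^sub>R (face_dir G P v' b + face_dir G P v' b') = 0"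
        "(1 / face_rad q P v) *\<^sub>R (face_dir G P v b + face_dir G P v b') +
          (1 / vertex_rad q P v') *\<^sub>R (radial_dir G P v' b + radial_dir G P v' b') = 0"
        using dual_closure[of v b v' b'] dual_closure[of v b' v' b] quad by (auto simp: add.commute)
    qed
    have zero: "X v b + X v b' - (X v' b + X v' b') = 0"
    proof (cases "svert G v")
      case True
      then have "X v b + X v b' - (X v' b + X v' b') = - ((1 / vertex_rad q P v) *\<^sub>R (radial_dir G P v b + radial_dir G P v b') +
          (1 / face_rad q P v') *\<^sub>R (face_dir G P v' b + face_dir G P v' b'))"
        using f(11) by (simp add: X_def scaleR_add_right)
      then show ?thesis unfolding c by simp
    next
      case False
      then have "X v b + X v b' - (X v' b + X v' b') = (1 / face_rad q P v) *\<^sub>R (face_dir G P v b + face_dir G P v b') +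
          (1 / vertex_rad q P v') *\<^sub>R (radial_dir G P v' b + radial_dir G P v' b')"
        using f(11) by (simp add: X_def scaleR_add_right)
      then show ?thesis unfolding c by simp
    qed
    \<comment> \<open>Opposite signs at the two black vertices turn the alternating sum of the form
      into the symmetric sum of \<open>dual_closure\<close>.\<close>
    have es: "edge_sign G b' = - edge_sign G b" using f(12) by (simp add: edge_sign_def)
    have "(edge_sign G b * dual_factor q) *\<^sub>R X v b - (edge_sign G b * dual_factor q) *\<^sub>R X v' b +
      (edge_sign G b' * dual_factor q) *\<^sub>R X v' b' - (edge_sign G b' * dual_factor q) *\<^sub>R X v b' =
      (edge_sign G b * dual_factor q) *\<^sub>R (X v b + X v b' - (X v' b + X v' b'))"
      unfolding es by (simp add: algebra_simps)
    then show ?thesis unfolding zero by simp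
  qed
  from bipartite_poincare[OF G, of "\<lambda>v b. (edge_sign G b * dual_factor q) *\<^sub>R X v b", OF closed]
  obtain F where "\<And>v b. incident G v b \<Longrightarrow> F b - F v = (edge_sign G b * dual_factor q) *\<^sub>R X v b"
    by blast
  then show ?thesis unfolding dual_net_def X_def by blast
qed

lemma dual_radii:
  assumes "v \<in> white_vertices G"
  shows "(1 - q) * dual_factor q / vertex_rad q P v = (tanh (outer_rad P v) - q * tanh (inner_rad P v)) / (2 * sqrt q)"
    and "(1 - q) * dual_factor q / face_rad q P v = (q * sinh (outer_rad P v) - sinh (inner_rad P v)) / (2 * sqrt q)"
proof -
  note w = white[OF assms]
  have sq: "sqrt q * sqrt q = q" using q by simp
  have f: "(1 - q) * dual_factor q = (1 - q\<^sup>2) / (4 * q)"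
    using q by (simp add: dual_factor_def field_simps power2_eq_square)
  have c: "(cosh (inner_rad P v))\<^sup>2 = 1 + (sinh (inner_rad P v))\<^sup>2" "(cosh (outer_rad P v))\<^sup>2 = 1 + (sinh (outer_rad P v))\<^sup>2"
    by (simp_all add: cosh_square_eq)
  have s: "q\<^sup>2 * (sinh (outer_rad P v))\<^sup>2 - (sinh (inner_rad P v))\<^sup>2 = 1 - q\<^sup>2"
    using c unfolding w(4) power_mult_distrib by (simp add: algebra_simps)
  have C: "cosh (outer_rad P v) \<noteq> 0" by simp
  have t: "tanh (outer_rad P v) * tanh (outer_rad P v) - (q * tanh (inner_rad P v)) * (q * tanh (inner_rad P v)) = 1 - q\<^sup>2"
  proof -
    have "tanh (outer_rad P v) * tanh (outer_rad P v) - (q * tanh (inner_rad P v)) * (q * tanh (inner_rad P v)) =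
      ((sinh (outer_rad P v))\<^sup>2 - (sinh (inner_rad P v))\<^sup>2) / (cosh (outer_rad P v))\<^sup>2"
      unfolding tanh_def w(4) using q by (simp add: power2_eq_square diff_divide_distrib)
    also have "(sinh (outer_rad P v))\<^sup>2 - (sinh (inner_rad P v))\<^sup>2 = (1 - q\<^sup>2) * (cosh (outer_rad P v))\<^sup>2"
      using s c by (simp add: algebra_simps)
    finally show ?thesis using C by simp
  qed
  have "vertex_rad q P v * ((tanh (outer_rad P v) - q * tanh (inner_rad P v)) / (2 * sqrt q)) = (1 - q\<^sup>2) / (4 * q)"
    unfolding vertex_rad_def t[symmetric] using sq q by (simp add: field_simps)
  then show "(1 - q) * dual_factor q / vertex_rad q P v = (tanh (outer_rad P v) - q * tanh (inner_rad P v)) / (2 * sqrt q)"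
    unfolding f using w(5) by (simp add: divide_eq_eq mult.commute)
  have "face_rad q P v * ((q * sinh (outer_rad P v) - sinh (inner_rad P v)) / (2 * sqrt q)) = (1 - q\<^sup>2) / (4 * q)"
    unfolding face_rad_def s[symmetric] using sq q by (simp add: field_simps power2_eq_square)
  then show "(1 - q) * dual_factor q / face_rad q P v = (q * sinh (outer_rad P v) - sinh (inner_rad P v)) / (2 * sqrt q)"
    unfolding f using w(6) by (simp add: divide_eq_eq mult.commute)
qed

text \<open>The common shape of the primal and the dual net: at black vertices \<open>X\<close> is
  the touching point of two vertex spheres of radii \<open>g\<close>, at c-vertices the centre of
  the circle through the touching points of a face. \<open>h\<close> is signed and is negative for
  the primal net.\<close>

definition net_eqs :: "(lattice_point \<Rightarrow> real^3) \<Rightarrow> (lattice_point \<Rightarrow> real) \<Rightarrow> (lattice_point \<Rightarrow> real) \<Rightarrow> (lattice_point \<Rightarrow> real) \<Rightarrow> bool" where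
  "net_eqs X \<sigma> g h \<longleftrightarrow>
     (\<forall>b. \<sigma> b = 1 \<or> \<sigma> b = -1) \<and> (\<forall>v \<in> white_vertices G. 0 < g v) \<and>
     (\<forall>v b. incident G v b \<longrightarrow>
       (svert G v \<longrightarrow> X v - X b = (\<sigma> b * g v) *\<^sub>R radial_dir G P v b) \<and>
       (\<not> svert G v \<longrightarrow> X b - X v = (\<sigma> b * h v) *\<^sub>R face_dir G P v b))"

lemma dual_factor_pos: "0 < dual_factor q"
  using q by (simp add: dual_factor_def)

lemma dual_net_eqs:
  assumes "dual_net G q P F"
  shows "net_eqs F (edge_sign G) (\<lambda>v. dual_factor q / vertex_rad q P v) (\<lambda>v. dual_factor q / face_rad q P v)"
  unfolding net_eqs_def
proof (intro conjI allI ballI impI)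
  show "edge_sign G b = 1 \<or> edge_sign G b = -1" for b by (simp add: edge_sign_def)
  show "0 < dual_factor q / vertex_rad q P v" if "v \<in> white_vertices G" for v
    using dual_factor_pos white(5)[OF that] by simp
  fix v b assume i: "incident G v b"
  from assms i have e: "F b - F v = (edge_sign G b * dual_factor q) *\<^sub>R
       (if svert G v then - (1 / vertex_rad q P v) *\<^sub>R radial_dir G P v b else (1 / face_rad q P v) *\<^sub>R face_dir G P v b)"
    unfolding dual_net_def by blast
  show "F v - F b = (edge_sign G b * (dual_factor q / vertex_rad q P v)) *\<^sub>R radial_dir G P v b" if "svert G v"
  proof -
    have "F v - F b = - (F b - F v)" by simp
    then show ?thesis unfolding e using that by simp
  qed
  show "F b - F v = (edge_sign G b * (dual_factor q / face_rad q P v)) *\<^sub>R face_dir G P v b" if "\<not> svert G v"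
    unfolding e using that by simp
qed

text \<open>At s-vertices the explicit term is the prescribed Gauss map. The terms at c-vertices and
  black vertices are those for which \<open>net_eqs\<close> holds with all edge signs 1; at q = 1 a
  black vertex goes to its point of the pattern, which lies on the unit sphere.\<close>

definition primal_net :: "(lattice_point \<Rightarrow> real^3) \<Rightarrow> lattice_point \<Rightarrow> real^3" where
  "primal_net F x = (1 - q) *\<^sub>R F x +
     (if white G x then (if svert G x then sqrt q / cosh (inner_rad P x) else sqrt q * cosh (outer_rad P x)) *\<^sub>R ctr P x
      else (if hor G x then sqrt q else 1 / sqrt q) *\<^sub>R pt P x)"

text \<open>On a horizontal edge the dual part contributes the dual radius and the explicit part q
  tanh r / sqrt q, on a vertical edge minus the dual radius and tanh R / sqrt q. Both sums are
  \<open>vertex_rad\<close>; at c-vertices the same happens with \<open>face_rad\<close>.\<close>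

lemma primal_net_eqs:
  assumes "dual_net G q P F"
  shows "net_eqs (primal_net F) (\<lambda>_. 1) (vertex_rad q P) (\<lambda>w. - face_rad q P w)"
  unfolding net_eqs_def
proof (intro conjI allI ballI impI)
  show "0 < vertex_rad q P v" if "v \<in> white_vertices G" for v using white(5)[OF that] .
  fix v b assume i: "incident G v b"
  note wh = incident_lattice_edge(2,3)[OF G i] and w = white[OF incident_white[OF i]] and D = dual_radii[OF incident_white[OF i]]
  have sq: "sqrt q * sqrt q = q" "sqrt q \<noteq> 0" "q \<noteq> 0" "q / sqrt q = sqrt q" using q by (simp_all add: real_div_sqrt)
  note E = dual_net_eqs[OF assms, unfolded net_eqs_def]
  note R = radial_dir(3)[OF i] and cs = ring_cosh_sinh[OF i]
  show "primal_net F v - primal_net F b = (1 * vertex_rad q P v) *\<^sub>R radial_dir G P v b" if s: "svert G v"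
  proof -
    have "F v - F b = (edge_sign G b * (dual_factor q / vertex_rad q P v)) *\<^sub>R radial_dir G P v b"
      using E i s by blast
    then have F: "(1 - q) *\<^sub>R F v - (1 - q) *\<^sub>R F b = (edge_sign G b * ((1 - q) * dual_factor q / vertex_rad q P v)) *\<^sub>R radial_dir G P v b"
      by (simp add: scaleR_diff_right[symmetric])
    have hv: "horizontal G v b \<longleftrightarrow> hor G b" using s by (simp add: horizontal_def)
    define u x where "u = radial_dir G P v b" and "x = pt P b"
    have K: "(sqrt q / cosh (inner_rad P v)) *\<^sub>R ctr P v - (if hor G b then sqrt q else 1 / sqrt q) *\<^sub>R x =
        ((if hor G b then q * tanh (inner_rad P v) else tanh (outer_rad P v)) / sqrt q) *\<^sub>R u"
    proof (cases "hor G b")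
      case True
      then have c: "ctr P v = cosh (inner_rad P v) *\<^sub>R x + sinh (inner_rad P v) *\<^sub>R u"
        using R hv by (simp add: ring_cosh_def ring_sinh_def u_def x_def)
      have "(sqrt q / cosh (inner_rad P v)) *\<^sub>R ctr P v - sqrt q *\<^sub>R x = (sqrt q * tanh (inner_rad P v)) *\<^sub>R u"
        unfolding c by (simp add: scaleR_add_right tanh_def)
      then show ?thesis using True sq(4) by (simp add: times_divide_eq_left[symmetric] del: times_divide_eq_left)
    next
      case False
      then have c: "ctr P v = cosh (outer_rad P v) *\<^sub>R x + sinh (outer_rad P v) *\<^sub>R u"
        using R hv by (simp add: ring_cosh_def ring_sinh_def u_def x_def)
      have k: "sqrt q / cosh (inner_rad P v) = 1 / (sqrt q * cosh (outer_rad P v))"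
        unfolding w(4) using sq(1,2,3) by (simp add: field_simps)
      have "(sqrt q / cosh (inner_rad P v)) *\<^sub>R ctr P v - (1 / sqrt q) *\<^sub>R x = (tanh (outer_rad P v) / sqrt q) *\<^sub>R u"
        unfolding k c using sq by (simp add: scaleR_add_right tanh_def)
      then show ?thesis using False by simp
    qed
    have "primal_net F v - primal_net F b = ((1 - q) *\<^sub>R F v - (1 - q) *\<^sub>R F b) +
        ((sqrt q / cosh (inner_rad P v)) *\<^sub>R ctr P v - (if hor G b then sqrt q else 1 / sqrt q) *\<^sub>R x)"
      using wh s by (simp add: primal_net_def x_def)
    also have "\<dots> = (edge_sign G b * ((tanh (outer_rad P v) - q * tanh (inner_rad P v)) / (2 * sqrt q)) +
        (if hor G b then q * tanh (inner_rad P v) else tanh (outer_rad P v)) / sqrt q) *\<^sub>R u"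
      unfolding F K D u_def by (simp add: scaleR_add_left)
    also have "edge_sign G b * ((tanh (outer_rad P v) - q * tanh (inner_rad P v)) / (2 * sqrt q)) +
        (if hor G b then q * tanh (inner_rad P v) else tanh (outer_rad P v)) / sqrt q = vertex_rad q P v"
      using sq by (simp add: vertex_rad_def edge_sign_def field_simps)
    finally show ?thesis by (simp add: u_def)
  qed
  show "primal_net F b - primal_net F v = (1 * - face_rad q P v) *\<^sub>R face_dir G P v b" if s: "\<not> svert G v"
  proof -
    have "F b - F v = (edge_sign G b * (dual_factor q / face_rad q P v)) *\<^sub>R face_dir G P v b"
      using E i s by blast
    then have F: "(1 - q) *\<^sub>R F b - (1 - q) *\<^sub>R F v = (edge_sign G b * ((1 - q) * dual_factor q / face_rad q P v)) *\<^sub>R face_dir G P v b"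
      by (simp add: scaleR_diff_right[symmetric])
    have hv: "horizontal G v b \<longleftrightarrow> \<not> hor G b" using s by (simp add: horizontal_def)
    define n x where "n = face_dir G P v b" and "x = pt P b"
    have nx: "x = ring_cosh G P v b *\<^sub>R ctr P v - ring_sinh G P v b *\<^sub>R n"
      using cs(1) by (simp add: n_def x_def face_dir_def)
    have K: "(if hor G b then sqrt q else 1 / sqrt q) *\<^sub>R x - (sqrt q * cosh (outer_rad P v)) *\<^sub>R ctr P v =
        (- (if hor G b then q * sinh (outer_rad P v) else sinh (inner_rad P v)) / sqrt q) *\<^sub>R n"
    proof (cases "hor G b")
      case True
      then have c: "x = cosh (outer_rad P v) *\<^sub>R ctr P v - sinh (outer_rad P v) *\<^sub>R n"
        using nx hv by (simp add: ring_cosh_def ring_sinh_def)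
      have "sqrt q *\<^sub>R x - (sqrt q * cosh (outer_rad P v)) *\<^sub>R ctr P v = (- (sqrt q * sinh (outer_rad P v))) *\<^sub>R n"
        unfolding c by (simp add: scaleR_diff_right)
      then show ?thesis using True sq(4) by (simp add: times_divide_eq_left[symmetric] del: times_divide_eq_left)
    next
      case False
      then have c: "x = cosh (inner_rad P v) *\<^sub>R ctr P v - sinh (inner_rad P v) *\<^sub>R n"
        using nx hv by (simp add: ring_cosh_def ring_sinh_def)
      have k: "cosh (inner_rad P v) / sqrt q = sqrt q * cosh (outer_rad P v)"
        unfolding w(4) using sq(4) by (metis times_divide_eq_left)
      have "(1 / sqrt q) *\<^sub>R x - (sqrt q * cosh (outer_rad P v)) *\<^sub>R ctr P v = (- sinh (inner_rad P v) / sqrt q) *\<^sub>R n"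
        unfolding k[symmetric] c by (simp add: scaleR_diff_right)
      then show ?thesis using False by simp
    qed
    have "primal_net F b - primal_net F v = ((1 - q) *\<^sub>R F b - (1 - q) *\<^sub>R F v) +
        ((if hor G b then sqrt q else 1 / sqrt q) *\<^sub>R x - (sqrt q * cosh (outer_rad P v)) *\<^sub>R ctr P v)"
      using wh s by (simp add: primal_net_def x_def)
    also have "\<dots> = (edge_sign G b * ((q * sinh (outer_rad P v) - sinh (inner_rad P v)) / (2 * sqrt q)) +
        (- (if hor G b then q * sinh (outer_rad P v) else sinh (inner_rad P v)) / sqrt q)) *\<^sub>R n"
      unfolding F K D n_def by (simp only: scaleR_add_left)
    also have "edge_sign G b * ((q * sinh (outer_rad P v) - sinh (inner_rad P v)) / (2 * sqrt q)) +
        (- (if hor G b then q * sinh (outer_rad P v) else sinh (inner_rad P v)) / sqrt q) = - face_rad q P v"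
      using sq by (simp add: face_rad_def edge_sign_def field_simps)
    finally show ?thesis by (simp add: n_def)
  qed
qed simp

end

section \<open>Isothermic surfaces, S1-cmc pairs and Koebe nets\<close>

lemma scale_map_apply: "scale_map \<mu> s v = (\<mu> *\<^sub>R fst (s v), \<mu> * snd (s v))"
  by (simp add: scale_map_def)

lemma scale_map_scale_map: "scale_map \<mu> (scale_map \<nu> s) = scale_map (\<mu> * \<nu>) s"
  by (simp add: scale_map_def fun_eq_iff)

lemma scale_map_1: "scale_map 1 s = s"
  by (simp add: scale_map_def fun_eq_iff)

text \<open>Scaling multiplies the three groups of components of a lift by 1, 1/\<mu> and \<mu>. The
  lift is not homogeneous, but each group keeps the relation with the same \<open>a\<close>.\<close>

lemma scale_pair_relation:
  assumes "\<mu> \<noteq> 0"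
    and "sphere_lift S - sphere_lift S' = a *\<^sub>R (sphere_lift T - sphere_lift T')"
  shows "sphere_lift (\<mu> *\<^sub>R fst S, \<mu> * snd S) - sphere_lift (\<mu> *\<^sub>R fst S', \<mu> * snd S') =
     a *\<^sub>R (sphere_lift (\<mu> *\<^sub>R fst T, \<mu> * snd T) - sphere_lift (\<mu> *\<^sub>R fst T', \<mu> * snd T'))"
proof -
  obtain c d c' d' b e b' e' where S: "S = (c, d)" "S' = (c', d')" "T = (b, e)" "T' = (b', e')"
    by (cases S, cases S', cases T, cases T')
  have i: "(1 / (\<mu> * r)) *\<^sub>R (\<mu> *\<^sub>R c) = (1 / r) *\<^sub>R c" for r and c :: "real^3" using assms(1) by simp
  have ii: "1 / (\<mu> * r) = (1 / \<mu>) * (1 / r)" for r by simp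
  have iii: "(lor (\<mu> *\<^sub>R c) (\<mu> *\<^sub>R c) - (\<mu> * r)\<^sup>2) / (\<mu> * r) = \<mu> * ((lor c c - r\<^sup>2) / r)" for c r
  proof -
    have "lor (\<mu> *\<^sub>R c) (\<mu> *\<^sub>R c) - (\<mu> * r)\<^sup>2 = \<mu> * (\<mu> * (lor c c - r\<^sup>2))"
      by (simp add: power2_eq_square algebra_simps)
    then show ?thesis using assms(1) by simp
  qed
  have m: "m * x - m * y = a * (m * z - m * t)" if "x - y = a * (z - t)" for m x y z t :: real
    using arg_cong[OF that, of "(*) m"] by (simp add: algebra_simps)
  from assms(2) show ?thesis
    unfolding S fst_conv snd_conv sphere_lift_relation_iff i unfolding ii iii using m by blast
qed

lemma tangent_plane_eq:
  assumes "x - c = k *\<^sub>R u" "k \<noteq> 0"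
  shows "tangent_plane (c, d) x = {y. lor (y - x) u = 0}"
  unfolding tangent_plane_def fst_conv assms(1) using assms(2) by simp

text \<open>With inverse signed radii \<open>e0\<close>, ..., \<open>e3\<close>, the closing of the
  dual quadrilateral relates the diagonals linearly (\<open>U\<close>). Each dual diagonal becomes
  parallel to the other diagonal of the primal face, the classical reason for a vanishing mixed
  area.\<close>

lemma dual_diagonals:
  fixes c0 c1 c2 c3 f0 f1 f2 f3 :: "real^3"
  assumes ne: "e3 \<noteq> e1" "e2 \<noteq> e0"
    and dual: "f1 - f0 = (k * (e0 * e1)) *\<^sub>R (c1 - c0)" "f2 - f1 = (k * (e1 * e2)) *\<^sub>R (c2 - c1)"
      "f3 - f2 = (k * (e2 * e3)) *\<^sub>R (c3 - c2)" "f0 - f3 = (k * (e3 * e0)) *\<^sub>R (c0 - c3)" and k: "k \<noteq> 0"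
  shows "\<exists>s. f2 - f0 = s *\<^sub>R (c3 - c1)" "\<exists>s. f3 - f1 = s *\<^sub>R (c2 - c0)"
proof -
  define V where "V = e3 *\<^sub>R c3 - e1 *\<^sub>R c1"
  have "(f1 - f0) + (f2 - f1) + (f3 - f2) + (f0 - f3) = 0" by simp
  then have "k *\<^sub>R ((e0 * e1) *\<^sub>R (c1 - c0) + (e1 * e2) *\<^sub>R (c2 - c1) + (e2 * e3) *\<^sub>R (c3 - c2) + (e3 * e0) *\<^sub>R (c0 - c3)) = 0"
    unfolding dual by (simp add: scaleR_add_right)
  then have z: "(e0 * e1) *\<^sub>R (c1 - c0) + (e1 * e2) *\<^sub>R (c2 - c1) + (e2 * e3) *\<^sub>R (c3 - c2) + (e3 * e0) *\<^sub>R (c0 - c3) = 0"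
    using k by simp
  have U: "(e3 - e1) *\<^sub>R (e2 *\<^sub>R c2 - e0 *\<^sub>R c0) = (e2 - e0) *\<^sub>R V"
  proof -
    have "(e3 - e1) *\<^sub>R (e2 *\<^sub>R c2 - e0 *\<^sub>R c0) - (e2 - e0) *\<^sub>R V =
      - ((e0 * e1) *\<^sub>R (c1 - c0) + (e1 * e2) *\<^sub>R (c2 - c1) + (e2 * e3) *\<^sub>R (c3 - c2) + (e3 * e0) *\<^sub>R (c0 - c3))"
      unfolding V_def by (simp add: vec3_eq_iff algebra_simps)
    then show ?thesis unfolding z by simp
  qed
  have "f2 - f0 = (f1 - f0) + (f2 - f1)" by simp
  also have "\<dots> = (k * e1) *\<^sub>R (e2 *\<^sub>R c2 - e0 *\<^sub>R c0 - (e2 - e0) *\<^sub>R c1)"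
    unfolding dual by (simp add: vec3_eq_iff algebra_simps)
  finally have "(e3 - e1) *\<^sub>R (f2 - f0) = (e3 - e1) *\<^sub>R ((k * e1) *\<^sub>R (e2 *\<^sub>R c2 - e0 *\<^sub>R c0 - (e2 - e0) *\<^sub>R c1))"
    by (rule arg_cong)
  also have "\<dots> = (k * e1) *\<^sub>R ((e3 - e1) *\<^sub>R (e2 *\<^sub>R c2 - e0 *\<^sub>R c0) - ((e3 - e1) * (e2 - e0)) *\<^sub>R c1)"
    by (simp add: vec3_eq_iff algebra_simps)
  also have "\<dots> = (k * e1 * (e2 - e0) * e3) *\<^sub>R (c3 - c1)"
    unfolding U V_def by (simp add: vec3_eq_iff algebra_simps)
  finally have "(1 / (e3 - e1)) *\<^sub>R ((e3 - e1) *\<^sub>R (f2 - f0)) = (1 / (e3 - e1)) *\<^sub>R ((k * e1 * (e2 - e0) * e3) *\<^sub>R (c3 - c1))"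
    by (rule arg_cong)
  then have "f2 - f0 = (k * e1 * (e2 - e0) * e3 / (e3 - e1)) *\<^sub>R (c3 - c1)" using ne(1) by simp
  then show "\<exists>s. f2 - f0 = s *\<^sub>R (c3 - c1)" by blast
  have "f3 - f1 = (f2 - f1) + (f3 - f2)" by simp
  also have "\<dots> = (k * e2) *\<^sub>R (V - (e3 - e1) *\<^sub>R c2)"
    unfolding dual V_def by (simp add: vec3_eq_iff algebra_simps)
  finally have "(e2 - e0) *\<^sub>R (f3 - f1) = (e2 - e0) *\<^sub>R ((k * e2) *\<^sub>R (V - (e3 - e1) *\<^sub>R c2))"
    by (rule arg_cong)
  also have "\<dots> = (k * e2) *\<^sub>R ((e2 - e0) *\<^sub>R V - ((e2 - e0) * (e3 - e1)) *\<^sub>R c2)"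
    by (simp add: vec3_eq_iff algebra_simps)
  also have "\<dots> = (k * e2 * (e3 - e1) * e0) *\<^sub>R (c2 - c0)"
    unfolding U[symmetric] by (simp add: vec3_eq_iff algebra_simps)
  finally have "(1 / (e2 - e0)) *\<^sub>R ((e2 - e0) *\<^sub>R (f3 - f1)) = (1 / (e2 - e0)) *\<^sub>R ((k * e2 * (e3 - e1) * e0) *\<^sub>R (c2 - c0))"
    by (rule arg_cong)
  then have "f3 - f1 = (k * e2 * (e3 - e1) * e0 / (e2 - e0)) *\<^sub>R (c2 - c0)" using ne(2) by simp
  then show "\<exists>s. f3 - f1 = s *\<^sub>R (c2 - c0)" by blast
qed

text \<open>The radii force the factor \<open>d' / d\<close>, Christoffel duality gives the vector
  part, and the quadratic part reduces to \<open>normal\<close>, a condition on the component of the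
  Gauss map along the edge. The dual radii enter with reversed orientation.\<close>

lemma cmc_lift_relation:
  fixes c c' e e' :: "real^3"
  assumes nz: "d \<noteq> 0" "d' \<noteq> 0" "k \<noteq> 0"
    and dual: "e' - e = (k / (d * d')) *\<^sub>R (c' - c)"
    and normal: "lor (c' - c) ((c - e) + (c' - e')) = (d'\<^sup>2 - d\<^sup>2) * (1 + k / (d * d'))"
  shows "sphere_lift (e', - (k / d')) - sphere_lift (c, d) = (d' / d) *\<^sub>R (sphere_lift (e, - (k / d)) - sphere_lift (c', d'))"
  unfolding sphere_lift_relation_iff
proof (intro conjI)
  define t where "t = k / (d * d')"
  define D where "D = c' - c"
  have k: "k = t * d * d'" and t: "t \<noteq> 0" using nz by (simp_all add: t_def)
  have c': "c' = c + D" and e': "e' = e + t *\<^sub>R D" using dual by (simp_all add: D_def t_def algebra_simps)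
  have kd: "k / d' = t * d" "k / d = t * d'" using nz by (simp_all add: k)
  show "1 / - (k / d') - 1 / d = d' / d * (1 / - (k / d) - 1 / d')"
    unfolding kd using nz t by (simp add: field_simps)
  show "(1 / - (k / d')) *\<^sub>R e' - (1 / d) *\<^sub>R c = (d' / d) *\<^sub>R ((1 / - (k / d)) *\<^sub>R e - (1 / d') *\<^sub>R c')"
    unfolding kd c' e' using nz t by (simp add: vec3_eq_iff field_simps)
  have n: "2 * lor c D + lor D D - 2 * lor e D - t * lor D D = (d'\<^sup>2 - d\<^sup>2) * (1 + t)"
  proof -
    have "(c - e) + (c' - e') = 2 *\<^sub>R (c - e) + (1 - t) *\<^sub>R D"
      unfolding c' e' by (simp add: vec3_eq_iff algebra_simps)
    then have "lor D ((c - e) + (c' - e')) = 2 * (lor D c - lor D e) + (1 - t) * lor D D"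
      by (simp only: lor_simps)
    from trans[OF this[symmetric] normal[folded t_def D_def]]
    show ?thesis
      unfolding lor_commute[of D c] lor_commute[of D e] by (simp add: algebra_simps)
  qed
  define E where "E = lor e e" define C where "C = lor c c" define X where "X = lor e D" define Y where "Y = lor c D" define Z where "Z = lor D D"
  have l: "lor e' e' = E + 2 * t * X + t\<^sup>2 * Z" "lor c' c' = C + 2 * Y + Z"
    unfolding c' e' E_def C_def X_def Y_def Z_def
    by (simp_all add: lor_commute[of D c] lor_commute[of D e] power2_eq_square algebra_simps)
  have "t * d * ((lor e' e' - (- (k / d'))\<^sup>2) / - (k / d') - (lor c c - d\<^sup>2) / d) =
      - (E + 2 * t * X + t\<^sup>2 * Z - (t * d)\<^sup>2) - t * (C - d\<^sup>2)"
    unfolding l kd C_def[symmetric] using nz t by (simp add: field_simps)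
  also have "\<dots> = - (E - (t * d')\<^sup>2) - t * (C + 2 * Y + Z - d'\<^sup>2)"
    using n[folded X_def Y_def Z_def] by (simp add: power2_eq_square algebra_simps) algebra
  also have "\<dots> = t * d * (d' / d * ((lor e e - (- (k / d))\<^sup>2) / - (k / d) - (lor c' c' - d'\<^sup>2) / d'))"
    unfolding l kd E_def[symmetric] using nz t by (simp add: field_simps)
  finally show "(lor e' e' - (- (k / d'))\<^sup>2) / - (k / d') - (lor c c - d\<^sup>2) / d =
      d' / d * ((lor e e - (- (k / d))\<^sup>2) / - (k / d) - (lor c' c' - d'\<^sup>2) / d')"
    using mult_left_cancel[of "t * d"] nz t by (metis mult_eq_0_iff)
qed

context ring_geometry
begin

lemma net_edge:
  assumes X: "net_eqs X \<sigma> g h" and e: "s_edge G b v v'"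
  shows "X v - X b = (\<sigma> b * g v) *\<^sub>R radial_dir G P v b" "X v' - X b = - (\<sigma> b * g v') *\<^sub>R radial_dir G P v b"
    "lor (radial_dir G P v b) (radial_dir G P v b) = 1" "v \<in> s_vertices G" "v' \<in> s_vertices G" "0 < g v" "0 < g v'"
    "\<sigma> b * \<sigma> b = 1" "\<sigma> b \<noteq> 0" "radial_dir G P v' b = - radial_dir G P v b" "incident G v b" "incident G v' b"
proof -
  have i: "svert G v" "svert G v'" "incident G v b" "incident G v' b" using e unfolding s_edge_def by blast+
  then show "incident G v b" "incident G v' b" by simp_all
  show r: "radial_dir G P v' b = - radial_dir G P v b"
    using G e
  proof (cases rule: s_edge_fan)
    case (1 w)
    then show ?thesis by (rule fan_dirs(1))
  next
    case (2 w)
    then show ?thesis using fan_dirs(1)[OF 2] by simp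
  qed
  show "X v - X b = (\<sigma> b * g v) *\<^sub>R radial_dir G P v b"
    using X i unfolding net_eqs_def by blast
  have "X v' - X b = (\<sigma> b * g v') *\<^sub>R radial_dir G P v' b"
    using X i unfolding net_eqs_def by blast
  then show "X v' - X b = - (\<sigma> b * g v') *\<^sub>R radial_dir G P v b" unfolding r by simp
  show "lor (radial_dir G P v b) (radial_dir G P v b) = 1" by (rule radial_dir(2)[OF i(3)])
  have w: "v \<in> white_vertices G" "v' \<in> white_vertices G" using i incident_white by blast+
  then show "v \<in> s_vertices G" "v' \<in> s_vertices G" "0 < g v" "0 < g v'"
    using i X unfolding s_vertices_def net_eqs_def by blast+
  have "\<sigma> b = 1 \<or> \<sigma> b = -1" using X unfolding net_eqs_def by blast
  then show "\<sigma> b * \<sigma> b = 1" "\<sigma> b \<noteq> 0" by auto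
qed

lemma net_edge_diff:
  assumes X: "net_eqs X \<sigma> g h" and e: "s_edge G b v v'"
  shows "X v' - X v = - (\<sigma> b * (g v + g v')) *\<^sub>R radial_dir G P v b"
proof -
  have "X v' - X v = (X v' - X b) - (X v - X b)" by simp
  then show ?thesis unfolding net_edge(1,2)[OF X e] by (simp add: algebra_simps)
qed

text \<open>Radial and face direction are orthonormal. By Pythagoras the sphere of radius
  \<open>h w\<close> about \<open>X w\<close> meets all vertex spheres of the face orthogonally, as
  \<open>isothermic_face\<close> asks.\<close>

lemma net_face:
  assumes X: "net_eqs X \<sigma> g h" and fan: "fan G b v w v'" and s: "\<not> svert G w"
  shows "X v - X w = (\<sigma> b * h w) *\<^sub>R face_dir G P w b + (\<sigma> b * g v) *\<^sub>R radial_dir G P v b"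
    "X v' - X w = (\<sigma> b * h w) *\<^sub>R face_dir G P w b - (\<sigma> b * g v') *\<^sub>R radial_dir G P v b"
    "lor (ctr P w) (X v - X w) = 0" "lor (X v - X w) (X v - X w) = (h w)\<^sup>2 + (g v)\<^sup>2"
proof -
  note i = fan_incident[OF fan] and f = fan_dirs[OF fan]
  obtain c c' where quad: "quad G v b w c" "quad G w b v' c'" using fan unfolding fan_def by blast
  have sv: "svert G v" "svert G v'" using quad_facts(11)[OF G quad(1)] quad_facts(11)[OF G quad(2)] s by simp_all
  have 1: "X v - X b = (\<sigma> b * g v) *\<^sub>R radial_dir G P v b" "X v' - X b = (\<sigma> b * g v') *\<^sub>R radial_dir G P v' b"
    "X b - X w = (\<sigma> b * h w) *\<^sub>R face_dir G P w b"
    using X i sv s unfolding net_eqs_def by blast+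
  have "X v - X w = (X v - X b) + (X b - X w)" "X v' - X w = (X v' - X b) + (X b - X w)" by simp_all
  then show a: "X v - X w = (\<sigma> b * h w) *\<^sub>R face_dir G P w b + (\<sigma> b * g v) *\<^sub>R radial_dir G P v b"
    and "X v' - X w = (\<sigma> b * h w) *\<^sub>R face_dir G P w b - (\<sigma> b * g v') *\<^sub>R radial_dir G P v b"
    unfolding 1 f(1) by (simp_all add: algebra_simps)
  show "lor (ctr P w) (X v - X w) = 0" unfolding a using f by simp
  have "\<sigma> b = 1 \<or> \<sigma> b = -1" using X unfolding net_eqs_def by blast
  then show "lor (X v - X w) (X v - X w) = (h w)\<^sup>2 + (g v)\<^sup>2"
    unfolding a using f(4,5) radial_dir(2)[OF i(1)] lor_commute[of "radial_dir G P v b" "face_dir G P w b"]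
    by (auto simp: power2_eq_square algebra_simps)
qed

text \<open>The centre of the ring of \<open>w\<close> is a timelike normal of the face.\<close>

lemma net_planar:
  assumes X: "net_eqs X \<sigma> g h"
  shows "planar_spacelike_faces G X"
  unfolding planar_spacelike_faces_def
proof
  fix w assume w: "w \<in> faces G"
  have "lor (ctr P w) (X (face_vertex w k)) = lor (ctr P w) (X w)" for k
    using net_face(3)[OF X face_fan[OF G w] face_facts(5)[OF G w], of k] by simp
  moreover have "lor (ctr P w) (ctr P w) < 0" using white(1)[OF face_facts(4)[OF G w]] by simp
  ultimately show "\<exists>F. spacelike_plane F \<and> (\<forall>k. X (face_vertex w k) \<in> F)"
    unfolding spacelike_plane_def by (intro exI[of _ "{x. lor (ctr P w) x = lor (ctr P w) (X w)}"]) auto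
qed

end

definition edge_signs :: "lattice_graph \<Rightarrow> (lattice_point \<Rightarrow> real) \<Rightarrow> bool" where
  "edge_signs G \<tau> \<longleftrightarrow> (\<forall>v. \<tau> v = 1 \<or> \<tau> v = -1) \<and>
     (\<forall>b v v'. s_edge G b v v' \<longrightarrow> \<tau> v' = (if hor G b then \<tau> v else - \<tau> v))"

lemma edge_signsD:
  assumes "edge_signs G \<tau>"
  shows "\<tau> v * \<tau> v = 1" "\<tau> v \<noteq> 0" "\<tau> v * (\<tau> v * x) = x" "\<bar>\<tau> v\<bar> = 1" "(\<tau> v)\<^sup>2 = 1"
    and "s_edge G b v v' \<Longrightarrow> \<tau> v * \<tau> v' = edge_sign G b" and "s_edge G b v v' \<Longrightarrow> \<tau> v' = edge_sign G b * \<tau> v"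
proof -
  have t: "\<tau> v = 1 \<or> \<tau> v = -1" using assms unfolding edge_signs_def by blast
  then show "\<tau> v * \<tau> v = 1" "\<tau> v \<noteq> 0" "\<tau> v * (\<tau> v * x) = x" "\<bar>\<tau> v\<bar> = 1" "(\<tau> v)\<^sup>2 = 1" by auto
  assume "s_edge G b v v'"
  then have "\<tau> v' = (if hor G b then \<tau> v else - \<tau> v)" using assms unfolding edge_signs_def by blast
  then show "\<tau> v * \<tau> v' = edge_sign G b" "\<tau> v' = edge_sign G b * \<tau> v" using t by (auto simp: edge_sign_def)
qed

context ring_geometry
begin

text \<open>Exactly one of two consecutive edges of a face is vertical, and only this one changes
  the sign.\<close>

lemma face_signs:
  assumes \<tau>: "edge_signs G \<tau>" and w: "w \<in> faces G"
  shows "\<tau> (face_vertex w (k + 2)) = - \<tau> (face_vertex w k)"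
proof -
  have e: "k + 1 + 1 = k + 2" by simp
  show ?thesis
    using edge_signsD(7)[OF \<tau> face_facts(1)[OF G w, of k]] edge_signsD(7)[OF \<tau> face_facts(1)[OF G w, of "k + 1", unfolded e]]
      face_facts(2)[OF G w, of k] by (auto simp: edge_sign_def split: if_splits)
qed

text \<open>\<open>Y\<close> serves to close the dual increments around a face: they are differences
  of a function on the vertices.\<close>

lemma net_isothermic:
  assumes X: "net_eqs X \<sigma> g h" and \<tau>: "edge_signs G \<tau>" and k: "k \<noteq> 0"
    and dual: "\<And>b v v'. s_edge G b v v' \<Longrightarrow> Y v' - Y v = (k / ((\<tau> v * g v) * (\<tau> v' * g v'))) *\<^sub>R (X v' - X v)"
  shows "s1_isothermic G (\<lambda>v. (X v, \<tau> v * g v))"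
  unfolding s1_isothermic_def
proof (intro conjI ballI allI impI)
  have gpos: "0 < g v" if "v \<in> s_vertices G" for v
    using X that unfolding net_eqs_def s_vertices_def by blast
  show "snd (X v, \<tau> v * g v) \<noteq> 0" if "v \<in> s_vertices G" for v
    using gpos[OF that] edge_signsD(2)[OF \<tau>] by simp
  show "planar_spacelike_faces G (\<lambda>v. fst (X v, \<tau> v * g v))"
    using net_planar[OF X] by simp
  show "\<exists>a. sphere_lift (X (face_vertex w (n + 2)), \<tau> (face_vertex w (n + 2)) * g (face_vertex w (n + 2))) -
        sphere_lift (X (face_vertex w n), \<tau> (face_vertex w n) * g (face_vertex w n)) =
        a *\<^sub>R (sphere_lift (X (face_vertex w (n + 3)), \<tau> (face_vertex w (n + 3)) * g (face_vertex w (n + 3))) -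
        sphere_lift (X (face_vertex w (n + 1)), \<tau> (face_vertex w (n + 1)) * g (face_vertex w (n + 1))))"
    if w: "w \<in> faces G" for w n
  proof (rule isothermic_face[where m = "X w" and r = "(h w)\<^sup>2"])
    define d where "d i = \<tau> (face_vertex w i) * g (face_vertex w i)" for i
    define c where "c i = X (face_vertex w i)" for i
    have gp: "0 < g (face_vertex w i)" for i using gpos[OF face_facts(3)[OF G w]] .
    then show "\<tau> (face_vertex w n) * g (face_vertex w n) \<noteq> 0" "\<tau> (face_vertex w (n + 1)) * g (face_vertex w (n + 1)) \<noteq> 0"
      "\<tau> (face_vertex w (n + 2)) * g (face_vertex w (n + 2)) \<noteq> 0" "\<tau> (face_vertex w (n + 3)) * g (face_vertex w (n + 3)) \<noteq> 0"
      using edge_signsD(2)[OF \<tau>] by (simp_all add: order_less_imp_not_eq2)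
    have e3: "n + 1 + 2 = n + 3" by simp
    have "\<tau> (face_vertex w (n + 3)) = - \<tau> (face_vertex w (n + 1))" using face_signs[OF \<tau> w, of "n + 1", unfolded e3] .
    moreover have "\<tau> (face_vertex w (n + 1)) = 1 \<or> \<tau> (face_vertex w (n + 1)) = -1" using \<tau> unfolding edge_signs_def by blast
    \<comment> \<open>Opposite vertices of a face carry opposite signs, so their inverse radii
      cannot coincide.\<close>
    ultimately have "d (n + 3) * d (n + 1) < 0"
      using gp[of "n + 3"] gp[of "n + 1"] by (auto simp: d_def)
    then show "1 / (\<tau> (face_vertex w (n + 3)) * g (face_vertex w (n + 3))) \<noteq> 1 / (\<tau> (face_vertex w (n + 1)) * g (face_vertex w (n + 1)))"
      unfolding d_def[symmetric] by (metis divide_cancel_left mult_less_0_iff not_less_iff_gr_or_eq zero_neq_one)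
    have orth: "lor (X (face_vertex w i) - X w) (X (face_vertex w i) - X w) = (h w)\<^sup>2 + (\<tau> (face_vertex w i) * g (face_vertex w i))\<^sup>2" for i
      using net_face(4)[OF X face_fan[OF G w] face_facts(5)[OF G w], of i] edge_signsD(5)[OF \<tau>] by (simp add: power_mult_distrib)
    show "lor (X (face_vertex w n) - X w) (X (face_vertex w n) - X w) = (h w)\<^sup>2 + (\<tau> (face_vertex w n) * g (face_vertex w n))\<^sup>2"
      "lor (X (face_vertex w (n + 1)) - X w) (X (face_vertex w (n + 1)) - X w) = (h w)\<^sup>2 + (\<tau> (face_vertex w (n + 1)) * g (face_vertex w (n + 1)))\<^sup>2"
      "lor (X (face_vertex w (n + 2)) - X w) (X (face_vertex w (n + 2)) - X w) = (h w)\<^sup>2 + (\<tau> (face_vertex w (n + 2)) * g (face_vertex w (n + 2)))\<^sup>2"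
      "lor (X (face_vertex w (n + 3)) - X w) (X (face_vertex w (n + 3)) - X w) = (h w)\<^sup>2 + (\<tau> (face_vertex w (n + 3)) * g (face_vertex w (n + 3)))\<^sup>2"
      by (rule orth)+
    have D: "Y (face_vertex w (i + 1)) - Y (face_vertex w i) = k *\<^sub>R ((1 / (d i * d (i + 1))) *\<^sub>R (c (i + 1) - c i))" for i
      using dual[OF face_facts(1)[OF G w, of i]] by (simp add: d_def c_def)
    have e4: "n + 3 + 1 = n + 4" by simp
    have four: "face_vertex w (n + 3 + 1) = face_vertex w n" unfolding e4 by (rule face_vertex_add_4)
    then have cd: "c (n + 3 + 1) = c n" "d (n + 3 + 1) = d n" unfolding c_def d_def by simp_all
    have e: "n + 1 + 1 = n + 2" "n + 2 + 1 = n + 3" by simp_all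
    have "k *\<^sub>R ((1 / (d n * d (n + 1))) *\<^sub>R (c (n + 1) - c n) + (1 / (d (n + 1) * d (n + 2))) *\<^sub>R (c (n + 2) - c (n + 1)) +
      (1 / (d (n + 2) * d (n + 3))) *\<^sub>R (c (n + 3) - c (n + 2)) + (1 / (d (n + 3) * d n)) *\<^sub>R (c n - c (n + 3))) = 0"
      unfolding scaleR_add_right D[symmetric, of n] D[symmetric, of "n + 1", unfolded e] D[symmetric, of "n + 2", unfolded e]
        D[symmetric, of "n + 3", unfolded four cd] by simp
    then have "(1 / (d n * d (n + 1))) *\<^sub>R (c (n + 1) - c n) + (1 / (d (n + 1) * d (n + 2))) *\<^sub>R (c (n + 2) - c (n + 1)) +
      (1 / (d (n + 2) * d (n + 3))) *\<^sub>R (c (n + 3) - c (n + 2)) + (1 / (d (n + 3) * d n)) *\<^sub>R (c n - c (n + 3)) = 0"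
      using k by simp
    then show "(1 / (\<tau> (face_vertex w n) * g (face_vertex w n) * (\<tau> (face_vertex w (n + 1)) * g (face_vertex w (n + 1))))) *\<^sub>R (X (face_vertex w (n + 1)) - X (face_vertex w n)) +
      (1 / (\<tau> (face_vertex w (n + 1)) * g (face_vertex w (n + 1)) * (\<tau> (face_vertex w (n + 2)) * g (face_vertex w (n + 2))))) *\<^sub>R (X (face_vertex w (n + 2)) - X (face_vertex w (n + 1))) +
      (1 / (\<tau> (face_vertex w (n + 2)) * g (face_vertex w (n + 2)) * (\<tau> (face_vertex w (n + 3)) * g (face_vertex w (n + 3))))) *\<^sub>R (X (face_vertex w (n + 3)) - X (face_vertex w (n + 2))) +
      (1 / (\<tau> (face_vertex w (n + 3)) * g (face_vertex w (n + 3)) * (\<tau> (face_vertex w n) * g (face_vertex w n)))) *\<^sub>R (X (face_vertex w n) - X (face_vertex w (n + 3))) = 0"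
      unfolding c_def d_def .
  qed
  fix b v v' assume e: "s_edge G b v v'"
  note N = net_edge[OF X e]
  define u where "u = radial_dir G P v b"
  have d: "X b - X v = (- (\<sigma> b * g v)) *\<^sub>R u" "X b - X v' = (\<sigma> b * g v') *\<^sub>R u"
    using arg_cong[OF N(1), of uminus] arg_cong[OF N(2), of uminus] by (simp_all add: u_def)
  have "X b \<in> sphere_points (X v, \<tau> v * g v)" "X b \<in> sphere_points (X v', \<tau> v' * g v')"
    unfolding sphere_points_def using N(3,8) edge_signsD(5)[OF \<tau>]
    by (simp_all add: d power_mult_distrib u_def[symmetric] del: lor_simps(3,4)) (simp_all add: power2_eq_square algebra_simps)
  moreover have "tangent_plane (X v, \<tau> v * g v) (X b) = tangent_plane (X v', \<tau> v' * g v') (X b)"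
    using N by (simp add: tangent_plane_eq[OF d(1)] tangent_plane_eq[OF d(2)])
  ultimately show "spheres_touch (X v, \<tau> v * g v) (X v', \<tau> v' * g v')"
    unfolding spheres_touch_def by blast
  have nz: "\<tau> v * g v \<noteq> 0" "\<tau> v' * g v' \<noteq> 0" using N(6,7) edge_signsD(2)[OF \<tau>] by simp_all
  have "lor (X v - X v') (X v - X v') = (g v + g v')\<^sup>2"
  proof -
    have "X v - X v' = (\<sigma> b * (g v + g v')) *\<^sub>R u"
      using arg_cong[OF net_edge_diff[OF X e], of uminus] by (simp add: u_def)
    then have "lor (X v - X v') (X v - X v') = (\<sigma> b * \<sigma> b) * (g v + g v')\<^sup>2 * lor u u"
      by (simp only: lor_simps(5,6) power2_eq_square mult_ac)
    then show ?thesis using N(3,8) by (simp add: u_def)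
  qed
  then have "inner32 (sphere_lift (X v, \<tau> v * g v)) (sphere_lift (X v', \<tau> v' * g v')) =
      ((g v)\<^sup>2 + (g v')\<^sup>2 - (g v + g v')\<^sup>2) / (2 * (edge_sign G b * (g v * g v')))"
    unfolding inner32_sphere_lift[OF nz] edge_signsD(6)[OF \<tau> e, symmetric]
    using edge_signsD(5)[OF \<tau>] by (simp add: power_mult_distrib mult_ac)
  also have "\<dots> = - (2 * (g v * g v')) / (2 * (edge_sign G b * (g v * g v')))"
    by (simp add: power2_eq_square algebra_simps)
  also have "\<dots> = (if hor G b then -1 else 1)"
    using N(6,7) by (auto simp: edge_sign_def)
  finally show "inner32 (sphere_lift (X v, \<tau> v * g v)) (sphere_lift (X v', \<tau> v' * g v')) = (if hor G b then -1 else 1)" .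
qed

end

section \<open>Scaling of pairs and mixed areas\<close>

lemma reverse_scale_map: "reverse_map (scale_map \<mu> s) = scale_map \<mu> (reverse_map s)"
  by (simp add: reverse_map_def scale_map_def)

lemma cmc_edge_condition_scale:
  assumes "\<mu> \<noteq> 0" "cmc_edge_condition G s s'"
  shows "cmc_edge_condition G (scale_map \<mu> s) (scale_map \<mu> s')"
  unfolding cmc_edge_condition_def
proof (intro allI impI)
  fix b v v' assume "s_edge G b v v'"
  then obtain a where "sphere_lift (s' v') - sphere_lift (s v) = a *\<^sub>R (sphere_lift (s' v) - sphere_lift (s v'))"
    using assms(2) unfolding cmc_edge_condition_def by blast
  from scale_pair_relation[OF assms(1) this]
  show "\<exists>a. sphere_lift (scale_map \<mu> s' v') - sphere_lift (scale_map \<mu> s v) =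
      a *\<^sub>R (sphere_lift (scale_map \<mu> s' v) - sphere_lift (scale_map \<mu> s v'))"
    unfolding scale_map_apply by blast
qed

lemma cmc_position_scale:
  assumes "\<mu> \<noteq> 0" "cmc_position G s s'"
  shows "cmc_position G (scale_map \<mu> s) (scale_map \<mu> s')"
proof -
  have "lor (fst (scale_map \<mu> s' v) - fst (scale_map \<mu> s v)) (fst (scale_map \<mu> s' v) - fst (scale_map \<mu> s v)) =
      \<mu>\<^sup>2 * lor (fst (s' v) - fst (s v)) (fst (s' v) - fst (s v))" for v
    unfolding scale_map_apply fst_conv scaleR_diff_right[symmetric] lor_simps(5,6) by (simp only: power2_eq_square mult_ac)
  then have "lor (fst (scale_map \<mu> s' v) - fst (scale_map \<mu> s v)) (fst (scale_map \<mu> s' v) - fst (scale_map \<mu> s v)) < 0"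
    if "v \<in> s_vertices G" for v
    using assms that unfolding cmc_position_def by (simp add: mult_pos_neg del: lor_simps)
  then show ?thesis
    using assms(2) cmc_edge_condition_scale[OF assms(1)] unfolding cmc_position_def reverse_scale_map by blast
qed

lemma mixed_area_scale:
  "mixed_area N w (\<lambda>v. \<mu> *\<^sub>R x v) n = \<mu> * mixed_area N w x n"
  "mixed_area N w x (\<lambda>v. \<mu> *\<^sub>R n v) = \<mu> * mixed_area N w x n"
  unfolding mixed_area_def det_eq_lor_lcross scaleR_diff_right[symmetric] lcross_simps(5,6) lor_simps(5,6)
  by (simp_all add: algebra_simps)

lemma mixed_area_diff: "mixed_area N w x (\<lambda>v. n v - m v) = mixed_area N w x n - mixed_area N w x m"
proof -
  have "(a - b) - (c - d) = (a - c) - (b - d)" for a b c d :: "real^3" by simp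
  then show ?thesis
    unfolding mixed_area_def det_eq_lor_lcross by (simp only: lcross_simps(3,4) lor_simps(3,4)) (simp add: field_simps)
qed

lemma has_mean_curvature_scale:
  assumes "\<mu> \<noteq> 0" and H: "has_mean_curvature G x n H"
  shows "has_mean_curvature G (\<lambda>v. \<mu> *\<^sub>R x v) n (H / \<mu>)"
  unfolding has_mean_curvature_def
proof
  fix w assume "w \<in> faces G"
  then obtain N where N: "lor N N = -1" "\<And>k l. lor N (x (face_vertex w k) - x (face_vertex w l)) = 0"
      "\<And>k l. lor N (n (face_vertex w k) - n (face_vertex w l)) = 0"
      "mixed_area N w x x \<noteq> 0" "H = - mixed_area N w x n / mixed_area N w x x"
    using H unfolding has_mean_curvature_def by blast
  show "\<exists>N. lor N N = - 1 \<and>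
         (\<forall>k l. lor N (\<mu> *\<^sub>R x (face_vertex w k) - \<mu> *\<^sub>R x (face_vertex w l)) = 0 \<and>
                lor N (n (face_vertex w k) - n (face_vertex w l)) = 0) \<and>
         mixed_area N w (\<lambda>v. \<mu> *\<^sub>R x v) (\<lambda>v. \<mu> *\<^sub>R x v) \<noteq> 0 \<and>
         H / \<mu> = - mixed_area N w (\<lambda>v. \<mu> *\<^sub>R x v) n / mixed_area N w (\<lambda>v. \<mu> *\<^sub>R x v) (\<lambda>v. \<mu> *\<^sub>R x v)"
    using N assms(1)
    by (intro exI[of _ N]) (simp add: mixed_area_scale scaleR_diff_right[symmetric] del: lor_simps(3,4))
qed

text \<open>Both sides are twice the vector area of the quadrilateral, by its diagonals and by the
  triangles over its edges.\<close>

lemma lcross_diagonals: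
  "lcross (y2 - y0) (y3 - y1) = lcross y0 y1 + lcross y1 y2 + lcross y2 y3 + lcross y3 y0"
  by (simp add: vec3_eq_iff algebra_simps)

definition signed_surface :: "(lattice_point \<Rightarrow> real^3) \<Rightarrow> (lattice_point \<Rightarrow> real) \<Rightarrow> (lattice_point \<Rightarrow> real) \<Rightarrow> sphere_map" where
  "signed_surface X \<tau> g = (\<lambda>v. (X v, \<tau> v * g v))"

section \<open>The primal surface and its dual\<close>

context ring_geometry
begin

definition dual_rad :: "lattice_point \<Rightarrow> real" where
  "dual_rad v = dual_factor q / vertex_rad q P v"

lemma net_eqs_scale:
  assumes X: "net_eqs X \<sigma> g h" and "0 < \<mu>"
  shows "net_eqs (\<lambda>x. \<mu> *\<^sub>R X x) \<sigma> (\<lambda>v. \<mu> * g v) (\<lambda>v. \<mu> * h v)"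
proof -
  have "\<mu> *\<^sub>R x - \<mu> *\<^sub>R y = (s * (\<mu> * c)) *\<^sub>R u" if "x - y = (s * c) *\<^sub>R u" for x y u :: "real^3" and s c
    unfolding scaleR_diff_right[symmetric] that by (simp add: mult_ac)
  then show ?thesis
    using X assms(2) unfolding net_eqs_def by simp
qed

context
  fixes F :: "lattice_point \<Rightarrow> real^3" and \<tau> :: "lattice_point \<Rightarrow> real"
  assumes F: "dual_net G q P F" and \<tau>: "edge_signs G \<tau>"
begin

lemmas F_eqs = dual_net_eqs[OF F, folded dual_rad_def]
lemmas C_eqs = primal_net_eqs[OF F]

text \<open>Both edges are multiples of the same radial direction, of lengths d + d' and l/d + l/d'
  with l = \<open>dual_factor q\<close>. The quotient is l/(d d'), and the product of the
  orientation signs is the edge sign.\<close>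

lemma primal_dual_edge:
  assumes e: "s_edge G b v v'"
  shows "F v' - F v = (dual_factor q / ((\<tau> v * vertex_rad q P v) * (\<tau> v' * vertex_rad q P v'))) *\<^sub>R (primal_net F v' - primal_net F v)"
    and "primal_net F v' - primal_net F v = (dual_factor q / ((\<tau> v * dual_rad v) * (\<tau> v' * dual_rad v'))) *\<^sub>R (F v' - F v)"
proof -
  define d d' \<eta> l where "d = vertex_rad q P v" and "d' = vertex_rad q P v'" and "\<eta> = edge_sign G b" and "l = dual_factor q"
  have pos: "d \<noteq> 0" "d' \<noteq> 0" "l \<noteq> 0" using net_edge(6,7)[OF C_eqs e] dual_factor_pos by (simp_all add: d_def d'_def l_def)
  have \<eta>: "\<eta> * \<eta> = 1" "\<eta> \<noteq> 0" "1 / \<eta> = \<eta>" by (auto simp: \<eta>_def edge_sign_def)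
  have t: "\<tau> v * \<tau> v' = \<eta>" using edge_signsD(6)[OF \<tau> e] by (simp add: \<eta>_def)
  have m: "(\<tau> v * a) * (\<tau> v' * c) = \<eta> * (a * c)" for a c unfolding t[symmetric] by simp
  have 1: "F v' - F v = - (\<eta> * (l / d + l / d')) *\<^sub>R radial_dir G P v b" "primal_net F v' - primal_net F v = - (d + d') *\<^sub>R radial_dir G P v b"
    using net_edge_diff[OF F_eqs e] net_edge_diff[OF C_eqs e] by (simp_all add: dual_rad_def d_def d'_def \<eta>_def l_def)
  have c1: "l / (\<eta> * (d * d')) * (d + d') = \<eta> * (l / d + l / d')"
  proof -
    have "l / (\<eta> * (d * d')) * (d + d') = (1 / \<eta>) * (l / d + l / d')" using pos \<eta>(2) by (simp add: field_simps)
    then show ?thesis unfolding \<eta>(3) .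
  qed
  have c2: "l / (\<eta> * ((l / d) * (l / d'))) * (\<eta> * (l / d + l / d')) = d + d'"
    using pos \<eta>(2) by (simp add: field_simps)
  show "F v' - F v = (dual_factor q / ((\<tau> v * vertex_rad q P v) * (\<tau> v' * vertex_rad q P v'))) *\<^sub>R (primal_net F v' - primal_net F v)"
    unfolding 1 m d_def[symmetric] d'_def[symmetric] l_def[symmetric] c1[symmetric]
    by (simp only: scaleR_scaleR scaleR_minus_right scaleR_minus_left)
  show "primal_net F v' - primal_net F v = (dual_factor q / ((\<tau> v * dual_rad v) * (\<tau> v' * dual_rad v'))) *\<^sub>R (F v' - F v)"
    unfolding 1 m dual_rad_def d_def[symmetric] d'_def[symmetric] l_def[symmetric] by (subst c2[symmetric]) simp
qed

abbreviation "primal_surface \<equiv> signed_surface (primal_net F) \<tau> (vertex_rad q P)"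
abbreviation "dual_surface \<equiv> signed_surface F \<tau> dual_rad"

lemma rads_pos:
  assumes "v \<in> s_vertices G" shows "0 < vertex_rad q P v" "0 < dual_rad v"
  using assms white(5)[of v] dual_factor_pos by (auto simp: s_vertices_def dual_rad_def)

text \<open>Each of the two nets plays the role of \<open>Y\<close> in \<open>net_isothermic\<close>
  for the other.\<close>

lemma scaled_isothermic:
  assumes "0 < \<mu>"
  shows "s1_isothermic G (scale_map \<mu> primal_surface)" "s1_isothermic G (scale_map \<mu> dual_surface)"
proof -
  have k: "\<mu> * dual_factor q \<noteq> 0" using assms dual_factor_pos by simp
  have r: "(\<mu> * l / ((s * (\<mu> * a)) * (t * (\<mu> * b)))) *\<^sub>R (\<mu> *\<^sub>R x - \<mu> *\<^sub>R y) = (l / ((s * a) * (t * b))) *\<^sub>R (x - y)"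
    for l s t a b and x y :: "real^3"
    unfolding scaleR_diff_right[symmetric] using assms by simp
  have "s1_isothermic G (\<lambda>v. (\<mu> *\<^sub>R primal_net F v, \<tau> v * (\<mu> * vertex_rad q P v)))"
    by (rule net_isothermic[OF net_eqs_scale[OF C_eqs assms] \<tau> k]) (unfold r, rule primal_dual_edge(1))
  then show "s1_isothermic G (scale_map \<mu> primal_surface)"
    by (simp add: scale_map_def signed_surface_def mult_ac)
  have "s1_isothermic G (\<lambda>v. (\<mu> *\<^sub>R F v, \<tau> v * (\<mu> * dual_rad v)))"
    by (rule net_isothermic[OF net_eqs_scale[OF F_eqs assms] \<tau> k]) (unfold r, rule primal_dual_edge(2))
  then show "s1_isothermic G (scale_map \<mu> dual_surface)"
    by (simp add: scale_map_def signed_surface_def mult_ac)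
qed

lemma scaled_dual:
  assumes \<mu>: "0 < \<mu>" "0 < \<nu>"
  shows "christoffel_dual G (scale_map \<mu> primal_surface) (scale_map \<nu> dual_surface)"
    and "christoffel_dual G (scale_map \<nu> dual_surface) (scale_map \<mu> primal_surface)"
proof -
  have pos: "0 < \<mu> * \<nu> * dual_factor q" using assms dual_factor_pos by simp
  have s: "\<nu> * (\<tau> v * dual_rad v) = \<mu> * \<nu> * dual_factor q / (\<mu> * (\<tau> v * vertex_rad q P v))"
    "\<mu> * (\<tau> v * vertex_rad q P v) = \<mu> * \<nu> * dual_factor q / (\<nu> * (\<tau> v * dual_rad v))" if "v \<in> s_vertices G" for v
    using rads_pos[OF that] \<mu> dual_factor_pos edge_signsD(1,2)[OF \<tau>, of v] unfolding dual_rad_def by (auto simp: field_simps)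
  have r: "\<nu> *\<^sub>R y' - \<nu> *\<^sub>R y = (\<mu> * \<nu> * l / ((\<mu> * a) * (\<mu> * b))) *\<^sub>R (\<mu> *\<^sub>R x' - \<mu> *\<^sub>R x)"
    "\<mu> *\<^sub>R y' - \<mu> *\<^sub>R y = (\<mu> * \<nu> * l / ((\<nu> * a) * (\<nu> * b))) *\<^sub>R (\<nu> *\<^sub>R x' - \<nu> *\<^sub>R x)"
    if "y' - y = (l / (a * b)) *\<^sub>R (x' - x)" for y y' x x' :: "real^3" and l a b
    unfolding scaleR_diff_right[symmetric] that using \<mu> by simp_all
  show "christoffel_dual G (scale_map \<mu> primal_surface) (scale_map \<nu> dual_surface)"
    unfolding christoffel_dual_def scale_map_apply signed_surface_def fst_conv snd_conv
    using pos s(1) r(1)[OF primal_dual_edge(1)] by blast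
  show "christoffel_dual G (scale_map \<nu> dual_surface) (scale_map \<mu> primal_surface)"
    unfolding christoffel_dual_def scale_map_apply signed_surface_def fst_conv snd_conv
    using pos s(2) r(2)[OF primal_dual_edge(2)] by blast
qed

lemma primal_minus_dual:
  assumes "v \<in> s_vertices G"
  shows "primal_net F v - (1 - q) *\<^sub>R F v = (sqrt q / cosh (inner_rad P v)) *\<^sub>R ctr P v"
proof -
  have "white G v" "svert G v" using assms unfolding s_vertices_def white_vertices_def quad_def by auto
  then show ?thesis by (simp add: primal_net_def)
qed

lemma primal_cmc_position:
  assumes q1: "q < 1"
  shows "cmc_position G primal_surface (scale_map (1 - q) dual_surface)"
proof -
  have "cmc_edge_condition G primal_surface (reverse_map (scale_map (1 - q) dual_surface))"
    unfolding cmc_edge_condition_def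
  proof (intro allI impI)
    fix b v v' assume e: "s_edge G b v v'"
    note N = net_edge[OF C_eqs e]
    have w: "v \<in> white_vertices G" "v' \<in> white_vertices G" using N(4,5) by (auto simp: s_vertices_def)
    define d d' u \<eta> k where "d = \<tau> v * vertex_rad q P v" and "d' = \<tau> v' * vertex_rad q P v'" and "u = radial_dir G P v b"
      and "\<eta> = edge_sign G b" and "k = (1 - q) * dual_factor q"
    have k: "k \<noteq> 0" using q1 dual_factor_pos by (simp add: k_def)
    have nz: "d \<noteq> 0" "d' \<noteq> 0" using N(6,7) edge_signsD(2)[OF \<tau>] by (simp_all add: d_def d'_def)
    have dual: "(1 - q) *\<^sub>R F v' - (1 - q) *\<^sub>R F v = (k / (d * d')) *\<^sub>R (primal_net F v' - primal_net F v)"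
      unfolding scaleR_diff_right[symmetric] primal_dual_edge(1)[OF e] by (simp add: k_def d_def d'_def)
    have ux: "lor u (pt P b) = 0" "lor u u = 1" unfolding u_def using radial_dir[OF N(11)] by simp_all
    have c: "ctr P v = ring_cosh G P v b *\<^sub>R pt P b + ring_sinh G P v b *\<^sub>R u"
      "ctr P v' = ring_cosh G P v' b *\<^sub>R pt P b - ring_sinh G P v' b *\<^sub>R u"
      using radial_dir(3)[OF N(11)] radial_dir(3)[OF N(12)] N(10) by (simp_all add: u_def)
    define m where "m x = sqrt q / cosh (inner_rad P x) * ring_sinh G P x b" for x
    have uK: "lor u (primal_net F v - (1 - q) *\<^sub>R F v) = m v" "lor u (primal_net F v' - (1 - q) *\<^sub>R F v') = - m v'"
      unfolding primal_minus_dual[OF N(4)] primal_minus_dual[OF N(5)] c m_def using ux by simp_all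
    \<comment> \<open>Along the edge the Gauss map has the component radius minus \<eta> times dual
      radius. Hence with l = \<open>k\<close>, m v - m v' is (d - d') (1 + \<eta> l/(d d')) in terms
      of the unsigned radii, and the factor - (d + d') produces the right side of
      \<open>normal\<close>.\<close>
    have m: "m x = vertex_rad q P x - \<eta> * ((1 - q) * dual_factor q / vertex_rad q P x)" if x: "x \<in> white_vertices G" "svert G x" for x
    proof -
      note r = dual_radii(1)[OF x(1)] and wx = white(4)[OF x(1)]
      have sq: "sqrt q * sqrt q = q" "sqrt q \<noteq> 0" "q \<noteq> 0" using q by simp_all
      have h: "horizontal G x b \<longleftrightarrow> hor G b" using x by (simp add: horizontal_def)
      have mx: "m x = (if hor G b then q * tanh (inner_rad P x) else tanh (outer_rad P x)) / sqrt q"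
      proof (cases "hor G b")
        case True
        have "sqrt q = q / sqrt q" using q by (simp add: real_div_sqrt)
        then have "m x = (q / sqrt q) * tanh (inner_rad P x)" using True h by (simp add: m_def ring_sinh_def tanh_def)
        then show ?thesis using True by simp
      next
        case False
        have "sqrt q / cosh (inner_rad P x) = 1 / (sqrt q * cosh (outer_rad P x))"
          unfolding wx using sq by (simp add: field_simps)
        then show ?thesis using False h by (simp add: m_def ring_sinh_def tanh_def)
      qed
      show ?thesis unfolding mx r unfolding \<eta>_def vertex_rad_def edge_sign_def using sq by (auto simp: field_simps)
    qed
    have sv: "svert G v" "svert G v'" using e unfolding s_edge_def by blast+
    have "lor (primal_net F v' - primal_net F v) ((primal_net F v - (1 - q) *\<^sub>R F v) + (primal_net F v' - (1 - q) *\<^sub>R F v'))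
        = - (vertex_rad q P v + vertex_rad q P v') * (m v - m v')"
      unfolding net_edge_diff[OF C_eqs e] u_def[symmetric] lor_simps(2,5) uK by (simp add: algebra_simps)
    also have "\<dots> = (d'\<^sup>2 - d\<^sup>2) * (1 + k / (d * d'))"
    proof -
      define a a' where "a = vertex_rad q P v" and "a' = vertex_rad q P v'"
      have aa: "a \<noteq> 0" "a' \<noteq> 0" using N(6,7) by (simp_all add: a_def a'_def)
      have \<eta>: "1 / \<eta> = \<eta>" "\<eta> \<noteq> 0" by (auto simp: \<eta>_def edge_sign_def)
      have "d * d' = \<eta> * (a * a')" unfolding \<eta>_def edge_signsD(6)[OF \<tau> e, symmetric] by (simp add: d_def d'_def a_def a'_def)
      then have kd: "k / (d * d') = \<eta> * (k / (a * a'))" using \<eta>(1) by (simp add: divide_simps)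
      have d2: "d\<^sup>2 = a\<^sup>2" "d'\<^sup>2 = a'\<^sup>2" using edge_signsD(5)[OF \<tau>] by (simp_all add: d_def d'_def a_def a'_def power_mult_distrib)
      show ?thesis
        unfolding m[OF w(1) sv(1)] m[OF w(2) sv(2)] kd d2 a_def[symmetric] a'_def[symmetric] k_def[symmetric]
        using aa by (simp add: field_simps power2_eq_square)
    qed
    finally have "sphere_lift ((1 - q) *\<^sub>R F v', - (k / d')) - sphere_lift (primal_net F v, d) =
        (d' / d) *\<^sub>R (sphere_lift ((1 - q) *\<^sub>R F v, - (k / d)) - sphere_lift (primal_net F v', d'))"
      by (rule cmc_lift_relation[OF nz k dual])
    moreover have "k / d = (1 - q) * (\<tau> v * dual_rad v)" "k / d' = (1 - q) * (\<tau> v' * dual_rad v')"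
    proof -
      have "1 / \<tau> x = \<tau> x" for x using edge_signsD(1,2)[OF \<tau>, of x] by (simp add: divide_eq_eq)
      then have t: "y / (\<tau> x * z) = \<tau> x * (y / z)" for x y z by (metis divide_divide_eq_left times_divide_eq_left mult.commute mult_1 times_divide_times_eq)
      show "k / d = (1 - q) * (\<tau> v * dual_rad v)" "k / d' = (1 - q) * (\<tau> v' * dual_rad v')"
        unfolding k_def d_def d'_def dual_rad_def t by simp_all
    qed
    ultimately show "\<exists>a. sphere_lift (reverse_map (scale_map (1 - q) dual_surface) v') - sphere_lift (primal_surface v) =
        a *\<^sub>R (sphere_lift (reverse_map (scale_map (1 - q) dual_surface) v) - sphere_lift (primal_surface v'))"
      unfolding reverse_map_def scale_map_apply signed_surface_def fst_conv snd_conv d_def d'_def by metis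
  qed
  moreover have "lor (fst (scale_map (1 - q) dual_surface v) - fst (primal_surface v)) (fst (scale_map (1 - q) dual_surface v) - fst (primal_surface v)) < 0"
    if v: "v \<in> s_vertices G" for v
  proof -
    define k where "k = sqrt q / cosh (inner_rad P v)"
    have "fst (scale_map (1 - q) dual_surface v) - fst (primal_surface v) = - (k *\<^sub>R ctr P v)"
      unfolding k_def primal_minus_dual[OF v, symmetric] by (simp add: scale_map_apply signed_surface_def)
    moreover have "lor (ctr P v) (ctr P v) = -1" using white(1) v by (simp add: s_vertices_def)
    moreover have "0 < k" using q by (simp add: k_def cosh_real_pos)
    ultimately show ?thesis by simp
  qed
  ultimately show ?thesis unfolding cmc_position_def by blast
qed

text \<open>With c = \<open>primal_net F\<close> the Gauss map is (1 - q) F - c. The mixed area of c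
  with its Christoffel dual F vanishes, so A(c,n) = - A(c,c), and only A(c,c) \<noteq> 0 remains to
  be seen.\<close>

lemma primal_mean_curvature:
  "has_mean_curvature G (primal_net F) (\<lambda>v. (1 - q) *\<^sub>R F v - primal_net F v) 1"
  unfolding has_mean_curvature_def
proof
  fix w assume w: "w \<in> faces G"
  define N where "N = ctr P w"
  note s = face_facts(5)[OF G w] and ww = face_facts(4)[OF G w]
  have C0: "lor N (primal_net F (face_vertex w k)) = lor N (primal_net F w)" for k
    using net_face(3)[OF C_eqs face_fan[OF G w] s, of k] by (simp add: N_def)
  have F0: "lor N (F (face_vertex w k)) = lor N (F w)" for k
    using net_face(3)[OF F_eqs face_fan[OF G w] s, of k] by (simp add: N_def)
  have "mixed_area N w (primal_net F) F = 0"
  proof -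
    define e where "e i = 1 / (\<tau> (face_vertex w i) * vertex_rad q P (face_vertex w i))" for i
    have D: "F (face_vertex w (i + 1)) - F (face_vertex w i) = (dual_factor q * (e i * e (i + 1))) *\<^sub>R (primal_net F (face_vertex w (i + 1)) - primal_net F (face_vertex w i))" for i
      using primal_dual_edge(1)[OF face_facts(1)[OF G w, of i]] by (simp add: e_def)
    have e_ne: "e (i + 2) \<noteq> e i" for i
    proof -
      have "0 < vertex_rad q P (face_vertex w j)" for j using rads_pos(1)[OF face_facts(3)[OF G w]] .
      moreover have "\<tau> (face_vertex w i) = 1 \<or> \<tau> (face_vertex w i) = -1" using \<tau> unfolding edge_signs_def by blast
      ultimately have "e (i + 2) * e i < 0"
        unfolding e_def face_signs[OF \<tau> w] by (auto simp: divide_less_0_iff)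
      then show ?thesis by (metis mult_less_0_iff not_less_iff_gr_or_eq)
    qed
    have f4: "face_vertex w (3 + 1) = face_vertex w 0" "e (3 + 1) = e 0" using face_vertex_add_4[of w 0] by (simp_all add: e_def)
    have nums: "0 + 1 = (1::nat)" "1 + 1 = (2::nat)" "2 + 1 = (3::nat)" "1 + 2 = (3::nat)" "0 + 2 = (2::nat)" by simp_all
    have nz: "dual_factor q \<noteq> 0" using dual_factor_pos by simp
    note dd = dual_diagonals[OF e_ne[of 1, unfolded nums] e_ne[of 0, unfolded nums] D[of 0, unfolded nums] D[of 1, unfolded nums] D[of 2, unfolded nums] D[of 3, unfolded f4] nz]
    obtain s1 s2 where "F (face_vertex w 2) - F (face_vertex w 0) = s1 *\<^sub>R (primal_net F (face_vertex w 3) - primal_net F (face_vertex w 1))"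
      "F (face_vertex w 3) - F (face_vertex w 1) = s2 *\<^sub>R (primal_net F (face_vertex w 2) - primal_net F (face_vertex w 0))"
      using dd by blast
    then show ?thesis
      unfolding mixed_area_def det_eq_lor_lcross by (simp only: lcross_simps(5,6,7)) simp
  qed
  moreover have "0 < mixed_area N w (primal_net F) (primal_net F)"
  proof -
    define y g where "y i = primal_net F (face_vertex w i) - primal_net F w" and "g i = vertex_rad q P (face_vertex w i)" for i
    have gp: "0 < g i" for i using rads_pos(1)[OF face_facts(3)[OF G w]] by (simp add: g_def)
    have rho: "0 < face_rad q P w" using white(6)[OF ww] .
    \<comment> \<open>The triangles over the edges with apex \<open>primal_net F w\<close> are all
      positively oriented, since the face radius and the vertex radii are positive.\<close>
    have A: "0 < lor (lcross (y i) (y (i + 1))) N" for i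
    proof -
      define n u r where "n = face_dir G P w (face_edge w i)" and "u = radial_dir G P (face_vertex w i) (face_edge w i)" and "r = face_rad q P w"
      note nf = net_face[OF C_eqs face_fan[OF G w, of i] s, folded n_def u_def r_def]
      have y: "y i = - r *\<^sub>R n + g i *\<^sub>R u" "y (i + 1) = - r *\<^sub>R n - g (i + 1) *\<^sub>R u"
        using nf(1,2) by (simp_all add: y_def g_def)
      have "lcross (y i) (y (i + 1)) = (r * (g i + g (i + 1))) *\<^sub>R lcross n u"
        unfolding y by (simp add: vec3_eq_iff algebra_simps)
      moreover have "lor (lcross n u) N = 1" using fan_dirs(6)[OF face_fan[OF G w, of i]] by (simp add: n_def u_def N_def)
      moreover have "0 < r * (g i + g (i + 1))" using rho gp[of i] gp[of "i + 1"] by (simp add: r_def)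
      ultimately show ?thesis by simp
    qed
    have y4: "y (3 + 1) = y 0" using face_vertex_add_4[of w 0] by (simp add: y_def)
    have nums: "0 + 1 = (1::nat)" "1 + 1 = (2::nat)" "2 + 1 = (3::nat)" by simp_all
    have "0 < lor (lcross (y 0) (y 1) + lcross (y 1) (y 2) + lcross (y 2) (y 3) + lcross (y 3) (y 0)) N"
      using A[of 0, unfolded nums] A[of 1, unfolded nums] A[of 2, unfolded nums] A[of 3, unfolded y4] by simp
    also have "\<dots> = 2 * mixed_area N w (primal_net F) (primal_net F)"
      unfolding lcross_diagonals[symmetric] mixed_area_def det_eq_lor_lcross y_def by simp
    finally show ?thesis by simp
  qed
  moreover have "lor N N = -1" using white(1)[OF ww] by (simp add: N_def)
  ultimately show "\<exists>N. lor N N = - 1 \<and>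
         (\<forall>k l. lor N (primal_net F (face_vertex w k) - primal_net F (face_vertex w l)) = 0 \<and>
                lor N ((1 - q) *\<^sub>R F (face_vertex w k) - primal_net F (face_vertex w k) - ((1 - q) *\<^sub>R F (face_vertex w l) - primal_net F (face_vertex w l))) = 0) \<and>
         mixed_area N w (primal_net F) (primal_net F) \<noteq> 0 \<and>
         1 = - mixed_area N w (primal_net F) (\<lambda>v. (1 - q) *\<^sub>R F v - primal_net F v) / mixed_area N w (primal_net F) (primal_net F)"
    by (intro exI[of _ N]) (simp add: mixed_area_diff mixed_area_scale C0 F0)
qed

text \<open>At q = 1 the value at a black vertex is the point of the pattern, and the edge leaves it
  on both sides along the tangent vector \<open>u\<close>.\<close>

lemma primal_koebe:
  assumes q1: "q = 1"
  shows "spacelike_koebe_surface G primal_surface"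
proof -
  have edge: "touches_unit_sphere_at (primal_net F v) (primal_net F v') (pt P b)"
      "t = pt P b" "pt P b \<in> sphere_points (primal_surface v) \<inter> sphere_points (primal_surface v')"
    if e: "s_edge G b v v'" and t: "t = pt P b \<or> touches_unit_sphere_at (primal_net F v) (primal_net F v') t" for b v v' t
  proof -
    note N = net_edge[OF C_eqs e]
    define u x d d' where "u = radial_dir G P v b" and "x = pt P b" and "d = vertex_rad q P v" and "d' = vertex_rad q P v'"
    have "\<not> white G b" using incident_lattice_edge(3)[OF G N(11)] .
    then have Cb: "primal_net F b = x" unfolding primal_net_def x_def using q1 by simp
    have c: "primal_net F v = x + d *\<^sub>R u" "primal_net F v' = x - d' *\<^sub>R u"
      using N(1,2) unfolding Cb by (simp_all add: u_def d_def d'_def algebra_simps)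
    have ux: "lor u u = 1" "lor u x = 0" "lor x u = 0" "lor x x = -1"
      using radial_dir[OF N(11)] incident_lor(1)[OF N(11)] lor_commute[of x u] by (simp_all add: u_def x_def)
    have dp: "0 < d" "0 < d'" using N(6,7) by (simp_all add: d_def d'_def)
    have seg: "x \<in> closed_segment (x + d *\<^sub>R u) (x - d' *\<^sub>R u)"
    proof -
      define s where "s = d / (d + d')"
      have "(1 - s) * d = s * d'" "0 \<le> s" "s \<le> 1" using dp by (simp_all add: s_def field_simps)
      moreover from this have "x = (1 - s) *\<^sub>R (x + d *\<^sub>R u) + s *\<^sub>R (x - d' *\<^sub>R u)"
        by (simp add: algebra_simps) (simp add: scaleR_add_left[symmetric] scaleR_diff_left[symmetric] algebra_simps)
      ultimately show ?thesis unfolding in_segment by blast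
    qed
    show "touches_unit_sphere_at (primal_net F v) (primal_net F v') (pt P b)"
      unfolding touches_unit_sphere_at_def c x_def[symmetric] using seg ux by simp
    show "t = pt P b"
      using t
    proof
      assume "touches_unit_sphere_at (primal_net F v) (primal_net F v') t"
      then obtain s where s: "t = (1 - s) *\<^sub>R (x + d *\<^sub>R u) + s *\<^sub>R (x - d' *\<^sub>R u)" and tt: "lor t t = -1"
        unfolding touches_unit_sphere_at_def c in_segment by blast
      define k where "k = (1 - s) * d - s * d'"
      have tk: "t = x + k *\<^sub>R u" unfolding s k_def by (simp add: vec3_eq_iff algebra_simps)
      \<comment> \<open>A spacelike tangent line meets the unit sphere only at the point of contact,
        so no other touching point exists.\<close>
      have "k * k = 0" using tt ux unfolding tk by (simp add: algebra_simps)
      then show ?thesis using tk by (simp add: x_def)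
    qed
    show "pt P b \<in> sphere_points (primal_surface v) \<inter> sphere_points (primal_surface v')"
      unfolding sphere_points_def signed_surface_def c x_def[symmetric] using ux edge_signsD(5)[OF \<tau>]
      by (simp add: c power_mult_distrib d_def d'_def) (simp add: power2_eq_square)
  qed
  have "s1_isothermic G primal_surface" using scaled_isothermic(1)[of 1] by (simp add: scale_map_1)
  moreover have "spacelike_koebe_net G (\<lambda>v. fst (primal_surface v))"
    unfolding spacelike_koebe_net_def signed_surface_def fst_conv using net_planar[OF C_eqs] edge(1) by blast
  moreover have "\<forall>b v v' t. s_edge G b v v' \<and> touches_unit_sphere_at (fst (primal_surface v)) (fst (primal_surface v')) t \<longrightarrow>
        t \<in> sphere_points (primal_surface v) \<inter> sphere_points (primal_surface v')"
    using edge(2,3) unfolding signed_surface_def fst_conv by metis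
  ultimately show ?thesis unfolding spacelike_koebe_surface_def by blast
qed

end

end

section \<open>Families of ring patterns\<close>

lemma tendsto_lcross:
  assumes "(f \<longlongrightarrow> a) F" "(g \<longlongrightarrow> b) F"
  shows "((\<lambda>x. lcross (f x) (g x)) \<longlongrightarrow> lcross a b) F"
proof (rule vec_tendstoI)
  fix i :: 3
  consider "i = 1" | "i = 2" | "i = 3" using exhaust_3[of i] by blast
  then show "((\<lambda>x. lcross (f x) (g x) $ i) \<longlongrightarrow> lcross a b $ i) F"
    by cases (auto intro!: tendsto_intros assms)
qed

lemma lorentz_frame_expansion:
  assumes "lor u u = 1" "lor x x = -1" "lor u x = 0"
  shows "z = - lor z x *\<^sub>R x + lor z u *\<^sub>R u + lor z (lcross u x) *\<^sub>R lcross u x"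
proof -
  define y where "y = lcross u x"
  have xu: "lor x u = 0" using assms(3) by (simp add: lor_commute)
  have "lor (lcross u x) y = 1" unfolding y_def using assms xu by (simp add: lor_lcross_lcross)
  moreover have "lcross x y = u" unfolding y_def using lcross_minus[of x "lcross u x"] lcross_lcross[of u x x] assms by simp
  moreover have "lcross u y = x" unfolding y_def using lcross_minus[of u "lcross u x"] lcross_lcross[of u x u] assms xu by simp
  ultimately have "lor u z *\<^sub>R u - lor x z *\<^sub>R x + lor y z *\<^sub>R y - z = 0"
    using four_vectors_dependent[of x y z u] by (simp add: y_def)
  then show ?thesis unfolding y_def[symmetric] by (simp add: lor_commute[of _ z] algebra_simps)
qed

text \<open>Complete both frames by \<open>lcross\<close> and map one orthonormal basis to the
  other; the common completion makes the determinant 1.\<close>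

lemma frame_motion:
  assumes f: "lor u u = 1" "lor x x = -1" "lor u x = 0" and f0: "lor u0 u0 = 1" "lor x0 x0 = -1" "lor u0 x0 = 0"
    and H: "x \<in> hyperbolic_plane" "x0 \<in> hyperbolic_plane"
  shows "\<exists>M. hyperbolic_motion M \<and> M *v x = x0 \<and> M *v u = u0"
proof -
  define y y0 where "y = lcross u x" and "y0 = lcross u0 x0"
  define g where "g z = - lor z x *\<^sub>R x0 + lor z u *\<^sub>R u0 + lor z y *\<^sub>R y0" for z
  have lin: "linear g" by (rule linearI) (simp_all add: g_def algebra_simps)
  define M where "M = matrix g"
  have M: "M *v z = g z" for z unfolding M_def by (rule fun_cong[OF matrix_vector_mul(2)[OF lin]])
  have c: "lor x u = 0" "lor x0 u0 = 0" using f f0 by (simp_all add: lor_commute)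
  have y: "lor y y = 1" "lor y x = 0" "lor y u = 0" "lor x y = 0" "lor u y = 0"
    and y0: "lor y0 y0 = 1" "lor y0 x0 = 0" "lor y0 u0 = 0" "lor x0 y0 = 0" "lor u0 y0 = 0"
    unfolding y_def y0_def using f f0 c by (simp_all add: lor_lcross_lcross)
  have Mx: "M *v x = x0" "M *v u = u0" "M *v y = y0" unfolding M g_def using f c y by simp_all
  have iso: "lor (M *v z) (M *v w) = lor z w" for z w
  proof -
    have "lor (M *v z) (M *v w) = - (lor z x * lor w x) + lor z u * lor w u + lor z y * lor w y"
      unfolding M g_def using f0 c y0 by (simp add: algebra_simps)
    also have "\<dots> = lor z w"
      by (subst (3) lorentz_frame_expansion[OF f, of w], fold y_def) (simp add: algebra_simps)
    finally show ?thesis .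
  qed
  have "lor (lcross x u) y = -1" "lor (lcross x0 u0) y0 = -1"
    unfolding lcross_minus[of x u] lcross_minus[of x0 u0] y_def[symmetric] y0_def[symmetric] using y y0 by simp_all
  then have "det M = 1"
    using det_vector_matrix_mult[of M x u y] unfolding Mx det_eq_lor_lcross by simp
  \<comment> \<open>The product of \<open>M *v z\<close> with \<open>x0\<close> equals that of
    \<open>z\<close> with \<open>x\<close> and is at most -1; on the lower sheet it would be at
    least 1.\<close>
  moreover have "M *v z \<in> hyperbolic_plane" if z: "z \<in> hyperbolic_plane" for z
  proof -
    have l: "lor (M *v z) (M *v z) = -1" using z iso by (simp add: hyperbolic_plane_def)
    have "lor (M *v z) x0 = lor z x" using iso[of z x] Mx by simp
    then have le: "lor (M *v z) x0 \<le> -1" using hyperbolic_plane_lor_le[OF z H(1)] by simp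
    have "0 < (M *v z) $ 3"
    proof (rule ccontr)
      assume "\<not> 0 < (M *v z) $ 3"
      moreover have "(M *v z) $ 3 \<noteq> 0"
      proof
        assume "(M *v z) $ 3 = 0"
        then have "lor (M *v z) (M *v z) \<ge> 0" by (simp add: lor_def)
        then show False using l by simp
      qed
      ultimately have "- (M *v z) \<in> hyperbolic_plane" using l by (simp add: hyperbolic_plane_def)
      then show False using hyperbolic_plane_lor_le[OF _ H(2)] le by fastforce
    qed
    then show ?thesis using l by (simp add: hyperbolic_plane_def)
  qed
  ultimately have "hyperbolic_motion M" using iso by (simp add: hyperbolic_motion_def)
  then show ?thesis using Mx by blast
qed

lemma hyperbolic_motion_1: "hyperbolic_motion (mat 1)"
  by (simp add: hyperbolic_motion_def)

text \<open>The sign of \<open>sn\<close> is read off from the positive number cosh R; everything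
  else is algebra.\<close>

lemma ring_variables_facts:
  assumes V: "ring_variables G q P \<gamma>" and q: "0 < q" and v: "v \<in> white_vertices G"
    and c: "q * cosh (outer_rad P v) = cosh (inner_rad P v)"
  shows "0 < jacobi_sn (\<gamma> v) q" "cosh (outer_rad P v) = 1 / (q * jacobi_sn (\<gamma> v) q)"
    "sinh (outer_rad P v) = jacobi_dn (\<gamma> v) q / (q * jacobi_sn (\<gamma> v) q)"
    "cosh (inner_rad P v) = 1 / jacobi_sn (\<gamma> v) q" "sinh (inner_rad P v) = jacobi_cn (\<gamma> v) q / jacobi_sn (\<gamma> v) q"
    "tanh (outer_rad P v) = jacobi_dn (\<gamma> v) q" "tanh (inner_rad P v) = jacobi_cn (\<gamma> v) q"
proof -
  have *: "cosh (outer_rad P v) = 1 / (q * jacobi_sn (\<gamma> v) q)" "tanh (outer_rad P v) = jacobi_dn (\<gamma> v) q"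
    "sinh (inner_rad P v) = jacobi_cn (\<gamma> v) q / jacobi_sn (\<gamma> v) q"
    using V v unfolding ring_variables_def by blast+
  then show "cosh (outer_rad P v) = 1 / (q * jacobi_sn (\<gamma> v) q)" "tanh (outer_rad P v) = jacobi_dn (\<gamma> v) q"
    "sinh (inner_rad P v) = jacobi_cn (\<gamma> v) q / jacobi_sn (\<gamma> v) q" by simp_all
  have "0 < 1 / (q * jacobi_sn (\<gamma> v) q)" unfolding *(1)[symmetric] by (rule cosh_real_pos)
  then show s: "0 < jacobi_sn (\<gamma> v) q" using q by (simp add: zero_less_mult_iff)
  show i: "cosh (inner_rad P v) = 1 / jacobi_sn (\<gamma> v) q"
    unfolding c[symmetric] *(1) using q by simp
  have "sinh (outer_rad P v) = tanh (outer_rad P v) * cosh (outer_rad P v)" by (simp add: tanh_def)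
  then show "sinh (outer_rad P v) = jacobi_dn (\<gamma> v) q / (q * jacobi_sn (\<gamma> v) q)" unfolding * by simp
  show "tanh (inner_rad P v) = jacobi_cn (\<gamma> v) q" unfolding tanh_def i *(3) using s by simp
qed

text \<open>From q cosh R = cosh r follows (q sinh R)^2 = sinh^2 r + (1 - q^2), so for q < 1 the
  outer term dominates whatever the sign of r.\<close>

lemma ring_pattern_geometry:
  assumes G: "s_quad_graph G" and P: "ring_pattern G q P"
    and pos: "q < 1 \<or> (\<forall>v \<in> white_vertices G. 0 < inner_rad P v)"
  shows "ring_geometry G q P"
proof
  show "s_quad_graph G" by (rule G)
  show L: "lorentz_pattern G q P" by (rule ring_pattern_lorentz_pattern[OF G P])
  fix v assume v: "v \<in> white_vertices G"
  have q: "0 < q" "q \<le> 1" using P by (auto simp: ring_pattern_def)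
  have w: "0 < outer_rad P v" "q * cosh (outer_rad P v) = cosh (inner_rad P v)"
    using P v unfolding ring_pattern_def by blast+
  show "0 < q * sinh (outer_rad P v) + sinh (inner_rad P v)"
    using pos
  proof
    assume q1: "q < 1"
    have "(q * sinh (outer_rad P v))\<^sup>2 = (q * cosh (outer_rad P v))\<^sup>2 - q\<^sup>2"
      by (simp add: power_mult_distrib cosh_square_eq algebra_simps)
    also have "\<dots> = (sinh (inner_rad P v))\<^sup>2 + (1 - q\<^sup>2)" unfolding w(2) by (simp add: cosh_square_eq)
    finally have "(sinh (inner_rad P v))\<^sup>2 < (q * sinh (outer_rad P v))\<^sup>2" using q q1 by (simp add: abs_square_less_1)
    then have sq: "\<bar>sinh (inner_rad P v)\<bar>\<^sup>2 < (q * sinh (outer_rad P v))\<^sup>2" unfolding power2_abs .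
    have "0 \<le> q * sinh (outer_rad P v)" using q w by simp
    with sq have "\<bar>sinh (inner_rad P v)\<bar> < q * sinh (outer_rad P v)" by (rule power2_less_imp_less)
    then show ?thesis by linarith
  next
    assume "\<forall>v \<in> white_vertices G. 0 < inner_rad P v"
    then show ?thesis using v w q by (simp add: add_pos_pos)
  qed
qed

lemma ring_geometry_move:
  assumes "ring_geometry G q P" "hyperbolic_motion M"
  shows "ring_geometry G q (move_pattern M P)"
proof -
  interpret ring_geometry G q P by fact
  show ?thesis
  proof
    show "s_quad_graph G" by (rule G)
    show "lorentz_pattern G q (move_pattern M P)" by (rule lorentz_pattern_move[OF P assms(2)])
    show "0 < q * sinh (outer_rad (move_pattern M P) v) + sinh (inner_rad (move_pattern M P) v)" if "v \<in> white_vertices G" for v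
      using positive[OF that] by (simp add: move_pattern_def)
  qed
qed

text \<open>Only increments are prescribed. Fixing the value at one vertex is the translation under
  which the surfaces converge.\<close>

lemma dual_net_normalized:
  assumes "ring_geometry G q P"
  shows "\<exists>F. dual_net G q P F \<and> F v0 = 0"
proof -
  obtain F where F: "dual_net G q P F" using ring_geometry.dual_net_exists[OF assms] by blast
  then have "dual_net G q P (\<lambda>x. F x - F v0)" unfolding dual_net_def by simp
  then show ?thesis by (intro exI[of _ "\<lambda>x. F x - F v0"]) simp
qed

section \<open>Convergence of patterns and nets\<close>

locale pattern_family =
  fixes G :: lattice_graph and Q :: "real \<Rightarrow> ring_data" and Q0 :: ring_data
  assumes fam: "\<forall>\<^sub>F \<epsilon> in at_right 0. ring_geometry G (1 - \<epsilon>) (Q \<epsilon>)" and lim: "ring_geometry G 1 Q0"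
    and radii: "\<And>v. v \<in> white_vertices G \<Longrightarrow> ((\<lambda>\<epsilon>. cosh (inner_rad (Q \<epsilon>) v)) \<longlongrightarrow> cosh (inner_rad Q0 v)) (at_right 0)"
      "\<And>v. v \<in> white_vertices G \<Longrightarrow> ((\<lambda>\<epsilon>. sinh (inner_rad (Q \<epsilon>) v)) \<longlongrightarrow> sinh (inner_rad Q0 v)) (at_right 0)"
      "\<And>v. v \<in> white_vertices G \<Longrightarrow> ((\<lambda>\<epsilon>. cosh (outer_rad (Q \<epsilon>) v)) \<longlongrightarrow> cosh (outer_rad Q0 v)) (at_right 0)"
      "\<And>v. v \<in> white_vertices G \<Longrightarrow> ((\<lambda>\<epsilon>. sinh (outer_rad (Q \<epsilon>) v)) \<longlongrightarrow> sinh (outer_rad Q0 v)) (at_right 0)"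
begin

interpretation lim: ring_geometry G 1 Q0 by (rule lim)

lemmas G = lim.G

abbreviation "ctr_conv v \<equiv> ((\<lambda>\<epsilon>. ctr (Q \<epsilon>) v) \<longlongrightarrow> ctr Q0 v) (at_right 0)"
abbreviation "pt_conv b \<equiv> ((\<lambda>\<epsilon>. pt (Q \<epsilon>) b) \<longlongrightarrow> pt Q0 b) (at_right 0)"

lemma ring_tendsto:
  assumes "incident G v b"
  shows "((\<lambda>\<epsilon>. ring_cosh G (Q \<epsilon>) v b) \<longlongrightarrow> ring_cosh G Q0 v b) (at_right 0)"
    "((\<lambda>\<epsilon>. ring_sinh G (Q \<epsilon>) v b) \<longlongrightarrow> ring_sinh G Q0 v b) (at_right 0)"
  using radii[OF incident_lattice_edge(4)[OF G assms]] by (simp_all add: ring_cosh_def ring_sinh_def)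

lemma radial_dir_tendsto:
  assumes "incident G v b" "ctr_conv v" "pt_conv b"
  shows "((\<lambda>\<epsilon>. radial_dir G (Q \<epsilon>) v b) \<longlongrightarrow> radial_dir G Q0 v b) (at_right 0)"
    "((\<lambda>\<epsilon>. face_dir G (Q \<epsilon>) v b) \<longlongrightarrow> face_dir G Q0 v b) (at_right 0)"
  unfolding radial_dir_def face_dir_def
  by (intro tendsto_intros assms ring_tendsto[OF assms(1)] lim.ring_cosh_sinh(1)[OF assms(1)])+

lemma ctr_convI:
  assumes i: "incident G v b" and "pt_conv b" and u: "((\<lambda>\<epsilon>. radial_dir G (Q \<epsilon>) v b) \<longlongrightarrow> radial_dir G Q0 v b) (at_right 0)"
  shows "ctr_conv v"
proof (rule Lim_transform_eventually)
  show "((\<lambda>\<epsilon>. ring_cosh G (Q \<epsilon>) v b *\<^sub>R pt (Q \<epsilon>) b + ring_sinh G (Q \<epsilon>) v b *\<^sub>R radial_dir G (Q \<epsilon>) v b) \<longlongrightarrow> ctr Q0 v) (at_right 0)"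
    unfolding lim.radial_dir(3)[OF i] by (intro tendsto_intros assms ring_tendsto[OF i])
  show "\<forall>\<^sub>F \<epsilon> in at_right 0. ring_cosh G (Q \<epsilon>) v b *\<^sub>R pt (Q \<epsilon>) b + ring_sinh G (Q \<epsilon>) v b *\<^sub>R radial_dir G (Q \<epsilon>) v b = ctr (Q \<epsilon>) v"
    using fam by eventually_elim (simp add: ring_geometry.radial_dir(3)[OF _ i, symmetric])
qed

text \<open>The quarter turn at \<open>b\<close> carries the radial direction of one ring to that of
  the other; with the point and the radius it determines the other centre continuously.\<close>

lemma quad_ctr_conv:
  assumes quad: "quad G v b v' b'" and b: "pt_conv b"
  shows "ctr_conv v \<Longrightarrow> ctr_conv v'" "ctr_conv v' \<Longrightarrow> ctr_conv v"
proof -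
  have i: "incident G v b" "incident G v' b" using quad_facts[OF G quad] by simp_all
  show "ctr_conv v'" if v: "ctr_conv v"
  proof (rule ctr_convI[OF i(2) b], rule Lim_transform_eventually)
    show "((\<lambda>\<epsilon>. lcross (radial_dir G (Q \<epsilon>) v b) (pt (Q \<epsilon>) b)) \<longlongrightarrow> radial_dir G Q0 v' b) (at_right 0)"
      unfolding lim.quad_dirs(3)[OF quad] by (intro tendsto_lcross radial_dir_tendsto i b v)
    show "\<forall>\<^sub>F \<epsilon> in at_right 0. lcross (radial_dir G (Q \<epsilon>) v b) (pt (Q \<epsilon>) b) = radial_dir G (Q \<epsilon>) v' b"
      using fam by eventually_elim (simp add: ring_geometry.quad_dirs(3)[OF _ quad])
  qed
  have reversed: "radial_dir G R v b = - lcross (radial_dir G R v' b) (pt R b)" if "ring_geometry G q R" for q R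
  proof -
    interpret R: ring_geometry G q R by fact
    show ?thesis
      unfolding R.quad_dirs(3)[OF quad] lcross_lcross using R.quad_dirs(1)[OF quad] R.incident_lor(1)[OF i(1)] by simp
  qed
  show "ctr_conv v" if v': "ctr_conv v'"
  proof (rule ctr_convI[OF i(1) b], rule Lim_transform_eventually)
    show "((\<lambda>\<epsilon>. - lcross (radial_dir G (Q \<epsilon>) v' b) (pt (Q \<epsilon>) b)) \<longlongrightarrow> radial_dir G Q0 v b) (at_right 0)"
      unfolding reversed[OF lim] by (intro tendsto_minus tendsto_lcross radial_dir_tendsto i b v')
    show "\<forall>\<^sub>F \<epsilon> in at_right 0. - lcross (radial_dir G (Q \<epsilon>) v' b) (pt (Q \<epsilon>) b) = radial_dir G (Q \<epsilon>) v b"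
      using fam by eventually_elim (rule reversed[symmetric])
  qed
qed

text \<open>The last equation of \<open>right_angle_frame\<close> solves for the point; its
  coefficient \<open>D\<close> is positive also at the limit.\<close>

lemma quad_pt_conv:
  assumes quad: "quad G v b v' b'" and v: "ctr_conv v" "ctr_conv v'"
  shows "pt_conv b"
proof -
  have i: "incident G v b" "incident G v' b" using quad_facts[OF G quad] by simp_all
  define D where "D R = (ring_cosh G R v b)\<^sup>2 * (ring_sinh G R v' b)\<^sup>2 + (ring_sinh G R v b)\<^sup>2" for R
  have D: "D R \<noteq> 0" if "ring_geometry G q R" for q R
  proof -
    have "0 < (ring_sinh G R v b)\<^sup>2" using ring_geometry.ring_cosh_sinh(1)[OF that i(1)] by simp
    then have "0 < D R" unfolding D_def by (simp add: add_nonneg_pos)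
    then show ?thesis by simp
  qed
  define X where "X R = (1 / D R) *\<^sub>R ((ring_cosh G R v b * (ring_sinh G R v' b)\<^sup>2) *\<^sub>R ctr R v + (ring_cosh G R v' b * (ring_sinh G R v b)\<^sup>2) *\<^sub>R ctr R v'
      - (ring_sinh G R v b * ring_sinh G R v' b) *\<^sub>R lcross (ctr R v) (ctr R v'))" for R
  have X: "X R = pt R b" if "ring_geometry G q R" for q R
    unfolding X_def ring_geometry.quad_dirs(4)[OF that quad, symmetric] D_def[symmetric] using D[OF that] by simp
  show ?thesis
  proof (rule Lim_transform_eventually)
    show "((\<lambda>\<epsilon>. X (Q \<epsilon>)) \<longlongrightarrow> pt Q0 b) (at_right 0)"
      unfolding X[OF lim, symmetric] unfolding X_def D_def
      by (intro tendsto_intros tendsto_lcross v ring_tendsto i D[OF lim, unfolded D_def])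
    show "\<forall>\<^sub>F \<epsilon> in at_right 0. X (Q \<epsilon>) = pt (Q \<epsilon>) b"
      using fam by eventually_elim (rule X)
  qed
qed

text \<open>One centre and one point on its ring determine the remaining corners of their square,
  and a side shared with the next square again consists of a centre and a point.\<close>

lemma all_conv:
  assumes start: "incident G v0 b0" "ctr_conv v0" "pt_conv b0"
    and "incident G v b"
  shows "ctr_conv v" "pt_conv b"
proof -
  define cv where "cv x \<longleftrightarrow> (if white G x then ctr_conv x else pt_conv x)" for x
  have quad_all: "cv v \<and> cv b \<and> cv v' \<and> cv b'" if quad: "quad G v b v' b'" and "cv v" "cv b \<or> cv b'" for v b v' b'
  proof -
    note f = quad_facts[OF G quad] and quad' = quad_swap[OF G quad]
    have v: "ctr_conv v" using that(2) f by (simp add: cv_def)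
    have "pt_conv b \<or> pt_conv b'" using that(3) f by (simp add: cv_def)
    then have v': "ctr_conv v'" using quad_ctr_conv(1)[OF quad _ v] quad_ctr_conv(2)[OF quad' _ v] by blast
    show ?thesis using v v' quad_pt_conv[OF quad v v'] quad_pt_conv[OF quad' v' v] f by (simp add: cv_def)
  qed
  have square: "\<forall>n. cv (corner S n)" if S: "S \<in> squares G" "cv (corner S k)" "cv (corner S (k + 1))" for S k
  proof -
    have "\<exists>m. \<forall>i \<in> {0, 1, 2, 3}. cv (corner S (m + i))"
    proof (cases "white G (corner S k)")
      case True
      then show ?thesis using quad_all[OF square_quad[OF S(1) True]] S by (intro exI[of _ k]) simp
    next
      case False
      then have w: "white G (corner S (k + 1))" using white_corner_alternates[OF G S(1)] by blast
      have e: "k + 1 + 3 = k + 4" by simp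
      have "cv (corner S (k + 1 + 3))" unfolding e corner_add_4 by (rule S(2))
      then show ?thesis using quad_all[OF square_quad[OF S(1) w] S(3)] by (intro exI[of _ "k + 1"]) simp
    qed
    then obtain m where "\<forall>i \<in> {0, 1, 2, 3}. cv (corner S (m + i))" by blast
    then have m: "cv (corner S m)" "cv (corner S (m + 1))" "cv (corner S (m + 2))" "cv (corner S (m + 3))" by simp_all
    show ?thesis
    proof
      fix n
      show "cv (corner S n)" by (cases rule: corner_index[of S n m]) (use m in simp_all)
    qed
  qed
  obtain S0 k0 where S0: "S0 \<in> squares G" "{v0, b0} = {corner S0 k0, corner S0 (k0 + 1)}"
    using incident_lattice_edge(1)[OF G start(1)] unfolding lattice_edge_def by blast
  have "cv v0" "cv b0" using start incident_lattice_edge[OF G start(1)] by (simp_all add: cv_def)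
  then have "cv (corner S0 k0)" "cv (corner S0 (k0 + 1))" using S0(2) by (metis doubleton_eq_iff)+
  then have base: "\<forall>n. cv (corner S0 n)" by (rule square[OF S0(1)])
  have all: "\<forall>n. cv (corner S n)" if "S \<in> squares G" for S
    using G S0(1) that
  proof (induction rule: s_quad_graph_square_induct)
    case start
    show ?case by (rule base)
  next
    case (step A B)
    then show ?case using square[of B] side_adjacent_common_edge[of A B] by metis
  qed
  have "cv v" "cv b"
    using incident_lattice_edge(1)[OF G assms(4)] all unfolding lattice_edge_def by blast+
  then show "ctr_conv v" "pt_conv b" using incident_lattice_edge[OF G assms(4)] by (simp_all add: cv_def)
qed

lemma rad_tendsto:
  assumes "v \<in> white_vertices G"
  shows "((\<lambda>\<epsilon>. vertex_rad (1 - \<epsilon>) (Q \<epsilon>) v) \<longlongrightarrow> vertex_rad 1 Q0 v) (at_right 0)"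
    "((\<lambda>\<epsilon>. face_rad (1 - \<epsilon>) (Q \<epsilon>) v) \<longlongrightarrow> face_rad 1 Q0 v) (at_right 0)"
proof -
  have q: "((\<lambda>\<epsilon>::real. 1 - \<epsilon>) \<longlongrightarrow> 1) (at_right 0)" by (auto intro!: tendsto_eq_intros)
  have s: "((\<lambda>\<epsilon>::real. 2 * sqrt (1 - \<epsilon>)) \<longlongrightarrow> 2 * sqrt 1) (at_right 0)" by (intro tendsto_intros q)
  note r = radii[OF assms]
  show "((\<lambda>\<epsilon>. vertex_rad (1 - \<epsilon>) (Q \<epsilon>) v) \<longlongrightarrow> vertex_rad 1 Q0 v) (at_right 0)"
    unfolding vertex_rad_def tanh_def by (intro tendsto_divide tendsto_add tendsto_mult r q s) simp_all
  show "((\<lambda>\<epsilon>. face_rad (1 - \<epsilon>) (Q \<epsilon>) v) \<longlongrightarrow> face_rad 1 Q0 v) (at_right 0)"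
    unfolding face_rad_def by (intro tendsto_divide tendsto_add tendsto_mult r q s) simp_all
qed

lemma dual_factor_tendsto: "((\<lambda>\<epsilon>. dual_factor (1 - \<epsilon>)) \<longlongrightarrow> dual_factor 1) (at_right 0)"
  unfolding dual_factor_def by (auto intro!: tendsto_eq_intros)

text \<open>The increments depend continuously on the pattern, with denominators whose limits are
  nonzero; connectedness carries the convergence from \<open>v0\<close> to all vertices.\<close>

lemma dual_net_tendsto:
  assumes F: "\<forall>\<^sub>F \<epsilon> in at_right 0. dual_net G (1 - \<epsilon>) (Q \<epsilon>) (F \<epsilon>)" and F0: "dual_net G 1 Q0 F0"
    and v0: "incident G v0 b0" "((\<lambda>\<epsilon>. F \<epsilon> v0) \<longlongrightarrow> F0 v0) (at_right 0)"
    and conv: "\<And>v b. incident G v b \<Longrightarrow> ctr_conv v \<and> pt_conv b"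
    and i: "incident G v b"
  shows "((\<lambda>\<epsilon>. F \<epsilon> v) \<longlongrightarrow> F0 v) (at_right 0)"
proof (rule incident_induct[OF G v0(1) i])
  show "((\<lambda>\<epsilon>. F \<epsilon> v0) \<longlongrightarrow> F0 v0) (at_right 0)" by (rule v0(2))
  fix v b assume i: "incident G v b"
  define \<theta> where "\<theta> q R = (edge_sign G b * dual_factor q) *\<^sub>R
       (if svert G v then - (1 / vertex_rad q R v) *\<^sub>R radial_dir G R v b else (1 / face_rad q R v) *\<^sub>R face_dir G R v b)" for q R
  have w: "v \<in> white_vertices G" using incident_lattice_edge(4)[OF G i] .
  have nz: "vertex_rad 1 Q0 v \<noteq> 0" "face_rad 1 Q0 v \<noteq> 0" using lim.white(5,6)[OF w] by simp_all
  have cvb: "ctr_conv v" "pt_conv b" using conv[OF i] by blast+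
  have \<theta>_lim: "((\<lambda>\<epsilon>. \<theta> (1 - \<epsilon>) (Q \<epsilon>)) \<longlongrightarrow> \<theta> 1 Q0) (at_right 0)"
    unfolding \<theta>_def
    by (cases "svert G v") (auto intro!: tendsto_intros dual_factor_tendsto rad_tendsto[OF w] nz radial_dir_tendsto[OF i cvb])
  have ev: "\<forall>\<^sub>F \<epsilon> in at_right 0. F \<epsilon> b - F \<epsilon> v = \<theta> (1 - \<epsilon>) (Q \<epsilon>)"
    using F by (rule eventually_mono) (use i in \<open>unfold dual_net_def \<theta>_def, blast\<close>)
  have e0: "F0 b - F0 v = \<theta> 1 Q0" using F0 i unfolding dual_net_def \<theta>_def by blast
  have diff: "((\<lambda>\<epsilon>. F \<epsilon> b - F \<epsilon> v) \<longlongrightarrow> F0 b - F0 v) (at_right 0)"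
    unfolding e0 by (rule Lim_transform_eventually[OF \<theta>_lim]) (use ev in \<open>auto elim: eventually_mono\<close>)
  show "((\<lambda>\<epsilon>. F \<epsilon> v) \<longlongrightarrow> F0 v) (at_right 0) \<longleftrightarrow> ((\<lambda>\<epsilon>. F \<epsilon> b) \<longlongrightarrow> F0 b) (at_right 0)"
    using tendsto_add[OF _ diff, of "\<lambda>\<epsilon>. F \<epsilon> v" "F0 v"] tendsto_diff[OF _ diff, of "\<lambda>\<epsilon>. F \<epsilon> b" "F0 b"] by auto
qed

end

text \<open>Arbitrary normalizing motions give convergence of centres only; the points follow quad
  by quad.\<close>

lemma (in pattern_family) pt_conv_if_ctr_conv:
  assumes ctr: "\<And>v. v \<in> white_vertices G \<Longrightarrow> ctr_conv v" and i: "incident G v b"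
  shows "ctr_conv v \<and> pt_conv b"
  using G i
proof (cases rule: incident_quad)
  case (1 v' b')
  then show ?thesis using quad_pt_conv[OF 1(1)] quad_facts(5,6)[OF G 1(1)] ctr by blast
next
  case (2 v' b')
  then show ?thesis using quad_pt_conv[OF 2(2)] quad_facts(5,6)[OF G 2(2)] ctr by blast
qed

lemma (in pattern_family) signed_surface_tendsto:
  assumes "((\<lambda>\<epsilon>. X \<epsilon> v) \<longlongrightarrow> X0 v) (at_right 0)" "((\<lambda>\<epsilon>. g \<epsilon> v) \<longlongrightarrow> g0 v) (at_right 0)"
  shows "((\<lambda>\<epsilon>. signed_surface (X \<epsilon>) \<tau> (g \<epsilon>) v) \<longlongrightarrow> signed_surface X0 \<tau> g0 v) (at_right 0)"
  unfolding signed_surface_def by (intro tendsto_intros assms)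

section \<open>The associated pairs and the limit\<close>

lemma associated_pair:
  assumes RG: "ring_geometry G q P" and q1: "q < 1" and F: "dual_net G q P F" and \<tau>: "edge_signs G \<tau>"
    and V: "ring_variables G q P' \<gamma>" and P': "outer_rad P' = outer_rad P" "inner_rad P' = inner_rad P"
  defines "s \<equiv> signed_surface (ring_geometry.primal_net G q P F) \<tau> (vertex_rad q P)"
    and "t \<equiv> signed_surface F \<tau> (ring_geometry.dual_rad q P)"
  shows "associated_cmc_pair G q P \<gamma> s (scale_map (1 - q) t)"
    and "s1_cmc_pair G (scale_map (1 / (1 - q)) s) (scale_map (1 / (1 - q)) (scale_map (1 - q) t))"
    and "has_mean_curvature G (\<lambda>v. fst (scale_map (1 / (1 - q)) s v)) (gauss_map s (scale_map (1 - q) t)) (1 - q)"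
proof -
  interpret ring_geometry G q P by fact
  let ?e = "1 - q"
  have e: "0 < ?e" using q1 by simp
  have s: "s = signed_surface (primal_net F) \<tau> (vertex_rad q P)" and t: "t = signed_surface F \<tau> dual_rad"
    by (simp_all add: s_def t_def)
  have pos: "cmc_position G s (scale_map ?e t)"
    unfolding s t by (rule primal_cmc_position[OF F \<tau> q1])
  have pair: "s1_cmc_pair G (scale_map \<mu> s) (scale_map \<mu> (scale_map ?e t))" if \<mu>: "0 < \<mu>" for \<mu>
    unfolding s1_cmc_pair_def
  proof (intro conjI)
    have me: "0 < \<mu> * ?e" using \<mu> e by simp
    show "s1_isothermic G (scale_map \<mu> s)" unfolding s by (rule scaled_isothermic(1)[OF F \<tau> \<mu>])
    show "s1_isothermic G (scale_map \<mu> (scale_map ?e t))" unfolding t scale_map_scale_map by (rule scaled_isothermic(2)[OF F \<tau> me])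
    show "christoffel_dual G (scale_map \<mu> s) (scale_map \<mu> (scale_map ?e t))"
      unfolding s t scale_map_scale_map by (rule scaled_dual(1)[OF F \<tau> \<mu> me])
    have "cmc_position G (scale_map \<mu> s) (scale_map \<mu> (scale_map ?e t))"
      using cmc_position_scale[OF _ pos] \<mu> by simp
    then have "cmc_position G (scale_map \<mu> s) (translate_map 0 (scale_map 1 (scale_map \<mu> (scale_map ?e t))))"
      by (simp add: scale_map_1 translate_map_def)
    then show "\<exists>\<nu>>0. \<exists>\<tau>. cmc_position G (scale_map \<mu> s) (translate_map \<tau> (scale_map \<nu> (scale_map \<mu> (scale_map ?e t))))"
      using zero_less_one by blast
  qed
  have gm: "gauss_map s (scale_map ?e t) = (\<lambda>v. ?e *\<^sub>R F v - primal_net F v)"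
    by (simp add: gauss_map_def s t signed_surface_def scale_map_apply)
  have H: "has_mean_curvature G (\<lambda>v. fst (s v)) (gauss_map s (scale_map ?e t)) 1"
    unfolding gm using primal_mean_curvature[OF F \<tau>] by (simp add: s signed_surface_def)
  show "s1_cmc_pair G (scale_map (1 / ?e) s) (scale_map (1 / ?e) (scale_map ?e t))"
    using pair[of "1 / ?e"] e by simp
  show "has_mean_curvature G (\<lambda>v. fst (scale_map (1 / ?e) s v)) (gauss_map s (scale_map ?e t)) ?e"
    using has_mean_curvature_scale[OF _ H, of "1 / ?e"] e by (simp add: scale_map_apply)
  show "associated_cmc_pair G q P \<gamma> s (scale_map ?e t)"
    unfolding associated_cmc_pair_def
  proof (intro conjI ballI)
    show "s1_cmc_pair G s (scale_map ?e t)" using pair[of 1] by (simp add: scale_map_1)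
    show "cmc_position G s (scale_map ?e t)" by (rule pos)
    show "has_mean_curvature G (\<lambda>v. fst (s v)) (gauss_map s (scale_map ?e t)) 1" by (rule H)
    have "fst (s v) - fst (scale_map ?e t v) = (1 * sqrt q / cosh (inner_rad P v)) *\<^sub>R ctr P v" if "v \<in> s_vertices G" for v
      using primal_minus_dual[OF F \<tau> that] by (simp add: s t signed_surface_def scale_map_apply)
    then show "\<exists>\<sigma>\<in>{1, - 1}. \<forall>v\<in>s_vertices G. fst (s v) - fst (scale_map ?e t v) = (\<sigma> * sqrt q / cosh (inner_rad P v)) *\<^sub>R ctr P v"
      by blast
    fix v assume v: "v \<in> s_vertices G"
    then have w: "v \<in> white_vertices G" by (simp add: s_vertices_def)
    have c: "q * cosh (outer_rad P' v) = cosh (inner_rad P' v)" using white(4)[OF w] P' by simp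
    have T: "tanh (outer_rad P v) = jacobi_dn (\<gamma> v) q" "tanh (inner_rad P v) = jacobi_cn (\<gamma> v) q"
      using ring_variables_facts(6,7)[OF V q(1) w c] P' by simp_all
    have r: "0 < vertex_rad q P v" "0 < dual_rad v" using rads_pos[OF F \<tau> v] by simp_all
    have "\<bar>snd (s v)\<bar> = vertex_rad q P v"
      using r edge_signsD(4)[OF \<tau>] by (simp add: s signed_surface_def abs_mult)
    then show "\<bar>snd (s v)\<bar> = (jacobi_dn (\<gamma> v) q + q * jacobi_cn (\<gamma> v) q) / (2 * sqrt q)"
      by (simp add: vertex_rad_def T)
    have "\<bar>snd (scale_map ?e t v)\<bar> = ?e * dual_rad v"
      using r e edge_signsD(4)[OF \<tau>] by (simp add: t signed_surface_def scale_map_apply abs_mult)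
    then show "\<bar>snd (scale_map ?e t v)\<bar> = (jacobi_dn (\<gamma> v) q - q * jacobi_cn (\<gamma> v) q) / (2 * sqrt q)"
      using dual_radii(1)[OF w] by (simp add: dual_rad_def T)
  qed
qed

theorem theorem13p2:
  fixes G :: lattice_graph
    and P :: "real \<Rightarrow> ring_data" and \<gamma> :: "real \<Rightarrow> lattice_point \<Rightarrow> real"
    and P0 :: ring_data and \<gamma>0 :: "lattice_point \<Rightarrow> real"
    and \<epsilon>0 :: real
  assumes "s_quad_graph G"
    and "0 < \<epsilon>0" and "\<epsilon>0 \<le> 1"
    and "\<forall>\<epsilon> \<in> {0<..<\<epsilon>0}. ring_pattern G (1 - \<epsilon>) (P \<epsilon>) \<and> ring_variables G (1 - \<epsilon>) (P \<epsilon>) (\<gamma> \<epsilon>)"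
    and "fixed_boundary_conditions G {0<..<\<epsilon>0} P \<gamma>"
    and "ring_pattern G 1 P0" and "ring_variables G 1 P0 \<gamma>0"
    and "\<forall>v \<in> white_vertices G. ((\<lambda>\<epsilon>. \<gamma> \<epsilon> v) \<longlongrightarrow> \<gamma>0 v) (at_right 0)"
  shows "(\<exists>M. normalizing_motions G P P0 M) \<and>
    (\<forall>M. normalizing_motions G P P0 M \<longrightarrow>
      (\<exists>s s'.
        (\<forall>\<epsilon> \<in> {0<..<\<epsilon>0}.
          associated_cmc_pair G (1 - \<epsilon>) (move_pattern (M \<epsilon>) (P \<epsilon>)) (\<gamma> \<epsilon>) (s \<epsilon>) (s' \<epsilon>) \<and>
          s1_cmc_pair G (scale_map (1 / \<epsilon>) (s \<epsilon>)) (scale_map (1 / \<epsilon>) (s' \<epsilon>)) \<and>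
          has_mean_curvature G (\<lambda>v. fst (scale_map (1 / \<epsilon>) (s \<epsilon>) v)) (gauss_map (s \<epsilon>) (s' \<epsilon>)) \<epsilon>) \<and>
        (\<exists>s0 s0'.
          surfaces_converge G s s0 \<and> spacelike_koebe_surface G s0 \<and>
          surfaces_converge G (\<lambda>\<epsilon>. scale_map (1 / \<epsilon>) (s' \<epsilon>)) s0' \<and>
          christoffel_dual G s0 s0' \<and> s1_maximal G s0')))"
proof -
  note G = assms(1)
  define E where "E = {0<..<\<epsilon>0}"
  have E: "0 < \<epsilon>" "\<epsilon> < 1" if "\<epsilon> \<in> E" for \<epsilon> using that assms(3) by (auto simp: E_def)
  have evE: "\<forall>\<^sub>F \<epsilon> in at_right 0. \<epsilon> \<in> E"
    unfolding E_def by (rule eventually_at_right_real[OF assms(2)])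
  have pat: "ring_pattern G (1 - \<epsilon>) (P \<epsilon>)" "ring_variables G (1 - \<epsilon>) (P \<epsilon>) (\<gamma> \<epsilon>)" if "\<epsilon> \<in> E" for \<epsilon>
    using assms(4) that unfolding E_def by blast+
  have RG: "ring_geometry G (1 - \<epsilon>) (P \<epsilon>)" if "\<epsilon> \<in> E" for \<epsilon>
    by (rule ring_pattern_geometry[OF G pat(1)[OF that]]) (use E[OF that] in simp)
  have rel: "q * cosh (outer_rad R v) = cosh (inner_rad R v)" if "ring_pattern G q R" "v \<in> white_vertices G" for q R v
    using that unfolding ring_pattern_def by blast
  note V0 = ring_variables_facts[OF assms(7) zero_less_one _ rel[OF assms(6)]]
  \<comment> \<open>At q = 1 the condition \<open>positive\<close> is not automatic; here it comes
    from \<open>cn\<close> being positive at modulus 1.\<close>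
  have "0 < inner_rad P0 v" if v: "v \<in> white_vertices G" for v
  proof -
    have "0 < sinh (inner_rad P0 v)"
      unfolding V0(5)[OF v v] using jacobi_cn_modulus_1_pos V0(1)[OF v v] by simp
    then show ?thesis by simp
  qed
  then have RG0: "ring_geometry G 1 P0" by (intro ring_pattern_geometry[OF G assms(6)]) blast
  have radii: "((\<lambda>\<epsilon>. cosh (inner_rad (P \<epsilon>) v)) \<longlongrightarrow> cosh (inner_rad P0 v)) (at_right 0)"
      "((\<lambda>\<epsilon>. sinh (inner_rad (P \<epsilon>) v)) \<longlongrightarrow> sinh (inner_rad P0 v)) (at_right 0)"
      "((\<lambda>\<epsilon>. cosh (outer_rad (P \<epsilon>) v)) \<longlongrightarrow> cosh (outer_rad P0 v)) (at_right 0)"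
      "((\<lambda>\<epsilon>. sinh (outer_rad (P \<epsilon>) v)) \<longlongrightarrow> sinh (outer_rad P0 v)) (at_right 0)" if v: "v \<in> white_vertices G" for v
  proof -
    have k: "((\<lambda>\<epsilon>::real. 1 - \<epsilon>) \<longlongrightarrow> 1) (at_right 0)" by (auto intro!: tendsto_eq_intros)
    have k1: "\<forall>\<^sub>F \<epsilon> in at_right 0. 0 \<le> 1 - \<epsilon> \<and> 1 - \<epsilon> < (1::real)"
      using evE by (rule eventually_mono) (use E in force)
    have "0 < \<gamma>0 v" using V0(1)[OF v v] jacobi_sn_modulus_1_pos_iff by simp
    note J = jacobi_tendsto[OF assms(8)[rule_format, OF v] this k k1]
    have sn0: "jacobi_sn (\<gamma>0 v) 1 \<noteq> 0" "1 * jacobi_sn (\<gamma>0 v) 1 \<noteq> 0" using V0(1)[OF v v] by simp_all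
    have V: "cosh (inner_rad (P \<epsilon>) v) = 1 / jacobi_sn (\<gamma> \<epsilon> v) (1 - \<epsilon>)"
      "sinh (inner_rad (P \<epsilon>) v) = jacobi_cn (\<gamma> \<epsilon> v) (1 - \<epsilon>) / jacobi_sn (\<gamma> \<epsilon> v) (1 - \<epsilon>)"
      "cosh (outer_rad (P \<epsilon>) v) = 1 / ((1 - \<epsilon>) * jacobi_sn (\<gamma> \<epsilon> v) (1 - \<epsilon>))"
      "sinh (outer_rad (P \<epsilon>) v) = jacobi_dn (\<gamma> \<epsilon> v) (1 - \<epsilon>) / ((1 - \<epsilon>) * jacobi_sn (\<gamma> \<epsilon> v) (1 - \<epsilon>))"
      if e: "\<epsilon> \<in> E" for \<epsilon>
      using ring_variables_facts[OF pat(2)[OF e] _ v rel[OF pat(1)[OF e] v]] E[OF e] by simp_all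
    have tr: "(f \<longlongrightarrow> l) (at_right 0)" if "(g \<longlongrightarrow> l) (at_right 0)" "\<And>\<epsilon>. \<epsilon> \<in> E \<Longrightarrow> f \<epsilon> = g \<epsilon>" for f g :: "real \<Rightarrow> real" and l
      by (rule Lim_transform_eventually[OF that(1)]) (use evE that(2) in \<open>auto elim: eventually_mono\<close>)
    show "((\<lambda>\<epsilon>. cosh (inner_rad (P \<epsilon>) v)) \<longlongrightarrow> cosh (inner_rad P0 v)) (at_right 0)"
      unfolding V0(4)[OF v v] by (rule tr[OF _ V(1)]) (intro tendsto_intros J sn0)
    show "((\<lambda>\<epsilon>. sinh (inner_rad (P \<epsilon>) v)) \<longlongrightarrow> sinh (inner_rad P0 v)) (at_right 0)"
      unfolding V0(5)[OF v v] by (rule tr[OF _ V(2)]) (intro tendsto_intros J sn0)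
    show "((\<lambda>\<epsilon>. cosh (outer_rad (P \<epsilon>) v)) \<longlongrightarrow> cosh (outer_rad P0 v)) (at_right 0)"
      unfolding V0(2)[OF v v] by (rule tr[OF _ V(3)]) (intro tendsto_intros J sn0 k)
    show "((\<lambda>\<epsilon>. sinh (outer_rad (P \<epsilon>) v)) \<longlongrightarrow> sinh (outer_rad P0 v)) (at_right 0)"
      unfolding V0(3)[OF v v] by (rule tr[OF _ V(4)]) (intro tendsto_intros J sn0 k)
  qed
  have RGM: "ring_geometry G (1 - \<epsilon>) (move_pattern (M \<epsilon>) (P \<epsilon>))" if "\<epsilon> \<in> E" "\<forall>\<epsilon>. hyperbolic_motion (M \<epsilon>)" for M \<epsilon>
    using ring_geometry_move[OF RG[OF that(1)]] that(2) by blast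
  have family: "pattern_family G (\<lambda>\<epsilon>. move_pattern (M \<epsilon>) (P \<epsilon>)) P0" if M: "\<forall>\<epsilon>. hyperbolic_motion (M \<epsilon>)" for M
  proof (rule pattern_family.intro)
    show "\<forall>\<^sub>F \<epsilon> in at_right 0. ring_geometry G (1 - \<epsilon>) (move_pattern (M \<epsilon>) (P \<epsilon>))"
      using evE by (rule eventually_mono) (rule RGM[OF _ M])
  qed (simp_all add: RG0 move_pattern_def radii)
  obtain v0 b0 where i0: "incident G v0 b0"
  proof -
    obtain Q where Q: "Q \<in> squares G" using G unfolding s_quad_graph_def by blast
    obtain k where "white G (corner Q k)" using white_corner_alternates[OF G Q] by blast
    then show thesis using square_quad[OF Q] quad_facts(1)[OF G] that by blast
  qed
  note w0 = incident_lattice_edge(4)[OF G i0]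
  have "\<exists>M. normalizing_motions G P P0 M"
  proof -
    have pt_in: "pt R b0 \<in> hyperbolic_plane" if "ring_pattern G q R" for q R
      using that i0 unfolding ring_pattern_def hcircle_def by blast
    \<comment> \<open>The motion brings the point and the radial direction at one incidence exactly
      to those of the limit pattern. The centre there then converges with its radius, and
      \<open>all_conv\<close> does the rest.\<close>
    have "\<exists>A. hyperbolic_motion A \<and> (\<epsilon> \<in> E \<longrightarrow> A *v pt (P \<epsilon>) b0 = pt P0 b0 \<and> A *v radial_dir G (P \<epsilon>) v0 b0 = radial_dir G P0 v0 b0)" for \<epsilon>
    proof (cases "\<epsilon> \<in> E")
      case True
      show ?thesis
        using frame_motion[OF ring_geometry.radial_dir(2)[OF RG[OF True] i0] ring_geometry.incident_lor(1)[OF RG[OF True] i0]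
            ring_geometry.radial_dir(1)[OF RG[OF True] i0] ring_geometry.radial_dir(2)[OF RG0 i0] ring_geometry.incident_lor(1)[OF RG0 i0]
            ring_geometry.radial_dir(1)[OF RG0 i0] pt_in[OF pat(1)[OF True]] pt_in[OF assms(6)]]
        by blast
    next
      case False
      then show ?thesis using hyperbolic_motion_1 by blast
    qed
    then obtain M where M: "\<forall>\<epsilon>. hyperbolic_motion (M \<epsilon>)"
      "\<And>\<epsilon>. \<epsilon> \<in> E \<Longrightarrow> M \<epsilon> *v pt (P \<epsilon>) b0 = pt P0 b0 \<and> M \<epsilon> *v radial_dir G (P \<epsilon>) v0 b0 = radial_dir G P0 v0 b0"
      by metis
    define Q where "Q \<epsilon> = move_pattern (M \<epsilon>) (P \<epsilon>)" for \<epsilon>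
    interpret pattern_family G Q P0 unfolding Q_def by (rule family[OF M(1)])
    have "pt_conv b0"
      by (rule Lim_transform_eventually[OF tendsto_const]) (use evE M(2) in \<open>auto simp: Q_def move_pattern_def elim: eventually_mono\<close>)
    moreover have "ctr_conv v0"
    proof (rule Lim_transform_eventually)
      show "((\<lambda>\<epsilon>. ring_cosh G (Q \<epsilon>) v0 b0 *\<^sub>R pt P0 b0 + ring_sinh G (Q \<epsilon>) v0 b0 *\<^sub>R radial_dir G P0 v0 b0) \<longlongrightarrow> ctr P0 v0) (at_right 0)"
        unfolding ring_geometry.radial_dir(3)[OF RG0 i0] by (intro tendsto_intros ring_tendsto[OF i0])
      have "ring_cosh G (Q \<epsilon>) v0 b0 *\<^sub>R pt P0 b0 + ring_sinh G (Q \<epsilon>) v0 b0 *\<^sub>R radial_dir G P0 v0 b0 = ctr (Q \<epsilon>) v0" if e: "\<epsilon> \<in> E" for \<epsilon>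
      proof -
        have "ctr (Q \<epsilon>) v0 = M \<epsilon> *v ctr (P \<epsilon>) v0" by (simp add: Q_def move_pattern_def)
        also have "\<dots> = M \<epsilon> *v (ring_cosh G (P \<epsilon>) v0 b0 *\<^sub>R pt (P \<epsilon>) b0 + ring_sinh G (P \<epsilon>) v0 b0 *\<^sub>R radial_dir G (P \<epsilon>) v0 b0)"
          using ring_geometry.radial_dir(3)[OF RG[OF e] i0] by simp
        also have "\<dots> = ring_cosh G (P \<epsilon>) v0 b0 *\<^sub>R pt P0 b0 + ring_sinh G (P \<epsilon>) v0 b0 *\<^sub>R radial_dir G P0 v0 b0"
          using M(2)[OF e] by (simp add: matrix_vector_right_distrib matrix_vector_mult_scaleR)
        finally show ?thesis by (simp add: Q_def move_pattern_def ring_cosh_def ring_sinh_def)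
      qed
      then show "\<forall>\<^sub>F \<epsilon> in at_right 0. ring_cosh G (Q \<epsilon>) v0 b0 *\<^sub>R pt P0 b0 + ring_sinh G (Q \<epsilon>) v0 b0 *\<^sub>R radial_dir G P0 v0 b0 = ctr (Q \<epsilon>) v0"
        using evE by (auto elim: eventually_mono)
    qed
    ultimately have conv: "ctr_conv v" if "incident G v b" for v b
      using all_conv(1)[OF i0 _ _ that] by blast
    have "normalizing_motions G P P0 M"
      unfolding normalizing_motions_def
    proof (intro conjI ballI)
      show "\<forall>\<epsilon>. hyperbolic_motion (M \<epsilon>)" by (rule M(1))
      fix v assume "v \<in> white_vertices G"
      then obtain b where "incident G v b" unfolding white_vertices_def incident_def by blast
      then show "((\<lambda>\<epsilon>. ctr (move_pattern (M \<epsilon>) (P \<epsilon>)) v) \<longlongrightarrow> ctr P0 v) (at_right 0)"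
        using conv unfolding Q_def by blast
    qed
    then show ?thesis by blast
  qed
  moreover have "\<exists>s s'.
        (\<forall>\<epsilon> \<in> {0<..<\<epsilon>0}.
          associated_cmc_pair G (1 - \<epsilon>) (move_pattern (M \<epsilon>) (P \<epsilon>)) (\<gamma> \<epsilon>) (s \<epsilon>) (s' \<epsilon>) \<and>
          s1_cmc_pair G (scale_map (1 / \<epsilon>) (s \<epsilon>)) (scale_map (1 / \<epsilon>) (s' \<epsilon>)) \<and>
          has_mean_curvature G (\<lambda>v. fst (scale_map (1 / \<epsilon>) (s \<epsilon>) v)) (gauss_map (s \<epsilon>) (s' \<epsilon>)) \<epsilon>) \<and>
        (\<exists>s0 s0'.
          surfaces_converge G s s0 \<and> spacelike_koebe_surface G s0 \<and>
          surfaces_converge G (\<lambda>\<epsilon>. scale_map (1 / \<epsilon>) (s' \<epsilon>)) s0' \<and>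
          christoffel_dual G s0 s0' \<and> s1_maximal G s0')"
    if norm: "normalizing_motions G P P0 M" for M
  proof -
    have M: "\<forall>\<epsilon>. hyperbolic_motion (M \<epsilon>)" using norm unfolding normalizing_motions_def by blast
    define Q where "Q \<epsilon> = move_pattern (M \<epsilon>) (P \<epsilon>)" for \<epsilon>
    interpret pattern_family G Q P0 unfolding Q_def by (rule family[OF M])
    interpret lim: ring_geometry G 1 P0 by (rule RG0)
    have RGQ: "ring_geometry G (1 - \<epsilon>) (Q \<epsilon>)" if "\<epsilon> \<in> E" for \<epsilon> unfolding Q_def by (rule RGM[OF that M])
    have conv: "ctr_conv v \<and> pt_conv b" if "incident G v b" for v b
      by (rule pt_conv_if_ctr_conv[OF _ that]) (use norm in \<open>simp add: normalizing_motions_def Q_def\<close>)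
    \<comment> \<open>One choice of orientations serves for all \<epsilon> and for the limit, so
      signed radii converge with the unsigned ones.\<close>
    obtain \<tau> where \<tau>: "edge_signs G \<tau>"
      using orientation_signs[OF G] unfolding edge_signs_def by metis
    have "\<exists>F. \<epsilon> \<in> E \<longrightarrow> dual_net G (1 - \<epsilon>) (Q \<epsilon>) F \<and> F v0 = 0" for \<epsilon>
      using dual_net_normalized[OF RGQ] by blast
    then obtain F where F: "\<And>\<epsilon>. \<epsilon> \<in> E \<Longrightarrow> dual_net G (1 - \<epsilon>) (Q \<epsilon>) (F \<epsilon>) \<and> F \<epsilon> v0 = 0" by metis
    obtain F0 where F0: "dual_net G 1 P0 F0" "F0 v0 = 0" using dual_net_normalized[OF RG0] by blast
    have F_conv: "((\<lambda>\<epsilon>. F \<epsilon> v) \<longlongrightarrow> F0 v) (at_right 0)" if "incident G v b" for v b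
    proof (rule dual_net_tendsto[OF _ F0(1) i0 _ conv that])
      show "\<forall>\<^sub>F \<epsilon> in at_right 0. dual_net G (1 - \<epsilon>) (Q \<epsilon>) (F \<epsilon>)"
        using evE by (rule eventually_mono) (use F in blast)
      show "((\<lambda>\<epsilon>. F \<epsilon> v0) \<longlongrightarrow> F0 v0) (at_right 0)"
        by (rule Lim_transform_eventually[OF tendsto_const]) (use evE F F0(2) in \<open>auto elim: eventually_mono\<close>)
    qed
    define s where "s \<epsilon> = signed_surface (ring_geometry.primal_net G (1 - \<epsilon>) (Q \<epsilon>) (F \<epsilon>)) \<tau> (vertex_rad (1 - \<epsilon>) (Q \<epsilon>))" for \<epsilon>
    \<comment> \<open>The dual surface is \<epsilon> times \<open>t \<epsilon>\<close>; its blow-up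
      is \<open>t \<epsilon>\<close> itself.\<close>
    define t where "t \<epsilon> = signed_surface (F \<epsilon>) \<tau> (ring_geometry.dual_rad (1 - \<epsilon>) (Q \<epsilon>))" for \<epsilon>
    define s0 where "s0 = signed_surface (lim.primal_net F0) \<tau> (vertex_rad 1 P0)"
    define t0 where "t0 = signed_surface F0 \<tau> lim.dual_rad"
    have pair: "associated_cmc_pair G (1 - \<epsilon>) (Q \<epsilon>) (\<gamma> \<epsilon>) (s \<epsilon>) (scale_map \<epsilon> (t \<epsilon>)) \<and>
          s1_cmc_pair G (scale_map (1 / \<epsilon>) (s \<epsilon>)) (scale_map (1 / \<epsilon>) (scale_map \<epsilon> (t \<epsilon>))) \<and>
          has_mean_curvature G (\<lambda>v. fst (scale_map (1 / \<epsilon>) (s \<epsilon>) v)) (gauss_map (s \<epsilon>) (scale_map \<epsilon> (t \<epsilon>))) \<epsilon>" if e: "\<epsilon> \<in> E" for \<epsilon>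
    proof -
      have e': "1 - (1 - \<epsilon>) = \<epsilon>" by simp
      have q1: "1 - \<epsilon> < 1" using E[OF e] by simp
      have r: "outer_rad (P \<epsilon>) = outer_rad (Q \<epsilon>)" "inner_rad (P \<epsilon>) = inner_rad (Q \<epsilon>)" by (simp_all add: Q_def move_pattern_def)
      note a = associated_pair[OF RGQ[OF e] q1 conjunct1[OF F[OF e]] \<tau> pat(2)[OF e] r, folded s_def t_def, unfolded e']
      show ?thesis using a by blast
    qed
    have svert: "\<exists>b. incident G v b" "v \<in> white_vertices G" if "v \<in> s_vertices G" for v
      using that unfolding s_vertices_def white_vertices_def incident_def by blast+
    have t_conv: "surfaces_converge G (\<lambda>\<epsilon>. scale_map (1 / \<epsilon>) (scale_map \<epsilon> (t \<epsilon>))) t0"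
      unfolding surfaces_converge_def
    proof
      fix v assume v: "v \<in> s_vertices G"
      then obtain b where b: "incident G v b" using svert by blast
      have w: "v \<in> white_vertices G" using svert[OF v] by blast
      have "((\<lambda>\<epsilon>. ring_geometry.dual_rad (1 - \<epsilon>) (Q \<epsilon>) v) \<longlongrightarrow> lim.dual_rad v) (at_right 0)"
      proof (rule Lim_transform_eventually)
        show "((\<lambda>\<epsilon>. dual_factor (1 - \<epsilon>) / vertex_rad (1 - \<epsilon>) (Q \<epsilon>) v) \<longlongrightarrow> lim.dual_rad v) (at_right 0)"
          unfolding lim.dual_rad_def by (intro tendsto_intros dual_factor_tendsto rad_tendsto[OF w]) (use lim.white(5)[OF w] in simp)
        show "\<forall>\<^sub>F \<epsilon> in at_right 0. dual_factor (1 - \<epsilon>) / vertex_rad (1 - \<epsilon>) (Q \<epsilon>) v = ring_geometry.dual_rad (1 - \<epsilon>) (Q \<epsilon>) v"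
          using evE by (rule eventually_mono) (simp add: ring_geometry.dual_rad_def[OF RGQ])
      qed
      then have "((\<lambda>\<epsilon>. t \<epsilon> v) \<longlongrightarrow> t0 v) (at_right 0)"
        unfolding t_def t0_def by (intro signed_surface_tendsto F_conv[OF b])
      moreover have "\<forall>\<^sub>F \<epsilon> in at_right 0. t \<epsilon> v = scale_map (1 / \<epsilon>) (scale_map \<epsilon> (t \<epsilon>)) v"
        using evE by (rule eventually_mono) (use E in \<open>force simp: scale_map_scale_map scale_map_1\<close>)
      ultimately show "((\<lambda>\<epsilon>. scale_map (1 / \<epsilon>) (scale_map \<epsilon> (t \<epsilon>)) v) \<longlongrightarrow> t0 v) (at_right 0)"
        by (rule Lim_transform_eventually)
    qed
    have s_conv: "surfaces_converge G s s0"
      unfolding surfaces_converge_def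
    proof
      fix v assume v: "v \<in> s_vertices G"
      then obtain b where b: "incident G v b" using svert by blast
      have w: "v \<in> white_vertices G" using svert[OF v] by blast
      have "((\<lambda>\<epsilon>. ring_geometry.primal_net G (1 - \<epsilon>) (Q \<epsilon>) (F \<epsilon>) v) \<longlongrightarrow> lim.primal_net F0 v) (at_right 0)"
      proof (rule Lim_transform_eventually)
        \<comment> \<open>The factors \<open>0\<close> and \<open>sqrt (1 - 0)\<close> give the
          limit the shape of the family, so that it can be taken term by term.\<close>
        have K: "lim.primal_net F0 v = 0 *\<^sub>R F0 v + (sqrt (1 - 0) / cosh (inner_rad P0 v)) *\<^sub>R ctr P0 v"
          using lim.primal_minus_dual[OF F0(1) \<tau> v] by simp
        have c: "ctr_conv v" "cosh (inner_rad P0 v) \<noteq> 0" using conv[OF b] by simp_all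
        show "((\<lambda>\<epsilon>. \<epsilon> *\<^sub>R F \<epsilon> v + (sqrt (1 - \<epsilon>) / cosh (inner_rad (Q \<epsilon>) v)) *\<^sub>R ctr (Q \<epsilon>) v) \<longlongrightarrow> lim.primal_net F0 v) (at_right 0)"
          unfolding K by (intro tendsto_intros F_conv[OF b] radii(1)[OF w] c)
        have "\<epsilon> *\<^sub>R F \<epsilon> v + (sqrt (1 - \<epsilon>) / cosh (inner_rad (Q \<epsilon>) v)) *\<^sub>R ctr (Q \<epsilon>) v = ring_geometry.primal_net G (1 - \<epsilon>) (Q \<epsilon>) (F \<epsilon>) v"
          if e: "\<epsilon> \<in> E" for \<epsilon>
          using ring_geometry.primal_minus_dual[OF RGQ[OF e] conjunct1[OF F[OF e]] \<tau> v] by (simp add: algebra_simps)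
        then show "\<forall>\<^sub>F \<epsilon> in at_right 0. \<epsilon> *\<^sub>R F \<epsilon> v + (sqrt (1 - \<epsilon>) / cosh (inner_rad (Q \<epsilon>) v)) *\<^sub>R ctr (Q \<epsilon>) v = ring_geometry.primal_net G (1 - \<epsilon>) (Q \<epsilon>) (F \<epsilon>) v"
          using evE by (auto elim: eventually_mono)
      qed
      then show "((\<lambda>\<epsilon>. s \<epsilon> v) \<longlongrightarrow> s0 v) (at_right 0)"
        unfolding s_def s0_def by (intro signed_surface_tendsto rad_tendsto[OF w])
    qed
    have koebe: "spacelike_koebe_surface G s0"
      unfolding s0_def by (rule lim.primal_koebe[OF F0(1) \<tau> refl])
    have dual: "christoffel_dual G s0 t0" "christoffel_dual G t0 s0" "s1_isothermic G t0"
      using lim.scaled_dual[OF F0(1) \<tau> zero_less_one zero_less_one] lim.scaled_isothermic(2)[OF F0(1) \<tau> zero_less_one]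
      by (simp_all add: scale_map_1 s0_def t0_def)
    then have max: "s1_maximal G t0" using koebe unfolding s1_maximal_def by blast
    show ?thesis
    proof (rule exI[of _ s], rule exI[of _ "\<lambda>\<epsilon>. scale_map \<epsilon> (t \<epsilon>)"], rule conjI)
      show "\<forall>\<epsilon> \<in> {0<..<\<epsilon>0}.
          associated_cmc_pair G (1 - \<epsilon>) (move_pattern (M \<epsilon>) (P \<epsilon>)) (\<gamma> \<epsilon>) (s \<epsilon>) (scale_map \<epsilon> (t \<epsilon>)) \<and>
          s1_cmc_pair G (scale_map (1 / \<epsilon>) (s \<epsilon>)) (scale_map (1 / \<epsilon>) (scale_map \<epsilon> (t \<epsilon>))) \<and>
          has_mean_curvature G (\<lambda>v. fst (scale_map (1 / \<epsilon>) (s \<epsilon>) v)) (gauss_map (s \<epsilon>) (scale_map \<epsilon> (t \<epsilon>))) \<epsilon>"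
        using pair unfolding E_def Q_def by (rule ballI)
    qed (intro exI[of _ s0] exI[of _ t0] conjI s_conv koebe t_conv dual(1) max)
  qed
  ultimately show ?thesis by blast
qed

end
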